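(* Let $d\ge 1$, $s\in(0,1)$, $0<\lambda<\Lambda$. There exist $\alpha\in(0,2s)$ and $C>0$, depending only on $d,s,\lambda,\Lambda$ (in particular not on $\rho$ or $R$), such that the following holds. Let $\rho>0$, $R>\rho$, and let $K(x,y,t)\ge 0$ be a kernel, measurable in $y$, satisfying $$\lambda\min\{|y|^{-d-2s},\rho^{-d-2s}\}\le K(x,y,t)\le \Lambda |y|^{-d-2s}$$ for all $y\in\mathbb R^d\setminus\{0\}$ and all $(x,t)$, and, if $s=1/2$, also $K(x,y,t)=K(x,-y,t)$. Let $L$ be the operator $$Lu(x,t)=\int_{\mathbb R^d}\delta_y u(x,t)\,K(x,y,t)\,dy .$$ Let $f\in L^\infty(B_R\times I_R)$ and let $u\in L^\infty(\mathbb R^d\times I_R)$ be a viscosity solution of $\partial_t u-Lu=f$ in $B_R\times I_R$. Then $$\sup_{\substack{(x,t),(y,\tau)\in B_{R/2}\times I_{R/2}\\ d((x,t),(y,\tau))>\rho}}\frac{|u(x,t)-u(y,\tau)|}{d((x,t),(y,\tau))^\alpha}\le \frac{C}{R^\alpha}\left(\|u\|_{L^\infty(\mathbb R^d\times I_R)}+R^{2s}\|f\|_{L^\infty(B_R\times I_R)}\right).$$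
   Context: Notation: $B_R(x)=\{y\in\mathbb R^d: |x-y|<R\}$, $B_R=B_R(0)$, $I_R=(-R^{2s},0]$, and $d((x,t),(y,\tau))=\max\{|x-y|,|t-\tau|^{1/(2s)}\}$ is the parabolic distance. The difference operator acts in the space variable: $\delta_y u(x,t)=u(x+y,t)-u(x,t)$ if $s<1/2$; $\delta_y u(x,t)=u(x+y,t)-u(x,t)-y\cdot\nabla u(x,t)\mathbf 1_{B_1}(y)$ if $s=1/2$; $\delta_y u(x,t)=u(x+y,t)-u(x,t)-y\cdot\nabla u(x,t)$ if $s>1/2$. Since functions are evaluated pointwise, $L^\infty(\mathbb R^d\times I)$ means bounded Borel measurable functions defined everywhere, with the supremum norm (similarly for $f$). Viscosity solutions: let $\Omega\subseteq\mathbb R^d$ be a domain, $I\subseteq(-\infty,0]$ a left-open interval, $f:\Omega\times I\to\mathbb R$; $\partial_t$ denotes the left derivative in time. A function $u\in L^\infty(\mathbb R^d\times I)$ that is upper semicontinuous in $\Omega\times I$ satisfies $\partial_tu-Lu\le f$ in $\Omega\times I$ in the viscosity sense if for every $(x_0,t_0)\in\Omega\times I$, every $\varepsilon>0$ with $B_\varepsilon(x_0)\times(t_0-\varepsilon,t_0]\subseteq\Omega\times I$ and every $\varphi:B_\varepsilon(x_0)\times(t_0-\varepsilon,t_0]\to\mathbb R$ that is left-differentiable in time and $C^{1,1}$ in space with $u(x_0,t_0)=\varphi(x_0,t_0)$ and $u\le\varphi$ in $B_\varepsilon(x_0)\times(t_0-\varepsilon,t_0]$, the function $v$ equal to $\varphi$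 in $B_\varepsilon(x_0)\times(t_0-\varepsilon,t_0]$ and to $u$ elsewhere in $\mathbb R^d\times I$ satisfies $\partial_tv(x_0,t_0)-Lv(x_0,t_0)\le f(x_0,t_0)$. A function $u\in L^\infty(\mathbb R^d\times I)$ that is lower semicontinuous in $\Omega\times I$ satisfies $\partial_tu-Lu\ge f$ in the viscosity sense if the same holds with $u\ge\varphi$ in place of $u\le\varphi$ and $\partial_tv(x_0,t_0)-Lv(x_0,t_0)\ge f(x_0,t_0)$ as conclusion. A viscosity solution of $\partial_tu-Lu=f$ is a function satisfying both (in particular it is continuous in $\Omega\times I$). *)

theory Defs
  imports "HOL-Analysis.Analysis"
begin

text \<open>Space-time functions have type \<open>'a \<times> real \<Rightarrow> real\<close> with \<open>'a\<close> Euclidean of dimension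
  \<open>d = DIM('a)\<close>. They are total, but only their values on the stated domains matter.\<close>

definition time_interval :: "real \<Rightarrow> real \<Rightarrow> real set" where
  "time_interval s R = {- (R powr (2 * s)) <.. 0}"

definition par_dist :: "real \<Rightarrow> 'a::euclidean_space \<times> real \<Rightarrow> 'a \<times> real \<Rightarrow> real" where
  "par_dist s p q = max (norm (fst p - fst q)) (\<bar>snd p - snd q\<bar> powr (1 / (2 * s)))"

text \<open>Everywhere defined bounded Borel functions with the supremum norm; there is no quotient
  by null sets, since viscosity solutions are evaluated pointwise.\<close>

definition Linfty :: "('b::topological_space) set \<Rightarrow> ('b \<Rightarrow> real) set" where
  "Linfty S = {g. g \<in> borel_measurable (restrict_space borel S) \<and> bounded (g ` S)}"

definition Linfty_norm :: "'b set \<Rightarrow> ('b \<Rightarrow> real) \<Rightarrow> real" where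
  "Linfty_norm S g = (SUP p\<in>S. \<bar>g p\<bar>)"

definition usc_on :: "('b::topological_space) set \<Rightarrow> ('b \<Rightarrow> real) \<Rightarrow> bool" where
  "usc_on S g \<longleftrightarrow> (\<forall>p\<in>S. \<forall>c>g p. \<forall>\<^sub>F q in at p within S. g q < c)"

definition lsc_on :: "('b::topological_space) set \<Rightarrow> ('b \<Rightarrow> real) \<Rightarrow> bool" where
  "lsc_on S g \<longleftrightarrow> (\<forall>p\<in>S. \<forall>c<g p. \<forall>\<^sub>F q in at p within S. c < g q)"

text \<open>The two derivatives below are only meaningful where they exist; this is the case at every
  point at which they are evaluated in the definition of viscosity solutions.\<close>

definition space_grad :: "('a::euclidean_space \<times> real \<Rightarrow> real) \<Rightarrow> 'a \<times> real \<Rightarrow> 'a" where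
  "space_grad v p = (THE g. GDERIV (\<lambda>x. v (x, snd p)) (fst p) :> g)"

definition left_dt :: "('a \<times> real \<Rightarrow> real) \<Rightarrow> 'a \<times> real \<Rightarrow> real" where
  "left_dt v p = (THE D. ((\<lambda>t. v (fst p, t)) has_real_derivative D) (at_left (snd p)))"

definition diff_op ::
    "real \<Rightarrow> 'a::euclidean_space \<Rightarrow> ('a \<times> real \<Rightarrow> real) \<Rightarrow> 'a \<times> real \<Rightarrow> real" where
  "diff_op s y v p = v (fst p + y, snd p) - v p -
     (if s < 1/2 then 0
      else if s = 1/2 then (y \<bullet> space_grad v p) * indicator (ball 0 1) y
      else y \<bullet> space_grad v p)"

text \<open>The value of a kernel at \<open>y = 0\<close> is irrelevant for the operator.\<close>

definition admissible_kernel ::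
    "real \<Rightarrow> real \<Rightarrow> real \<Rightarrow> real \<Rightarrow> ('a::euclidean_space \<Rightarrow> 'a \<Rightarrow> real \<Rightarrow> real) \<Rightarrow> bool" where
  "admissible_kernel s lam Lam \<rho> K \<longleftrightarrow>
     (\<forall>x t. (\<lambda>y. K x y t) \<in> borel_measurable lebesgue) \<and>
     (\<forall>x t y. y \<noteq> 0 \<longrightarrow>
        0 \<le> K x y t \<and>
        lam * min (norm y powr (- real DIM('a) - 2 * s)) (\<rho> powr (- real DIM('a) - 2 * s)) \<le> K x y t \<and>
        K x y t \<le> Lam * norm y powr (- real DIM('a) - 2 * s)) \<and>
     (s = 1/2 \<longrightarrow> (\<forall>x t y. K x y t = K x (- y) t))"

definition nonlocal_op ::
    "real \<Rightarrow> ('a::euclidean_space \<Rightarrow> 'a \<Rightarrow> real \<Rightarrow> real) \<Rightarrow> ('a \<times> real \<Rightarrow> real) \<Rightarrow> 'a \<times> real \<Rightarrow> real" where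
  "nonlocal_op s K v p = (LINT y|lebesgue. diff_op s y v p * K (fst p) y (snd p))"

definition cylinder :: "real \<Rightarrow> 'a::euclidean_space \<times> real \<Rightarrow> ('a \<times> real) set" where
  "cylinder \<epsilon> p = ball (fst p) \<epsilon> \<times> {snd p - \<epsilon> <.. snd p}"

definition C11_on :: "'a::euclidean_space set \<Rightarrow> ('a \<Rightarrow> real) \<Rightarrow> bool" where
  "C11_on B g \<longleftrightarrow> (\<exists>G M. (\<forall>x\<in>B. GDERIV g x :> G x) \<and> M-lipschitz_on B G)"

definition test_function ::
    "real \<Rightarrow> 'a::euclidean_space \<times> real \<Rightarrow> ('a \<times> real \<Rightarrow> real) \<Rightarrow> bool" where
  "test_function \<epsilon> p \<phi> \<longleftrightarrow>
     (\<forall>(x, t)\<in>cylinder \<epsilon> p. \<exists>D. ((\<lambda>\<tau>. \<phi> (x, \<tau>)) has_real_derivative D) (at_left t)) \<and>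
     (\<forall>t\<in>{snd p - \<epsilon> <.. snd p}. C11_on (ball (fst p) \<epsilon>) (\<lambda>x. \<phi> (x, t)))"

definition glue :: "'b set \<Rightarrow> ('b \<Rightarrow> real) \<Rightarrow> ('b \<Rightarrow> real) \<Rightarrow> 'b \<Rightarrow> real" where
  "glue Q \<phi> u = (\<lambda>q. if q \<in> Q then \<phi> q else u q)"

definition viscosity_subsolution ::
    "real \<Rightarrow> ('a::euclidean_space \<Rightarrow> 'a \<Rightarrow> real \<Rightarrow> real) \<Rightarrow> 'a set \<Rightarrow> real set \<Rightarrow>
     ('a \<times> real \<Rightarrow> real) \<Rightarrow> ('a \<times> real \<Rightarrow> real) \<Rightarrow> bool" where
  "viscosity_subsolution s K \<Omega> I f u \<longleftrightarrow>
     u \<in> Linfty (UNIV \<times> I) \<and> usc_on (\<Omega> \<times> I) u \<and>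
     (\<forall>p\<in>\<Omega> \<times> I. \<forall>\<epsilon>>0. \<forall>\<phi>.
        cylinder \<epsilon> p \<subseteq> \<Omega> \<times> I \<and> test_function \<epsilon> p \<phi> \<and>
        u p = \<phi> p \<and> (\<forall>q\<in>cylinder \<epsilon> p. u q \<le> \<phi> q) \<longrightarrow>
        (let v = glue (cylinder \<epsilon> p) \<phi> u in left_dt v p - nonlocal_op s K v p \<le> f p))"

definition viscosity_supersolution ::
    "real \<Rightarrow> ('a::euclidean_space \<Rightarrow> 'a \<Rightarrow> real \<Rightarrow> real) \<Rightarrow> 'a set \<Rightarrow> real set \<Rightarrow>
     ('a \<times> real \<Rightarrow> real) \<Rightarrow> ('a \<times> real \<Rightarrow> real) \<Rightarrow> bool" where
  "viscosity_supersolution s K \<Omega> I f u \<longleftrightarrow>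
     u \<in> Linfty (UNIV \<times> I) \<and> lsc_on (\<Omega> \<times> I) u \<and>
     (\<forall>p\<in>\<Omega> \<times> I. \<forall>\<epsilon>>0. \<forall>\<phi>.
        cylinder \<epsilon> p \<subseteq> \<Omega> \<times> I \<and> test_function \<epsilon> p \<phi> \<and>
        u p = \<phi> p \<and> (\<forall>q\<in>cylinder \<epsilon> p. u q \<ge> \<phi> q) \<longrightarrow>
        (let v = glue (cylinder \<epsilon> p) \<phi> u in left_dt v p - nonlocal_op s K v p \<ge> f p))"

definition viscosity_solution ::
    "real \<Rightarrow> ('a::euclidean_space \<Rightarrow> 'a \<Rightarrow> real \<Rightarrow> real) \<Rightarrow> 'a set \<Rightarrow> real set \<Rightarrow>
     ('a \<times> real \<Rightarrow> real) \<Rightarrow> ('a \<times> real \<Rightarrow> real) \<Rightarrow> bool" where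
  "viscosity_solution s K \<Omega> I f u \<longleftrightarrow>
     viscosity_subsolution s K \<Omega> I f u \<and> viscosity_supersolution s K \<Omega> I f u"

text \<open>The supremum is taken in the extended reals, so that it needs no boundedness side condition.\<close>

definition holder_above ::
    "real \<Rightarrow> real \<Rightarrow> real \<Rightarrow> ('a::euclidean_space \<times> real) set \<Rightarrow> ('a \<times> real \<Rightarrow> real) \<Rightarrow> ereal" where
  "holder_above s \<alpha> \<rho> Q u =
     (SUP (p, q)\<in>{(p, q). p \<in> Q \<and> q \<in> Q \<and> par_dist s p q > \<rho>}.
        ereal (\<bar>u p - u q\<bar> / par_dist s p q powr \<alpha>))"

end

theory Submission
  imports Defs
begin

text \<open>The proof is Silvestre's barrier argument for nonlocal parabolic equations. Its regularizing mechanism is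
the pointwise lower bound of the kernel: through it, the operator at a single touching point sees the
values of \<open>u\<close> in a whole ball at the same time.

\<^bold>\<open>One scale.\<close> Suppose that \<open>A \<le> u \<le> B\<close> in the parabolic cylinder
of radius \<open>2 r\<close> around \<open>(x0, t0)\<close>, with controlled growth outside. For each
time \<open>t\<close> put \<open>g t = \<integral> B - u (x, t) dx\<close> over the ball with radius
\<open>r\<close>. The masses of \<open>B - u\<close> and \<open>u - A\<close> add up to
\<open>B - A\<close> times the volume, so on the first half of the time interval one of them is at least
one half of that; replacing \<open>u\<close> by \<open>- u\<close> if necessary, let it be the first.
Solve \<open>m' = \<kappa> g - L m\<close>, \<open>m = 0\<close> initially
(\<open>damped_growth\<close>), and compare \<open>u\<close> with
\<open>B + (small slope) (t - initial time) - m t * bump ((x - x0) / r)\<close>. If \<open>u\<close> is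
somewhere above this barrier, then a raised copy of the barrier touches \<open>u\<close> from above, and
the equation at the touching point is contradicted: the jumps into the ball contribute
\<open>- \<kappa> g\<close>, which outweighs the term \<open>\<kappa> g * bump\<close> from
\<open>m' * bump\<close>, while \<open>L m * bump\<close> pays for the action of the operator on the
bump. Hence \<open>u\<close> stays below the barrier, and in the second half of the time interval this is
a definite improvement of the upper bound (\<open>point_estimate\<close>,
\<open>oscillation_step\<close>). Using the mass \<open>g\<close>, which is continuous in time, and not
the measure of a level set makes \<open>m\<close> differentiable everywhere, as a test function must be.

\<^bold>\<open>The barrier.\<close> The decisive property is that the operator lowers the bump at a rate
at most proportional to the bump itself, even where the bump is small (\<open>bump_is_barrier\<close>).
Near the boundary of its support the bump loses little, as its gradient is at most a multiple of its
square root, and it gains a fixed positive amount from the jumps into the middle of the ball. That gain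
is where the lower bound of the kernel is used; it concerns jumps of length up to \<open>2 r\<close>
only, for which truncation at \<open>\<rho>\<close> is harmless once \<open>\<rho> \<le> r\<close>.

\<^bold>\<open>Iteration.\<close> The scales are \<open>q ^ k * r0\<close>, as long as they are at least
\<open>\<rho>\<close>, and the oscillation at step \<open>k\<close> is
\<open>A0 * (q powr \<alpha>) ^ k\<close> (\<open>oscillation_decay\<close>). The growth of
\<open>u\<close> outside a cylinder is governed by the oscillation at the earlier scales, so it is that
of a power \<open>\<alpha>\<close>; for small \<open>\<alpha>\<close> this is a small perturbation in the
one-scale estimate. Two points whose distance \<open>d\<close> exceeds \<open>\<rho>\<close> are compared
at the last scale that is at least \<open>d\<close> (\<open>holder_from_decay\<close>).

All estimates are made at scale \<open>r\<close> directly and for a fixed kernel slice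
\<open>y \<mapsto> K x y t\<close>. So viscosity solutions are never rescaled, which for
\<open>s = 1/2\<close> would interfere with the cutoff of the gradient term at radius one.\<close>

section \<open>Integrals of powers of the norm\<close>

lemma lebesgue_integral_affine_isometry:
  fixes f :: "'a::euclidean_space \<Rightarrow> real" and \<sigma> :: real
  assumes "f \<in> borel_measurable lebesgue" and "\<bar>\<sigma>\<bar> = 1"
  shows "(LINT y|lebesgue. f (a + \<sigma> *\<^sub>R y)) = (LINT y|lebesgue. f y)"
    and "integrable lebesgue (\<lambda>y. f (a + \<sigma> *\<^sub>R y)) \<longleftrightarrow> integrable lebesgue f"
    and "(\<lambda>y. f (a + \<sigma> *\<^sub>R y)) \<in> borel_measurable lebesgue"
proof -
  define T where "T = (\<lambda>x::'a. a + (\<Sum>j\<in>Basis. (\<sigma> * (x \<bullet> j)) *\<^sub>R j))"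
  have T: "T x = a + \<sigma> *\<^sub>R x" for x
    by (simp add: T_def mult.commute scaleR_sum_right[symmetric] scaleR_scaleR[symmetric]
        euclidean_representation del: scaleR_scaleR)
  have meas: "T \<in> lebesgue \<rightarrow>\<^sub>M lebesgue"
    unfolding T_def using assms(2) by (intro lebesgue_affine_measurable) auto
  have "lebesgue = density (distr lebesgue lebesgue T) (\<lambda>_. (\<Prod>j\<in>(Basis::'a set). \<bar>\<sigma>\<bar>))"
    unfolding T_def using assms(2) by (intro lebesgue_affine_euclidean) auto
  then have eq: "distr lebesgue lebesgue T = lebesgue"
    using assms(2) by (simp add: density_1)
  show "(LINT y|lebesgue. f (a + \<sigma> *\<^sub>R y)) = (LINT y|lebesgue. f y)"
    using integral_distr[OF meas, of f] assms(1) by (simp add: eq T)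
  show "integrable lebesgue (\<lambda>y. f (a + \<sigma> *\<^sub>R y)) \<longleftrightarrow> integrable lebesgue f"
    using integrable_distr_eq[OF meas, of f] assms(1) by (simp add: eq T)
  show "(\<lambda>y. f (a + \<sigma> *\<^sub>R y)) \<in> borel_measurable lebesgue"
    using measurable_compose[OF meas assms(1)] by (simp add: T)
qed

lemma AE_lebesgue_nonzero: "AE y in lebesgue. (y::'a::euclidean_space) \<noteq> 0"
proof -
  have "{0::'a} \<in> null_sets lebesgue"
    by (simp add: negligible_iff_null_sets[symmetric])
  then show ?thesis
    using AE_not_in[of "{0::'a}" lebesgue] by simp
qed

lemma norm_powr_measurable [measurable]:
  "(\<lambda>y::'a::euclidean_space. norm y powr e) \<in> borel_measurable lebesgue"
  by (intro measurable_completion) measurable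

lemma ball_lebesgue_sets [measurable]:
  "ball 0 r \<in> sets lebesgue" "- ball (0::'a::euclidean_space) r \<in> sets lebesgue"
  by (auto intro!: sets_completionI_sets)

text \<open>Almost everywhere, \<open>h\<close> is at most the sum of the functions that are \<open>c k\<close> on
the ball of radius \<open>\<rho> k\<close> and zero elsewhere, and \<open>S\<close> is the integral of
this sum.\<close>

lemma integral_le_weighted_balls:
  fixes h :: "'a::euclidean_space \<Rightarrow> real"
  assumes h: "h \<in> borel_measurable lebesgue" "\<And>y. 0 \<le> h y"
    and c: "\<And>k. 0 \<le> c k" and \<rho>: "\<And>k. 0 \<le> \<rho> k"
    and dom: "\<And>y. y \<noteq> 0 \<Longrightarrow> 0 < h y \<Longrightarrow> \<exists>k::nat. norm y < \<rho> k \<and> h y \<le> c k"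
    and S: "(\<lambda>k. c k * (unit_ball_vol (real DIM('a)) * \<rho> k ^ DIM('a))) sums S"
  shows "integrable lebesgue h" "(LINT y|lebesgue. h y) \<le> S"
proof -
  have pos: "0 \<le> c k * (unit_ball_vol (real DIM('a)) * \<rho> k ^ DIM('a))" for k
    using c \<rho> by simp
  have pt: "ennreal (h y) \<le> (\<Sum>k. ennreal (c k) * indicator (ball 0 (\<rho> k)) y)" if y: "y \<noteq> 0" for y
  proof (cases "0 < h y")
    case True
    then obtain k where k: "norm y < \<rho> k" "h y \<le> c k" using dom[OF y] by blast
    have "ennreal (h y) \<le> ennreal (c k) * indicator (ball 0 (\<rho> k)) y"
      using k by (simp add: ennreal_leI)
    also have "\<dots> \<le> (\<Sum>k. ennreal (c k) * indicator (ball 0 (\<rho> k)) y)"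
      using sum_le_suminf[of "\<lambda>k. ennreal (c k) * indicator (ball 0 (\<rho> k)) y" "{k}"]
      unfolding sum.insert_if[OF finite.emptyI] by fastforce
    finally show ?thesis .
  next
    case False
    then have "h y = 0" using h(2)[of y] by simp
    then show ?thesis by simp
  qed
  have "(\<integral>\<^sup>+y. ennreal (h y) \<partial>lebesgue) \<le>
      (\<integral>\<^sup>+(y::'a). (\<Sum>k. ennreal (c k) * indicator (ball 0 (\<rho> k)) y) \<partial>lebesgue)"
    by (rule nn_integral_mono_AE) (rule eventually_mono[OF AE_lebesgue_nonzero pt])
  also have "\<dots> = (\<Sum>k. \<integral>\<^sup>+(y::'a). ennreal (c k) * indicator (ball 0 (\<rho> k)) y \<partial>lebesgue)"
    by (intro nn_integral_suminf) auto
  also have "\<dots> = (\<Sum>k. ennreal (c k * (unit_ball_vol (real DIM('a)) * \<rho> k ^ DIM('a))))"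
    using c \<rho> by (simp add: nn_integral_cmult_indicator emeasure_ball ennreal_mult)
  also have "\<dots> = ennreal S"
    using S pos by (simp add: suminf_ennreal2 sums_iff)
  finally have le: "(\<integral>\<^sup>+y. ennreal (h y) \<partial>lebesgue) \<le> ennreal S" .
  show int: "integrable lebesgue h"
    using h le by (intro integrableI_nonneg) (auto simp: ennreal_less_top order_le_less_trans)
  have "0 \<le> S" using S pos suminf_nonneg unfolding sums_iff by blast
  moreover have "ennreal (LINT y|lebesgue. h y) \<le> ennreal S"
    using le nn_integral_eq_integral[OF int] h(2) by simp
  ultimately show "(LINT y|lebesgue. h y) \<le> S" by simp
qed

text \<open>The sum of the geometric series that arises when the integrand is frozen on dyadic shells. The same
constant serves for the singularity at the origin and for the decay at infinity.\<close>

definition dyadic_const :: "'a::euclidean_space itself \<Rightarrow> real \<Rightarrow> real" where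
  "dyadic_const _ a = unit_ball_vol (real DIM('a)) * 2 ^ DIM('a) / (1 - 2 powr (- a))"

lemma dyadic_const_pos: "0 < a \<Longrightarrow> 0 < dyadic_const TYPE('a::euclidean_space) a"
  by (simp add: dyadic_const_def powr_minus_divide divide_simps)

lemma geometric_powr_sums:
  assumes "0 < (a::real)"
  shows "(\<lambda>k. (2 powr (- a)) ^ k) sums (1 / (1 - 2 powr (- a)))"
  using assms by (intro geometric_sums) (simp add: powr_minus_divide)

text \<open>On the shell of outer radius \<open>r / 2 ^ k\<close> the integrand is at most its value with the
positive power taken at the outer and the negative power at the inner radius.\<close>

lemma inner_power_integral:
  fixes r a :: real
  assumes "0 < r" "0 < a"
  shows "integrable lebesgue (\<lambda>y::'a::euclidean_space. norm y powr (a - real DIM('a)) * indicator (ball 0 r) y)"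
    and "(LINT y|lebesgue. norm (y::'a) powr (a - real DIM('a)) * indicator (ball 0 r) y)
          \<le> dyadic_const TYPE('a) a * r powr a"
proof -
  let ?n = "real DIM('a)" and ?w = "unit_ball_vol (real DIM('a))"
  define \<rho> c where "\<rho> k = r / 2 ^ k" and "c k = \<rho> k powr a * (\<rho> k / 2) powr (- ?n)" for k :: nat
  have \<rho>: "0 < \<rho> k" for k using assms by (simp add: \<rho>_def)
  have "c k * (?w * \<rho> k ^ DIM('a)) = ?w * 2 ^ DIM('a) * r powr a * (2 powr (- a)) ^ k" for k
  proof -
    have "c k * \<rho> k ^ DIM('a) = 2 ^ DIM('a) * \<rho> k powr a"
      using \<rho>[of k] by (simp add: c_def powr_minus powr_realpow power_divide field_simps)
    moreover have "\<rho> k powr a = r powr a * (2 powr (- a)) ^ k"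
      using assms by (simp add: \<rho>_def powr_divide powr_minus field_simps power_inverse
          powr_powr mult.commute flip: powr_realpow)
    ultimately show ?thesis by (metis (no_types, lifting) mult.assoc mult.left_commute)
  qed
  then have "(\<lambda>k. c k * (?w * \<rho> k ^ DIM('a))) sums
      (?w * 2 ^ DIM('a) * r powr a * (1 / (1 - 2 powr (- a))))"
    by (simp only: sums_mult[OF geometric_powr_sums[OF assms(2)]])
  then have sums: "(\<lambda>k. c k * (?w * \<rho> k ^ DIM('a))) sums (dyadic_const TYPE('a) a * r powr a)"
    by (simp add: dyadic_const_def)
  have dom: "\<exists>k. norm y < \<rho> k \<and> norm y powr (a - ?n) * indicator (ball 0 r) y \<le> c k"
    if y: "y \<noteq> 0" "0 < norm y powr (a - ?n) * indicator (ball 0 r) y" for y :: 'a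
  proof -
    have yr: "norm y < r" using y by (cases "norm y < r") auto
    define k where "k = (LEAST k. \<rho> (Suc k) \<le> norm y)"
    have "\<exists>k. \<rho> (Suc k) \<le> norm y"
    proof -
      obtain n where "(1/2::real) ^ n < norm y / r"
        using real_arch_pow_inv[of "norm y / r" "1/2"] y assms by auto
      then have "\<rho> n < norm y" using assms by (simp add: \<rho>_def field_simps power_divide)
      moreover have "\<rho> (Suc n) \<le> \<rho> n" using assms by (simp add: \<rho>_def field_simps)
      ultimately show ?thesis by (meson less_le_trans less_imp_le order_trans)
    qed
    then have k1: "\<rho> (Suc k) \<le> norm y" unfolding k_def by (rule LeastI_ex)
    have k2: "norm y < \<rho> k"
    proof (cases k)
      case 0 then show ?thesis using yr by (simp add: \<rho>_def)
    next
      case (Suc j)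
      then have "\<not> \<rho> (Suc j) \<le> norm y" using not_less_Least[of j "\<lambda>k. \<rho> (Suc k) \<le> norm y"] k_def by simp
      then show ?thesis using Suc by simp
    qed
    have half: "\<rho> (Suc k) = \<rho> k / 2" by (simp add: \<rho>_def)
    have "norm y powr (a - ?n) = norm y powr a * norm y powr (- ?n)" by (simp flip: powr_add)
    also have "\<dots> \<le> \<rho> k powr a * (\<rho> k / 2) powr (- ?n)"
      using k1 k2 half \<rho>[of k] assms
      by (intro mult_mono powr_mono2 powr_mono2') auto
    finally show ?thesis using k2 by (auto simp: c_def indicator_def)
  qed
  note main = integral_le_weighted_balls[of "\<lambda>y::'a. norm y powr (a - real DIM('a)) * indicator (ball 0 r) y" c \<rho>, OF _ _ _ _ dom sums]
  show "integrable lebesgue (\<lambda>y::'a. norm y powr (a - real DIM('a)) * indicator (ball 0 r) y)"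
    using \<rho> by (intro main(1)) (auto simp: c_def less_imp_le)
  show "(LINT y|lebesgue. norm (y::'a) powr (a - real DIM('a)) * indicator (ball 0 r) y) \<le> dyadic_const TYPE('a) a * r powr a"
    using \<rho> by (intro main(2)) (auto simp: c_def less_imp_le)
qed

lemma outer_power_integral:
  fixes r a :: real
  assumes "0 < r" "0 < a"
  shows "integrable lebesgue (\<lambda>y::'a::euclidean_space. norm y powr (- real DIM('a) - a) * indicator (- ball 0 r) y)"
    and "(LINT y|lebesgue. norm (y::'a) powr (- real DIM('a) - a) * indicator (- ball 0 r) y)
          \<le> dyadic_const TYPE('a) a * r powr (- a)"
proof -
  let ?n = "real DIM('a)" and ?w = "unit_ball_vol (real DIM('a))"
  define \<rho> c where "\<rho> k = 2 * (r * 2 ^ k)" and "c k = (r * 2 ^ k) powr (- ?n - a)" for k :: nat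
  have \<rho>: "0 < \<rho> k" for k using assms by (simp add: \<rho>_def)
  have "c k * (?w * \<rho> k ^ DIM('a)) = ?w * 2 ^ DIM('a) * r powr (- a) * (2 powr (- a)) ^ k" for k
  proof -
    have "c k = (r * 2 ^ k) powr (- a) / (r * 2 ^ k) ^ DIM('a)"
      using assms by (simp add: c_def powr_diff powr_minus powr_realpow field_simps)
    then have "c k * \<rho> k ^ DIM('a) = 2 ^ DIM('a) * (r * 2 ^ k) powr (- a)"
      using assms by (simp add: \<rho>_def power_mult_distrib)
    moreover have "(r * 2 ^ k) powr (- a) = r powr (- a) * (2 powr (- a)) ^ k"
      using assms by (simp add: powr_mult powr_powr mult.commute flip: powr_realpow)
    ultimately show ?thesis by (metis (no_types, lifting) mult.assoc mult.left_commute)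
  qed
  then have "(\<lambda>k. c k * (?w * \<rho> k ^ DIM('a))) sums
      (?w * 2 ^ DIM('a) * r powr (- a) * (1 / (1 - 2 powr (- a))))"
    by (simp only: sums_mult[OF geometric_powr_sums[OF assms(2)]])
  then have sums: "(\<lambda>k. c k * (?w * \<rho> k ^ DIM('a))) sums (dyadic_const TYPE('a) a * r powr (- a))"
    by (simp add: dyadic_const_def)
  have dom: "\<exists>k. norm y < \<rho> k \<and> norm y powr (- ?n - a) * indicator (- ball 0 r) y \<le> c k"
    if y: "y \<noteq> 0" "0 < norm y powr (- ?n - a) * indicator (- ball 0 r) y" for y :: 'a
  proof -
    have yr: "r \<le> norm y" using y by (cases "norm y < r") auto
    define k where "k = (LEAST k. norm y < \<rho> k)"
    have "\<exists>k. norm y < \<rho> k"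
    proof -
      obtain n where "norm y / (2 * r) < 2 ^ n"
        using real_arch_pow[of 2 "norm y / (2 * r)"] by auto
      then show ?thesis using assms by (auto simp: \<rho>_def field_simps)
    qed
    then have k1: "norm y < \<rho> k" unfolding k_def by (rule LeastI_ex)
    have k2: "r * 2 ^ k \<le> norm y"
    proof (cases k)
      case 0 then show ?thesis using yr by simp
    next
      case (Suc j)
      then have "\<not> norm y < \<rho> j" using not_less_Least[of j "\<lambda>k. norm y < \<rho> k"] k_def by simp
      then show ?thesis using Suc by (simp add: \<rho>_def)
    qed
    have "norm y powr (- ?n - a) \<le> c k"
      unfolding c_def using k2 assms by (intro powr_mono2') auto
    then show ?thesis using k1 by (auto simp: c_def indicator_def)
  qed
  note main = integral_le_weighted_balls[of "\<lambda>y::'a. norm y powr (- real DIM('a) - a) * indicator (- ball 0 r) y" c \<rho>, OF _ _ _ _ dom sums]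
  show "integrable lebesgue (\<lambda>y::'a. norm y powr (- real DIM('a) - a) * indicator (- ball 0 r) y)"
    using \<rho> by (intro main(1)) (auto simp: c_def less_imp_le)
  show "(LINT y|lebesgue. norm (y::'a) powr (- real DIM('a) - a) * indicator (- ball 0 r) y) \<le> dyadic_const TYPE('a) a * r powr (- a)"
    using \<rho> by (intro main(2)) (auto simp: c_def less_imp_le)
qed

section \<open>A bump function whose gradient is controlled by its square root\<close>

text \<open>The square makes the function \<open>C\<^sup>1\<^sup>,\<^sup>1\<close> across the unit sphere, and it
makes the gradient at most a multiple of the square root of the function, which is what the barrier
estimate relies on.\<close>

definition bump :: "'a::euclidean_space \<Rightarrow> real" where
  "bump z = (max 0 (1 - z \<bullet> z))\<^sup>2"

definition bump_grad :: "'a::euclidean_space \<Rightarrow> 'a" where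
  "bump_grad z = (- 4 * max 0 (1 - z \<bullet> z)) *\<^sub>R z"

lemma bump_nonneg: "0 \<le> bump z"
  by (simp add: bump_def)

lemma bump_le_1: "bump z \<le> 1"
  unfolding bump_def by (intro power_le_one) auto

lemma bump_eq_0: "1 \<le> norm z \<Longrightarrow> bump z = 0"
  using power_mono[of 1 "norm z" 2] by (simp add: bump_def dot_square_norm)

lemma bump_ge: assumes "norm z \<le> 1/2" shows "9/16 \<le> bump z"
proof -
  have "(norm z)\<^sup>2 \<le> (1/2)\<^sup>2" using assms by (intro power_mono) auto
  then have "z \<bullet> z \<le> 1/4" by (simp add: dot_square_norm power2_eq_square)
  then have "3/4 \<le> max 0 (1 - z \<bullet> z)" by linarith
  then have "(3/4)\<^sup>2 \<le> (max 0 (1 - z \<bullet> z))\<^sup>2" by (rule power_mono) simp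
  moreover have "(3/4)\<^sup>2 = (9/16::real)" by (simp add: power2_eq_square)
  ultimately show ?thesis unfolding bump_def by metis
qed

text \<open>A nonnegative function with Lipschitz gradient always satisfies such a bound; for this bump it can be
read off.\<close>

lemma norm_bump_grad_le: "norm (bump_grad z) \<le> 4 * sqrt (bump z)"
proof (cases "norm z \<le> 1")
  case True
  have "norm (bump_grad z) = 4 * max 0 (1 - z \<bullet> z) * norm z"
    by (simp add: bump_grad_def abs_mult)
  also have "\<dots> \<le> 4 * max 0 (1 - z \<bullet> z) * 1"
    using True by (intro mult_left_mono) auto
  finally show ?thesis by (simp add: bump_def)
next
  case False
  then have "max 0 (1 - z \<bullet> z) = 0"
    using power_mono[of 1 "norm z" 2] by (simp add: dot_square_norm)
  then show ?thesis by (simp add: bump_grad_def bump_nonneg)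
qed

text \<open>Convexity of the squared positive part, and the bound of its second derivative by that of the square.\<close>

lemma pos_part_square_bounds:
  fixes a b :: real
  shows "(max 0 a)\<^sup>2 + 2 * max 0 a * (b - a) \<le> (max 0 b)\<^sup>2"
    and "(max 0 b)\<^sup>2 \<le> (max 0 a)\<^sup>2 + 2 * max 0 a * (b - a) + (b - a)\<^sup>2"
proof -
  have "max 0 a * (b - a) \<le> max 0 a * (max 0 b - max 0 a)"
    by (cases "0 \<le> a") (auto intro: mult_left_mono)
  moreover have "0 \<le> (max 0 b - max 0 a)\<^sup>2" by simp
  ultimately show "(max 0 a)\<^sup>2 + 2 * max 0 a * (b - a) \<le> (max 0 b)\<^sup>2"
    by (simp add: power2_eq_square algebra_simps)
  have "(max 0 b)\<^sup>2 \<le> (max 0 a + (b - a))\<^sup>2"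
  proof (cases "0 \<le> b")
    case True then show ?thesis by (intro power_mono) auto
  qed simp
  then show "(max 0 b)\<^sup>2 \<le> (max 0 a)\<^sup>2 + 2 * max 0 a * (b - a) + (b - a)\<^sup>2"
    by (simp add: power2_sum)
qed

text \<open>The lower bound holds for all increments and has no error from the kink, because the squared positive
part is convex: only the concavity of \<open>1 - z \<bullet> z\<close> enters.\<close>

lemma bump_expansion:
  fixes z w :: "'a::euclidean_space"
  shows "bump z + w \<bullet> bump_grad z - 2 * (norm w)\<^sup>2 \<le> bump (z + w)"
    and "norm w \<le> 1 \<Longrightarrow> bump (z + w) \<le> bump z + w \<bullet> bump_grad z + 25 * (norm w)\<^sup>2"
proof -
  let ?a = "1 - z \<bullet> z" and ?b = "1 - (z + w) \<bullet> (z + w)"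
  have ba: "?b - ?a = - (2 * (z \<bullet> w)) - (norm w)\<^sup>2"
    by (simp add: inner_add inner_commute dot_square_norm[symmetric] algebra_simps)
  have grad: "w \<bullet> bump_grad z = 2 * max 0 ?a * (- (2 * (z \<bullet> w)))"
    by (simp add: bump_grad_def inner_commute)
  have a: "max 0 ?a \<le> 1" by auto
  have a2: "2 * max 0 ?a * (norm w)\<^sup>2 \<le> 2 * (norm w)\<^sup>2"
    using mult_right_mono[OF a, of "2 * (norm w)\<^sup>2"] by simp
  have exp: "2 * max 0 ?a * (?b - ?a) = w \<bullet> bump_grad z - 2 * max 0 ?a * (norm w)\<^sup>2"
    unfolding grad ba by (simp only: right_diff_distrib)
  show "bump z + w \<bullet> bump_grad z - 2 * (norm w)\<^sup>2 \<le> bump (z + w)"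
    using pos_part_square_bounds(1)[of ?a ?b] a2 exp unfolding bump_def by linarith
  show "bump (z + w) \<le> bump z + w \<bullet> bump_grad z + 25 * (norm w)\<^sup>2" if w: "norm w \<le> 1"
  proof (cases "norm z \<le> 2")
    case True
    have "\<bar>?b - ?a\<bar> \<le> 2 * \<bar>z \<bullet> w\<bar> + (norm w)\<^sup>2"
      unfolding ba using zero_le_power2[of "norm w"] by linarith
    also have "\<dots> \<le> 2 * (2 * norm w) + 1 * norm w"
    proof -
      have "\<bar>z \<bullet> w\<bar> \<le> norm z * norm w" by (rule Cauchy_Schwarz_ineq2)
      also have "\<dots> \<le> 2 * norm w" using True by (intro mult_right_mono) auto
      finally show ?thesis using mult_right_mono[OF w, of "norm w"]
        by (simp add: power2_eq_square)
    qed
    finally have "\<bar>?b - ?a\<bar> \<le> 5 * norm w" by simp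
    then have "\<bar>?b - ?a\<bar>\<^sup>2 \<le> (5 * norm w)\<^sup>2" by (intro power_mono) auto
    then have "(?b - ?a)\<^sup>2 \<le> 25 * (norm w)\<^sup>2" by (simp add: power_mult_distrib)
    moreover have "0 \<le> 2 * max 0 ?a * (norm w)\<^sup>2" by simp
    ultimately show ?thesis
      using pos_part_square_bounds(2)[of ?b ?a] exp unfolding bump_def by linarith
  next
    case False
    then have "1 \<le> norm z" "1 \<le> norm (z + w)"
      using w norm_triangle_ineq4[of "z + w" w] by auto
    moreover from this have "bump_grad z = 0"
      using norm_bump_grad_le[of z] bump_eq_0[of z] by simp
    ultimately show ?thesis by (simp add: bump_eq_0)
  qed
qed

lemma bump_Lipschitz:
  fixes z w :: "'a::euclidean_space"
  shows "\<bar>bump (z + w) - bump z\<bar> \<le> 4 * norm w"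
proof -
  have clamp: "max 0 (1 - x \<bullet> x) = 1 - (min 1 (norm x))\<^sup>2" for x :: 'a
  proof (cases "norm x \<le> 1")
    case True
    then have "(norm x)\<^sup>2 \<le> 1" by (simp add: power_le_one)
    then show ?thesis using True by (simp add: dot_square_norm)
  next
    case False
    then show ?thesis using power_mono[of 1 "norm x" 2] by (simp add: dot_square_norm)
  qed
  let ?a = "min 1 (norm z)" and ?b = "min 1 (norm (z + w))"
  have ab: "0 \<le> ?a" "?a \<le> 1" "0 \<le> ?b" "?b \<le> 1" by auto
  then have sq: "?a\<^sup>2 \<le> 1" "?b\<^sup>2 \<le> 1" by (auto intro: power_le_one)
  have "\<bar>?a - ?b\<bar> \<le> norm w"
    using norm_triangle_ineq3[of z "z + w"] by (auto simp: min_def norm_minus_commute)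
  moreover have "bump (z + w) - bump z = (2 - ?a\<^sup>2 - ?b\<^sup>2) * (?a + ?b) * (?a - ?b)"
    unfolding bump_def clamp by (simp add: power2_eq_square algebra_simps)
  moreover have "\<bar>(2 - ?a\<^sup>2 - ?b\<^sup>2) * (?a + ?b)\<bar> \<le> 2 * 2"
    unfolding abs_mult using ab sq by (intro mult_mono) auto
  ultimately show ?thesis by (simp add: abs_mult mult_mono del: abs_mult_pos)
qed

lemma bump_taylor:
  fixes z w :: "'a::euclidean_space"
  assumes "norm w \<le> 1"
  shows "\<bar>bump (z + w) - bump z - w \<bullet> bump_grad z\<bar> \<le> 25 * (norm w)\<^sup>2"
  using bump_expansion(1)[of z w] bump_expansion(2)[OF assms, of z] zero_le_power2[of "norm w"]
  by (simp add: abs_le_iff)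

lemma GDERIV_bump: "GDERIV bump z :> bump_grad z"
  unfolding gderiv_def
proof (rule has_derivativeI_sandwich[of 1])
  show "bounded_linear (\<lambda>h. h \<bullet> bump_grad z)" by (rule bounded_linear_inner_left)
  fix y assume y: "y \<noteq> z" "dist y z < 1"
  have "\<bar>bump y - bump z - (y - z) \<bullet> bump_grad z\<bar> \<le> 25 * (norm (y - z))\<^sup>2"
    using bump_taylor[of "y - z" z] y by (simp add: dist_norm)
  then show "norm (bump y - bump z - (y - z) \<bullet> bump_grad z) / norm (y - z) \<le> 25 * norm (y - z)"
    using y by (simp add: divide_le_eq power2_eq_square mult.assoc)
next
  show "((\<lambda>y. 25 * norm (y - z)) \<longlongrightarrow> 0) (at z)"
    by (auto intro!: tendsto_eq_intros)
qed auto

lemma bump_grad_Lipschitz: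
  assumes "0 \<le> B"
  shows "(4 + 8 * B\<^sup>2)-lipschitz_on (cball 0 B) (bump_grad :: 'a::euclidean_space \<Rightarrow> 'a)"
proof (rule lipschitz_onI)
  fix z w :: 'a assume zw: "z \<in> cball 0 B" "w \<in> cball 0 B"
  let ?a = "max 0 (1 - z \<bullet> z)" and ?b = "max 0 (1 - w \<bullet> w)"
  have "z \<bullet> z - w \<bullet> w = (z - w) \<bullet> (z + w)"
    by (simp add: inner_add inner_diff inner_commute)
  then have "\<bar>?a - ?b\<bar> \<le> \<bar>(z - w) \<bullet> (z + w)\<bar>" by auto
  also have "\<dots> \<le> norm (z - w) * norm (z + w)" by (rule Cauchy_Schwarz_ineq2)
  also have "\<dots> \<le> norm (z - w) * (2 * B)"
    using zw norm_triangle_ineq[of z w] by (intro mult_left_mono) auto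
  finally have ab: "\<bar>?a - ?b\<bar> \<le> norm (z - w) * (2 * B)" .
  have "bump_grad z - bump_grad w = - ((4 * ?a) *\<^sub>R (z - w) + (4 * (?a - ?b)) *\<^sub>R w)"
    by (simp add: bump_grad_def algebra_simps)
  then have "norm (bump_grad z - bump_grad w) \<le> norm ((4 * ?a) *\<^sub>R (z - w)) + norm ((4 * (?a - ?b)) *\<^sub>R w)"
    by (metis norm_minus_cancel norm_triangle_ineq)
  also have "\<dots> \<le> 4 * norm (z - w) + (4 * (norm (z - w) * (2 * B))) * B"
    unfolding norm_scaleR abs_mult using ab zw assms
    by (intro add_mono mult_mono) auto
  finally show "dist (bump_grad z) (bump_grad w) \<le> (4 + 8 * B\<^sup>2) * dist z w"
    by (simp add: dist_norm algebra_simps power2_eq_square)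
qed (use assms in auto)

section \<open>Viscosity inequalities with an explicit gradient and time derivative\<close>

text \<open>The factor of the gradient term. In the case \<open>s = 1/2\<close> the cutoff radius is a parameter,
since by symmetry of the kernel it may be adapted to the scale at which the operator is estimated.\<close>

definition cutoff :: "real \<Rightarrow> real \<Rightarrow> 'a::euclidean_space \<Rightarrow> real" where
  "cutoff s \<rho> y = (if s < 1/2 then 0 else if s = 1/2 then indicator (ball 0 \<rho>) y else 1)"

definition kernel_upper :: "real \<Rightarrow> real \<Rightarrow> ('a::euclidean_space \<Rightarrow> real) \<Rightarrow> bool" where
  "kernel_upper s Lam k \<longleftrightarrow> k \<in> borel_measurable lebesgue \<and>
     (\<forall>y. y \<noteq> 0 \<longrightarrow> 0 \<le> k y \<and> k y \<le> Lam * norm y powr (- real DIM('a) - 2 * s))"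

text \<open>The order in \<open>norm y\<close> of an increment of a smooth function after subtraction of the gradient
term prescribed for \<open>s\<close>; it always exceeds \<open>2 * s\<close>, so that the operator
converges at the origin.\<close>

definition taylor_order :: "real \<Rightarrow> real" where
  "taylor_order s = (if s < 1/2 then 1 else 2)"

lemma taylor_order_gt: "s < 1 \<Longrightarrow> 0 < taylor_order s - 2 * s"
  by (simp add: taylor_order_def)

lemma cutoff_measurable [measurable]: "cutoff s \<rho> \<in> borel_measurable lebesgue"
  unfolding cutoff_def[abs_def] by measurable

lemma cutoff_bounds: "0 \<le> cutoff s \<rho> y" "cutoff s \<rho> y \<le> 1"
  by (auto simp: cutoff_def indicator_def)

lemma inner_measurable_lebesgue [measurable]: "(\<lambda>y::'a::euclidean_space. y \<bullet> g) \<in> borel_measurable lebesgue"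
  by (intro measurable_completion) measurable

text \<open>Near the origin the integrand is controlled by the power \<open>taylor_order s\<close>. Away from it the
increment is bounded, and the gradient term grows linearly only if \<open>1/2 < s\<close>, when the
kernel decays fast enough to compensate this. Integrability has to be proved wherever an operator is to
be estimated, as the Bochner integral of a nonintegrable function is zero.\<close>

lemma increment_integrable:
  fixes h k :: "'a::euclidean_space \<Rightarrow> real"
  assumes s: "0 < s" "s < 1" and k: "kernel_upper s Lam k" and "0 \<le> Lam"
    and h: "h \<in> borel_measurable lebesgue" "\<And>y. \<bar>h y\<bar> \<le> B"
    and near: "\<And>y. norm y < \<epsilon> \<Longrightarrow> \<bar>h y - h0 - y \<bullet> g\<bar> \<le> M * (norm y)\<^sup>2"
    and pos: "0 < \<epsilon>" "0 < \<rho>"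
  shows "integrable lebesgue (\<lambda>y. (h y - h0 - cutoff s \<rho> y * (y \<bullet> g)) * k y)"
proof -
  let ?n = "real DIM('a)" and ?p = "taylor_order s"
  have [measurable]: "k \<in> borel_measurable lebesgue" using k by (simp add: kernel_upper_def)
  note [measurable] = h(1)
  define \<delta> where "\<delta> = min 1 (min \<epsilon> \<rho>)"
  have \<delta>: "0 < \<delta>" "\<delta> \<le> 1" "\<delta> \<le> \<epsilon>" "\<delta> \<le> \<rho>" using pos by (auto simp: \<delta>_def)
  define m where "m = \<bar>M\<bar> + norm g"
  define c where "c = B + \<bar>h0\<bar> + \<rho> * norm g"
  define c' where "c' = (if 1/2 < s then norm g else 0)"
  have B: "0 \<le> B" using h(2)[of 0] by linarith
  have nonneg: "0 \<le> m" "0 \<le> c" "0 \<le> c'" using B pos by (auto simp: m_def c_def c'_def)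
  define H where "H y = Lam * m * (norm y powr ((?p - 2 * s) - ?n) * indicator (ball 0 \<delta>) y)
      + Lam * c * (norm y powr (- ?n - 2 * s) * indicator (- ball 0 \<delta>) y)
      + Lam * c' * (norm y powr (- ?n - (2 * s - 1)) * indicator (- ball 0 \<delta>) y)" for y :: 'a
  have "integrable lebesgue (\<lambda>y::'a. Lam * c' * (norm y powr (- ?n - (2 * s - 1)) * indicator (- ball 0 \<delta>) y))"
  proof (cases "1/2 < s")
    case True
    then show ?thesis
      using outer_power_integral(1)[of \<delta> "2 * s - 1", where 'a='a] \<delta> by (intro integrable_mult_right) auto
  next
    case False then show ?thesis by (simp add: c'_def)
  qed
  then have H: "integrable lebesgue H"
    unfolding H_def
    using inner_power_integral(1)[of \<delta> "?p - 2 * s", where 'a='a] taylor_order_gt[of s]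
      outer_power_integral(1)[of \<delta> "2 * s", where 'a='a] \<delta> s
    by (intro Bochner_Integration.integrable_add integrable_mult_right) auto
  have bound: "norm ((h y - h0 - cutoff s \<rho> y * (y \<bullet> g)) * k y) \<le> H y" if y: "y \<noteq> 0" for y
  proof -
    have ky: "0 \<le> k y" "k y \<le> Lam * norm y powr (- ?n - 2 * s)"
      using k y by (auto simp: kernel_upper_def)
    have yg: "\<bar>y \<bullet> g\<bar> \<le> norm y * norm g" by (rule Cauchy_Schwarz_ineq2)
    have step: "norm ((h y - h0 - cutoff s \<rho> y * (y \<bullet> g)) * k y) \<le> a * (Lam * norm y powr (- ?n - 2 * s))"
      if "\<bar>h y - h0 - cutoff s \<rho> y * (y \<bullet> g)\<bar> \<le> a" for a
      using that ky by (auto simp: abs_mult intro!: mult_mono)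
    show ?thesis
    proof (cases "norm y < \<delta>")
      case True
      have y2: "(norm y)\<^sup>2 \<le> norm y"
        using True \<delta> by (simp add: power2_eq_square mult_left_le)
      have q: "\<bar>h y - h0 - y \<bullet> g\<bar> \<le> \<bar>M\<bar> * (norm y)\<^sup>2"
        using near[of y] True \<delta> mult_right_mono[of M "\<bar>M\<bar>" "(norm y)\<^sup>2"] by (smt (verit) abs_ge_self zero_le_power2)
      have "\<bar>h y - h0 - cutoff s \<rho> y * (y \<bullet> g)\<bar> \<le> m * norm y powr ?p"
      proof (cases "s < 1/2")
        case True
        have "\<bar>h y - h0\<bar> \<le> \<bar>M\<bar> * norm y + norm y * norm g"
          using q yg mult_left_mono[OF y2, of "\<bar>M\<bar>"] by linarith
        then show ?thesis using True y by (simp add: cutoff_def taylor_order_def m_def algebra_simps)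
      next
        case False
        then have "cutoff s \<rho> y = 1" using \<open>norm y < \<delta>\<close> \<delta> by (simp add: cutoff_def)
        moreover have "\<bar>M\<bar> * (norm y)\<^sup>2 \<le> m * (norm y)\<^sup>2"
          by (intro mult_right_mono) (auto simp: m_def)
        ultimately have "\<bar>h y - h0 - cutoff s \<rho> y * (y \<bullet> g)\<bar> \<le> m * (norm y)\<^sup>2"
          using q by (simp only: mult_1)
        then show ?thesis using False y by (simp add: taylor_order_def powr_numeral)
      qed
      from step[OF this] have "norm ((h y - h0 - cutoff s \<rho> y * (y \<bullet> g)) * k y)
          \<le> Lam * m * (norm y powr ?p * norm y powr (- ?n - 2 * s))" by (simp add: mult_ac)
      also have "norm y powr ?p * norm y powr (- ?n - 2 * s) = norm y powr ((?p - 2 * s) - ?n)"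
        by (simp add: algebra_simps flip: powr_add)
      finally show ?thesis using True by (simp add: H_def)
    next
      case False
      have "\<bar>h y - h0 - cutoff s \<rho> y * (y \<bullet> g)\<bar> \<le> \<bar>h y\<bar> + \<bar>h0\<bar> + cutoff s \<rho> y * \<bar>y \<bullet> g\<bar>"
        using cutoff_bounds[of s \<rho> y] abs_mult[of "cutoff s \<rho> y" "y \<bullet> g"] by linarith
      also have "cutoff s \<rho> y * \<bar>y \<bullet> g\<bar> \<le> \<rho> * norm g + c' * norm y"
      proof -
        consider "s < 1/2" | "s = 1/2" | "1/2 < s" by linarith
        then show ?thesis
        proof cases
          case 2
          have "indicator (ball 0 \<rho>) y * \<bar>y \<bullet> g\<bar> \<le> \<rho> * norm g"
          proof (cases "norm y < \<rho>")
            case True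
            then have "norm y * norm g \<le> \<rho> * norm g" by (intro mult_right_mono) auto
            then show ?thesis using yg True by simp
          qed (use pos in simp)
          then show ?thesis using 2 by (simp add: cutoff_def c'_def)
        qed (use pos yg in \<open>auto simp: cutoff_def c'_def mult.commute intro: add_increasing\<close>)
      qed
      finally have "\<bar>h y - h0 - cutoff s \<rho> y * (y \<bullet> g)\<bar> \<le> c + c' * norm y"
        using h(2)[of y] by (simp add: c_def)
      from step[OF this] have "norm ((h y - h0 - cutoff s \<rho> y * (y \<bullet> g)) * k y)
          \<le> Lam * c * norm y powr (- ?n - 2 * s) + Lam * c' * (norm y powr 1 * norm y powr (- ?n - 2 * s))"
        using y by (simp add: algebra_simps)
      also have "norm y powr 1 * norm y powr (- ?n - 2 * s) = norm y powr (- ?n - (2 * s - 1))"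
        unfolding powr_add[symmetric] by (simp add: algebra_simps)
      finally show ?thesis using False by (simp add: H_def)
    qed
  qed
  show ?thesis
    by (rule Bochner_Integration.integrable_bound[OF H])
      (measurable, rule eventually_mono[OF AE_lebesgue_nonzero],
        use bound in \<open>force intro: order_trans[OF _ abs_ge_self]\<close>)
qed

text \<open>Only the case \<open>s = 1/2\<close> has content, and there the integrand is odd.\<close>

lemma gradient_cutoff_irrelevant:
  fixes k :: "'a::euclidean_space \<Rightarrow> real"
  assumes k: "k \<in> borel_measurable lebesgue" and sym: "s = 1/2 \<Longrightarrow> \<forall>y. k y = k (- y)"
  shows "(LINT y|lebesgue. (cutoff s \<rho> y - cutoff s \<rho>' y) * (y \<bullet> g) * k y) = 0"
proof (cases "s = 1/2")
  case True
  let ?F = "\<lambda>y. (cutoff s \<rho> y - cutoff s \<rho>' y) * (y \<bullet> g) * k y"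
  note [measurable] = k
  have odd: "?F (0 + (-1) *\<^sub>R y) = - ?F y" for y
    using sym[OF True] by (simp add: cutoff_def indicator_def)
  have "(LINT y|lebesgue. ?F (0 + (-1) *\<^sub>R y)) = (LINT y|lebesgue. ?F y)"
    by (rule lebesgue_integral_affine_isometry(1)) auto
  then have "- (LINT y|lebesgue. ?F y) = (LINT y|lebesgue. ?F y)"
    unfolding odd by simp
  then show ?thesis by simp
next
  case False
  then have "cutoff s \<rho> y = cutoff s \<rho>' y" for y :: 'a by (simp add: cutoff_def)
  then show ?thesis by simp
qed

text \<open>The form in which viscosity sub- and supersolutions are used. The derivatives of the test function are
given by witnesses, not by definite descriptions, so that replacing \<open>u\<close> by
\<open>- u\<close> is harmless and both halves of the notion of solution become instances of one
property. The cutoff radius for \<open>s = 1/2\<close> is free, and integrability is part of the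
conclusion.\<close>

definition viscosity_inequality ::
    "real \<Rightarrow> ('a::euclidean_space \<Rightarrow> 'a \<Rightarrow> real \<Rightarrow> real) \<Rightarrow> 'a set \<Rightarrow> real set \<Rightarrow>
     ('a \<times> real \<Rightarrow> real) \<Rightarrow> ('a \<times> real \<Rightarrow> real) \<Rightarrow> bool" where
  "viscosity_inequality s K \<Omega> I f u \<longleftrightarrow>
     (\<forall>x t \<epsilon> \<phi> D g M \<rho>.
        (x, t) \<in> \<Omega> \<times> I \<longrightarrow> 0 < \<epsilon> \<longrightarrow> 0 < \<rho> \<longrightarrow> cylinder \<epsilon> (x, t) \<subseteq> \<Omega> \<times> I \<longrightarrow>
        test_function \<epsilon> (x, t) \<phi> \<longrightarrow>
        ((\<lambda>\<tau>. \<phi> (x, \<tau>)) has_real_derivative D) (at_left t) \<longrightarrow>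
        GDERIV (\<lambda>x. \<phi> (x, t)) x :> g \<longrightarrow>
        (\<forall>y. norm y < \<epsilon> \<longrightarrow> \<bar>\<phi> (x + y, t) - \<phi> (x, t) - y \<bullet> g\<bar> \<le> M * (norm y)\<^sup>2) \<longrightarrow>
        u (x, t) = \<phi> (x, t) \<longrightarrow> (\<forall>q\<in>cylinder \<epsilon> (x, t). u q \<le> \<phi> q) \<longrightarrow>
        integrable lebesgue (\<lambda>y. (glue (cylinder \<epsilon> (x, t)) \<phi> u (x + y, t) - \<phi> (x, t)
            - cutoff s \<rho> y * (y \<bullet> g)) * K x y t) \<and>
        D - (LINT y|lebesgue. (glue (cylinder \<epsilon> (x, t)) \<phi> u (x + y, t) - \<phi> (x, t)
            - cutoff s \<rho> y * (y \<bullet> g)) * K x y t) \<le> f (x, t))"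

lemma glue_increment_integrable:
  fixes K :: "'a::euclidean_space \<Rightarrow> 'a \<Rightarrow> real \<Rightarrow> real"
  assumes s: "0 < s" "s < 1" "0 < lam" "lam < Lam" and K: "admissible_kernel s lam Lam r K"
    and u: "u \<in> Linfty (UNIV \<times> I)" and xt: "t \<in> I" and pos: "0 < \<epsilon>" "0 < \<rho>"
    and test: "test_function \<epsilon> (x, t) \<phi>"
    and quad: "\<And>y. norm y < \<epsilon> \<Longrightarrow> \<bar>\<phi> (x + y, t) - \<phi> (x, t) - y \<bullet> g\<bar> \<le> M * (norm y)\<^sup>2"
  shows "integrable lebesgue (\<lambda>y. (glue (cylinder \<epsilon> (x, t)) \<phi> u (x + y, t) - \<phi> (x, t)
            - cutoff s \<rho> y * (y \<bullet> g)) * K x y t)"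
proof -
  let ?h = "\<lambda>y. glue (cylinder \<epsilon> (x, t)) \<phi> u (x + y, t)"
  have cyl: "(x + y, t) \<in> cylinder \<epsilon> (x, t) \<longleftrightarrow> norm y < \<epsilon>" for y
    using pos by (simp add: cylinder_def dist_norm)
  have k: "kernel_upper s Lam (\<lambda>y. K x y t)"
    using K by (simp add: kernel_upper_def admissible_kernel_def)
  obtain B where B: "\<And>q. q \<in> UNIV \<times> I \<Longrightarrow> \<bar>u q\<bar> \<le> B"
    using u by (auto simp: Linfty_def bounded_iff)
  have um: "(\<lambda>y. u (x + y, t)) \<in> borel_measurable borel"
  proof -
    have "(\<lambda>y. (x + y, t)) \<in> borel \<rightarrow>\<^sub>M restrict_space borel (UNIV \<times> I)"
      using xt by (intro measurable_restrict_space2) auto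
    then show ?thesis using u measurable_compose by (fastforce simp: Linfty_def)
  qed
  have "C11_on (ball x \<epsilon>) (\<lambda>x. \<phi> (x, t))"
    using test pos by (simp add: test_function_def)
  then have "continuous_on (ball x \<epsilon>) (\<lambda>x. \<phi> (x, t))"
    unfolding C11_on_def gderiv_def
    by (meson continuous_at_imp_continuous_on has_derivative_continuous)
  then have "continuous_on (ball 0 \<epsilon>) (\<lambda>y. \<phi> (x + y, t))"
    by (auto intro!: continuous_on_compose2[of "ball x \<epsilon>" "\<lambda>x. \<phi> (x, t)"] continuous_intros simp: dist_norm)
  then have pm: "(\<lambda>y. if y \<in> ball 0 \<epsilon> then \<phi> (x + y, t) else 0) \<in> borel_measurable borel"
    using borel_measurable_continuous_on_if[of "ball (0::'a) \<epsilon>" "\<lambda>y. \<phi> (x + y, t)" "\<lambda>_. 0"] by auto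
  have "?h = (\<lambda>y. if y \<in> ball 0 \<epsilon> then (if y \<in> ball 0 \<epsilon> then \<phi> (x + y, t) else 0) else u (x + y, t))"
    by (auto simp: glue_def cyl)
  also have "\<dots> \<in> borel_measurable borel"
    by (rule measurable_If_set[OF pm um]) auto
  finally have hm: "?h \<in> borel_measurable lebesgue" by (intro measurable_completion) simp
  have hb: "\<bar>?h y\<bar> \<le> B + \<bar>\<phi> (x, t)\<bar> + \<epsilon> * norm g + \<bar>M\<bar> * \<epsilon>\<^sup>2" for y
  proof (cases "norm y < \<epsilon>")
    case True
    have "\<bar>y \<bullet> g\<bar> \<le> norm y * norm g" by (rule Cauchy_Schwarz_ineq2)
    also have "\<dots> \<le> \<epsilon> * norm g" using True by (intro mult_right_mono) auto
    finally have 1: "\<bar>y \<bullet> g\<bar> \<le> \<epsilon> * norm g" .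
    have "M * (norm y)\<^sup>2 \<le> \<bar>M\<bar> * \<epsilon>\<^sup>2"
      using True by (intro mult_mono power_mono) auto
    moreover have "0 \<le> B" using B[of "(x, t)"] xt by auto
    ultimately show ?thesis using 1 quad[OF True] True by (simp add: glue_def cyl)
  next
    case False
    have "0 \<le> \<epsilon> * norm g" "0 \<le> \<bar>M\<bar> * \<epsilon>\<^sup>2" using pos by auto
    moreover have "\<bar>u (x + y, t)\<bar> \<le> B" using B xt by auto
    ultimately have "\<bar>u (x + y, t)\<bar> \<le> B + \<bar>\<phi> (x, t)\<bar> + \<epsilon> * norm g + \<bar>M\<bar> * \<epsilon>\<^sup>2"
      by linarith
    then show ?thesis using False by (simp add: glue_def cyl)
  qed
  show ?thesis
    using s quad by (intro increment_integrable[OF s(1,2) k _ hm hb _ pos, where M = M])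
      (auto simp: glue_def cyl)
qed

text \<open>At the touching point both derivatives of the glued function are those of the test function, as the two
agree on the cylinder. Changing the cutoff radius does not affect the integral because of
\<open>gradient_cutoff_irrelevant\<close>.\<close>

lemma glued_operator:
  fixes K :: "'a::euclidean_space \<Rightarrow> 'a \<Rightarrow> real \<Rightarrow> real"
  assumes s: "0 < s" "s < 1" "0 < lam" "lam < Lam" and K: "admissible_kernel s lam Lam r K"
    and u: "u \<in> Linfty (UNIV \<times> I)" and xt: "t \<in> I" and pos: "0 < \<epsilon>" "0 < \<rho>"
    and test: "test_function \<epsilon> (x, t) \<phi>"
    and quad: "\<And>y. norm y < \<epsilon> \<Longrightarrow> \<bar>\<phi> (x + y, t) - \<phi> (x, t) - y \<bullet> g\<bar> \<le> M * (norm y)\<^sup>2"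
    and D: "((\<lambda>\<tau>. \<phi> (x, \<tau>)) has_real_derivative D) (at_left t)"
    and g: "GDERIV (\<lambda>x. \<phi> (x, t)) x :> g"
  defines "v \<equiv> glue (cylinder \<epsilon> (x, t)) \<phi> u"
  shows "left_dt v (x, t) = D"
    and "nonlocal_op s K v (x, t) = (LINT y|lebesgue. (v (x + y, t) - \<phi> (x, t)
            - cutoff s \<rho> y * (y \<bullet> g)) * K x y t)"
proof -
  have vt: "v (x, \<tau>) = \<phi> (x, \<tau>)" if "t - \<epsilon> < \<tau>" "\<tau> \<le> t" for \<tau>
    using that pos by (simp add: v_def glue_def cylinder_def)
  have vx: "v (z, t) = \<phi> (z, t)" if "z \<in> ball x \<epsilon>" for z
    using that pos by (simp add: v_def glue_def cylinder_def)
  have "((\<lambda>\<tau>. v (x, \<tau>)) has_real_derivative D) (at_left t)"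
    using D vt pos
    by (subst has_field_derivative_cong_eventually[where g = "\<lambda>\<tau>. \<phi> (x, \<tau>)"])
      (auto simp: eventually_at_left[of "t - \<epsilon>" t] intro!: exI[of _ "t - \<epsilon>"])
  then show "left_dt v (x, t) = D"
    unfolding left_dt_def
    by (intro the_equality) (auto intro: has_field_derivative_unique)
  have gv: "GDERIV (\<lambda>x. v (x, t)) x :> g"
    using g unfolding gderiv_def
    by (rule has_derivative_transform_within_open[where s = "ball x \<epsilon>"]) (use vx pos in auto)
  have grad: "space_grad v (x, t) = g"
    unfolding space_grad_def fst_conv snd_conv
  proof (rule the_equality[where P = "\<lambda>g. GDERIV (\<lambda>x. v (x, t)) x :> g", OF gv])
    fix g' assume "GDERIV (\<lambda>x. v (x, t)) x :> g'"
    then have "(\<lambda>h. h \<bullet> g) = (\<lambda>h. h \<bullet> g')"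
      using gv unfolding gderiv_def by (auto intro: has_derivative_unique)
    then have "h \<bullet> g = h \<bullet> g'" for h by (rule fun_cong)
    then show "g' = g" using vector_eq_ldot[of g g'] by blast
  qed
  have vp: "v (x, t) = \<phi> (x, t)" using vx pos by simp
  let ?A = "\<lambda>\<rho> y. (v (x + y, t) - \<phi> (x, t) - cutoff s \<rho> y * (y \<bullet> g)) * K x y t"
  have int: "integrable lebesgue (?A \<rho>)" if "0 < \<rho>" for \<rho>
    unfolding v_def by (rule glue_increment_integrable[OF s K u xt pos(1) that test quad])
  have op: "nonlocal_op s K v (x, t) = (LINT y|lebesgue. ?A 1 y)"
    unfolding nonlocal_op_def diff_op_def grad fst_conv snd_conv vp
    by (intro Bochner_Integration.integral_cong) (auto simp: cutoff_def)
  have "(LINT y|lebesgue. ?A 1 y) - (LINT y|lebesgue. ?A \<rho> y) = (LINT y|lebesgue. ?A 1 y - ?A \<rho> y)"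
    using int pos by simp
  also have "\<dots> = (LINT y|lebesgue. (cutoff s \<rho> y - cutoff s 1 y) * (y \<bullet> g) * K x y t)"
    by (intro Bochner_Integration.integral_cong) (auto simp: algebra_simps)
  also have "\<dots> = 0"
    using K by (intro gradient_cutoff_irrelevant) (auto simp: admissible_kernel_def)
  finally show "nonlocal_op s K v (x, t) = (LINT y|lebesgue. ?A \<rho> y)" using op by simp
qed

lemma viscosity_inequality_subsolution:
  fixes K :: "'a::euclidean_space \<Rightarrow> 'a \<Rightarrow> real \<Rightarrow> real"
  assumes s: "0 < s" "s < 1" "0 < lam" "lam < Lam" and K: "admissible_kernel s lam Lam r K"
    and sub: "viscosity_subsolution s K \<Omega> I f u"
  shows "viscosity_inequality s K \<Omega> I f u"
  unfolding viscosity_inequality_def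
proof (intro allI impI conjI, goal_cases)
  case (1 x t \<epsilon> \<phi> D g M \<rho>)
  then show ?case using sub
    by (intro glue_increment_integrable[OF s K, of u I t \<epsilon> \<rho> x \<phi> g M]) (auto simp: viscosity_subsolution_def)
next
  case (2 x t \<epsilon> \<phi> D g M \<rho>)
  have u: "u \<in> Linfty (UNIV \<times> I)" "t \<in> I" using sub 2 by (auto simp: viscosity_subsolution_def)
  have "left_dt (glue (cylinder \<epsilon> (x, t)) \<phi> u) (x, t)
      - nonlocal_op s K (glue (cylinder \<epsilon> (x, t)) \<phi> u) (x, t) \<le> f (x, t)"
    using sub 2 unfolding viscosity_subsolution_def Let_def by meson
  then show ?case
    using glued_operator[OF s K u 2(2,3,5) _ 2(6,7), of M] 2(8) by simp
qed

lemma Linfty_uminus: "u \<in> Linfty S \<Longrightarrow> (\<lambda>q. - u q) \<in> Linfty S"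
  by (auto simp: Linfty_def bounded_iff)

lemma test_function_uminus:
  assumes "test_function \<epsilon> p \<phi>" shows "test_function \<epsilon> p (\<lambda>q. - \<phi> q)"
  unfolding test_function_def
proof (intro conjI ballI)
  fix q assume "q \<in> cylinder \<epsilon> p"
  then obtain D where "((\<lambda>\<tau>. \<phi> (fst q, \<tau>)) has_real_derivative D) (at_left (snd q))"
    using assms by (fastforce simp: test_function_def)
  then show "case q of (x, t) \<Rightarrow> \<exists>D. ((\<lambda>\<tau>. - \<phi> (x, \<tau>)) has_real_derivative D) (at_left t)"
    by (auto intro!: exI[of _ "- D"] DERIV_minus simp: split_beta)
next
  fix t assume "t \<in> {snd p - \<epsilon> <.. snd p}"
  then have "C11_on (ball (fst p) \<epsilon>) (\<lambda>x. \<phi> (x, t))"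
    using assms by (auto simp: test_function_def)
  then obtain G M where "\<forall>x\<in>ball (fst p) \<epsilon>. GDERIV (\<lambda>x. \<phi> (x, t)) x :> G x" "M-lipschitz_on (ball (fst p) \<epsilon>) G"
    unfolding C11_on_def by blast
  then show "C11_on (ball (fst p) \<epsilon>) (\<lambda>x. - \<phi> (x, t))"
    unfolding C11_on_def by (intro exI[of _ "\<lambda>x. - G x"] exI[of _ M]) (auto intro: GDERIV_minus)
qed

lemma viscosity_inequality_supersolution:
  fixes K :: "'a::euclidean_space \<Rightarrow> 'a \<Rightarrow> real \<Rightarrow> real"
  assumes s: "0 < s" "s < 1" "0 < lam" "lam < Lam" and K: "admissible_kernel s lam Lam r K"
    and sup: "viscosity_supersolution s K \<Omega> I f u"
  shows "viscosity_inequality s K \<Omega> I (\<lambda>q. - f q) (\<lambda>q. - u q)"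
  unfolding viscosity_inequality_def
proof (intro allI impI conjI, goal_cases)
  case (1 x t \<epsilon> \<phi> D g M \<rho>)
  then show ?case using sup Linfty_uminus
    by (intro glue_increment_integrable[OF s K, of _ I t \<epsilon> \<rho> x \<phi> g M]) (auto simp: viscosity_supersolution_def)
next
  case (2 x t \<epsilon> \<phi> D g M \<rho>)
  let ?\<psi> = "\<lambda>q. - \<phi> q"
  let ?v = "glue (cylinder \<epsilon> (x, t)) ?\<psi> u" and ?w = "glue (cylinder \<epsilon> (x, t)) \<phi> (\<lambda>q. - u q)"
  have u: "u \<in> Linfty (UNIV \<times> I)" "t \<in> I" using sup 2 by (auto simp: viscosity_supersolution_def)
  have test: "test_function \<epsilon> (x, t) ?\<psi>" using 2 by (intro test_function_uminus) auto
  have quad: "\<bar>?\<psi> (x + y, t) - ?\<psi> (x, t) - y \<bullet> (- g)\<bar> \<le> M * (norm y)\<^sup>2" if "norm y < \<epsilon>" for y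
    using 2(8) that by (simp add: abs_minus_commute) (smt (verit))
  have touch: "u (x, t) = ?\<psi> (x, t)" "\<forall>q\<in>cylinder \<epsilon> (x, t). ?\<psi> q \<le> u q" using 2(9,10) by force+
  have "f (x, t) \<le> left_dt ?v (x, t) - nonlocal_op s K ?v (x, t)"
    using sup 2(1,2,4) test touch unfolding viscosity_supersolution_def Let_def by meson
  also have "left_dt ?v (x, t) = - D"
    using glued_operator[OF s K u 2(2,3) test quad DERIV_minus[OF 2(6)] GDERIV_minus[OF 2(7)]] by auto
  also have "nonlocal_op s K ?v (x, t) =
      (LINT y|lebesgue. (?v (x + y, t) - ?\<psi> (x, t) - cutoff s \<rho> y * (y \<bullet> (- g))) * K x y t)"
    using glued_operator[OF s K u 2(2,3) test quad DERIV_minus[OF 2(6)] GDERIV_minus[OF 2(7)]] by auto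
  also have "(LINT y|lebesgue. (?v (x + y, t) - ?\<psi> (x, t) - cutoff s \<rho> y * (y \<bullet> (- g))) * K x y t)
      = (LINT y|lebesgue. - ((?w (x + y, t) - \<phi> (x, t) - cutoff s \<rho> y * (y \<bullet> g)) * K x y t))"
    by (intro Bochner_Integration.integral_cong) (auto simp: glue_def algebra_simps)
  finally show ?case by simp
qed

section \<open>The operator acting on the bump\<close>

text \<open>The value at distance \<open>2 * r\<close> of the lower bound of the kernel, which is therefore a lower
bound for all jumps between two points of a ball of radius \<open>r\<close>.\<close>

definition kernel_floor :: "'a::euclidean_space itself \<Rightarrow> real \<Rightarrow> real \<Rightarrow> real \<Rightarrow> real" where
  "kernel_floor _ s lam r = lam * (2 * r) powr (- real DIM('a) - 2 * s)"

definition kernel_lower :: "real \<Rightarrow> real \<Rightarrow> real \<Rightarrow> ('a::euclidean_space \<Rightarrow> real) \<Rightarrow> bool" where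
  "kernel_lower s lam r k \<longleftrightarrow>
     (\<forall>y. y \<noteq> 0 \<longrightarrow> norm y \<le> 2 * r \<longrightarrow> kernel_floor TYPE('a) s lam r \<le> k y)"

lemma kernel_floor_pos: "0 < lam \<Longrightarrow> 0 < r \<Longrightarrow> 0 < kernel_floor TYPE('a::euclidean_space) s lam r"
  by (simp add: kernel_floor_def)

text \<open>The rate of jumps into a ball whose radius is comparable with \<open>r\<close> scales like
\<open>r powr (- 2 * s)\<close>. This is why all constants below are independent of \<open>r\<close>.\<close>

lemma kernel_floor_volume:
  assumes "0 < r" "0 \<le> \<theta>"
  shows "kernel_floor TYPE('a::euclidean_space) s lam r * (unit_ball_vol (real DIM('a)) * (\<theta> * r) ^ DIM('a))
    = lam * 2 powr (- real DIM('a) - 2 * s) * unit_ball_vol (real DIM('a)) * \<theta> ^ DIM('a) * r powr (- 2 * s)"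
proof -
  have "r powr (- real DIM('a) - 2 * s) * r ^ DIM('a) = r powr (- 2 * s)"
    using assms by (simp add: powr_realpow[symmetric] flip: powr_add)
  then show ?thesis
    unfolding kernel_floor_def using assms
    by (simp add: powr_mult power_mult_distrib mult_ac)
qed

definition bump_mass :: "'a::euclidean_space itself \<Rightarrow> real \<Rightarrow> real" where
  "bump_mass _ r = (LINT y|lebesgue. bump ((1 / r) *\<^sub>R (y::'a)))"

lemma bump_measurable [measurable]: "(\<lambda>y::'a::euclidean_space. bump (z + c *\<^sub>R y)) \<in> borel_measurable lebesgue"
  unfolding bump_def by (intro measurable_completion) measurable

lemma integrable_indicator_ball: "integrable lebesgue (indicator (ball c r) :: 'a::euclidean_space \<Rightarrow> real)"
  by (cases "0 \<le> r") (auto simp: emeasure_ball ennreal_less_top ball_empty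
      intro!: integrable_real_indicator)

lemma bump_integrable:
  fixes z :: "'a::euclidean_space"
  assumes "0 < r"
  shows "integrable lebesgue (\<lambda>y. bump (z + (1 / r) *\<^sub>R y))"
    and "(LINT y|lebesgue. bump (z + (1 / r) *\<^sub>R y)) = bump_mass TYPE('a) r"
proof -
  let ?f = "\<lambda>y::'a. bump (0 + (1 / r) *\<^sub>R y)"
  have int: "integrable lebesgue ?f"
  proof (rule Bochner_Integration.integrable_bound[OF integrable_indicator_ball[of 0 r]])
    show "AE y in lebesgue. norm (?f y) \<le> norm (indicator (ball 0 r) y :: real)"
      using assms bump_le_1 by (auto simp: bump_nonneg indicator_def bump_eq_0 divide_simps intro!: AE_I2)
  qed (rule bump_measurable)
  have shift: "?f (r *\<^sub>R z + 1 *\<^sub>R y) = bump (z + (1 / r) *\<^sub>R y)" for y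
    using assms by (simp add: scaleR_add_right)
  show "integrable lebesgue (\<lambda>y. bump (z + (1 / r) *\<^sub>R y))"
    using lebesgue_integral_affine_isometry(2)[OF bump_measurable, of 1 0 "1 / r" "r *\<^sub>R z"] int unfolding shift by simp
  show "(LINT y|lebesgue. bump (z + (1 / r) *\<^sub>R y)) = bump_mass TYPE('a) r"
    using lebesgue_integral_affine_isometry(1)[OF bump_measurable, of 1 0 "1 / r" "r *\<^sub>R z"] unfolding shift bump_mass_def by simp
qed

lemma bump_mass_ge:
  assumes "0 < r"
  shows "9/16 * (unit_ball_vol (real DIM('a)) * (1/2 * r) ^ DIM('a)) \<le> bump_mass TYPE('a::euclidean_space) r"
proof -
  let ?f = "\<lambda>y::'a. bump (0 + (1 / r) *\<^sub>R y)"
  have int: "integrable lebesgue ?f" by (rule bump_integrable(1)[OF assms])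
  have "(LINT y|lebesgue. 9/16 * indicator (ball 0 (1/2 * r)) (y::'a)) \<le> (LINT y|lebesgue. ?f y)"
    using assms bump_ge[of "(1 / r) *\<^sub>R y" for y :: 'a]
    by (intro integral_mono int integrable_mult_right integrable_indicator_ball)
      (auto simp: indicator_def bump_nonneg divide_simps)
  then show "9/16 * (unit_ball_vol (real DIM('a)) * (1/2 * r) ^ DIM('a)) \<le> bump_mass TYPE('a) r"
    using assms by (simp add: bump_mass_def content_ball)
qed

text \<open>Minus the increment that the operator integrates, for the bump rescaled to radius \<open>r\<close>, at
the point whose rescaled position is \<open>z\<close>.\<close>

definition bump_defect :: "real \<Rightarrow> real \<Rightarrow> real \<Rightarrow> 'a::euclidean_space \<Rightarrow> 'a \<Rightarrow> real" where
  "bump_defect s \<rho> r z y = bump z - bump (z + (1 / r) *\<^sub>R y)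
     + cutoff s \<rho> y * (y \<bullet> ((1 / r) *\<^sub>R bump_grad z))"

lemma bump_defect_integrable:
  fixes k :: "'a::euclidean_space \<Rightarrow> real"
  assumes s: "0 < s" "s < 1" and k: "kernel_upper s Lam k" and "0 \<le> Lam" "0 < r" "0 < \<rho>"
  shows "integrable lebesgue (\<lambda>y. bump_defect s \<rho> r z y * k y)"
proof -
  have "integrable lebesgue (\<lambda>y. (- bump (z + (1 / r) *\<^sub>R y) - (- bump z)
      - cutoff s \<rho> y * (y \<bullet> (- (1 / r) *\<^sub>R bump_grad z))) * k y)"
  proof (rule increment_integrable[OF s k, where B = 1 and M = "25 / r\<^sup>2" and \<epsilon> = r])
    fix y :: 'a assume "norm y < r"
    then have "norm ((1 / r) *\<^sub>R y) \<le> 1" using assms by simp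
    from bump_taylor[OF this, of z]
    show "\<bar>- bump (z + (1 / r) *\<^sub>R y) - - bump z - y \<bullet> (- (1 / r) *\<^sub>R bump_grad z)\<bar> \<le> 25 / r\<^sup>2 * (norm y)\<^sup>2"
      using assms by (simp add: power_divide abs_le_iff algebra_simps)
  qed (use assms bump_le_1 in \<open>auto simp: bump_nonneg\<close>)
  then show ?thesis by (simp add: bump_defect_def algebra_simps)
qed

lemma bump_defect_near:
  fixes z :: "'a::euclidean_space"
  assumes "0 < r" "norm y < \<rho>" "y \<noteq> 0"
  shows "bump_defect s \<rho> r z y \<le> 4 * (norm y / r) powr taylor_order s"
proof (cases "s < 1/2")
  case True
  then show ?thesis
    using assms bump_Lipschitz[of z "(1 / r) *\<^sub>R y"]
    by (simp add: bump_defect_def cutoff_def taylor_order_def)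
next
  case False
  have "bump_defect s \<rho> r z y \<le> 2 * (norm ((1 / r) *\<^sub>R y))\<^sup>2"
    using False assms bump_expansion(1)[of z "(1 / r) *\<^sub>R y"]
    by (simp add: bump_defect_def cutoff_def)
  also have "\<dots> \<le> 4 * (norm y / r)\<^sup>2" using assms by simp
  finally show ?thesis using False assms by (simp add: taylor_order_def powr_numeral)
qed

lemma bump_defect_far:
  fixes z :: "'a::euclidean_space"
  assumes "0 < r" "\<rho> \<le> norm y"
  shows "bump_defect s \<rho> r z y \<le> bump z + (if 1/2 < s then 4 * sqrt (bump z) / r else 0) * norm y
    - bump (z + (1 / r) *\<^sub>R y)"
proof -
  have "y \<bullet> bump_grad z \<le> norm y * norm (bump_grad z)" by (rule norm_cauchy_schwarz)
  also have "\<dots> \<le> norm y * (4 * sqrt (bump z))"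
    by (intro mult_left_mono norm_bump_grad_le) auto
  finally have "(y \<bullet> bump_grad z) / r \<le> norm y * (4 * sqrt (bump z)) / r"
    using assms by (intro divide_right_mono) auto
  then show ?thesis
    using assms by (auto simp: bump_defect_def cutoff_def mult_ac)
qed

lemma scaled_power: "0 < r \<Longrightarrow> 0 < \<tau> \<Longrightarrow> r powr (- a) * (\<tau> * r) powr (a - b) = \<tau> powr (a - b) * r powr (- b)"
  for r \<tau> a b :: real
  by (simp add: powr_mult mult.left_commute flip: powr_add)

lemma small_scale_exists:
  fixes a b c q :: real
  assumes "0 \<le> a" "0 \<le> b" "0 < c" "0 < q" "0 < n"
  shows "\<exists>\<tau>>0. a * \<tau> powr q + b * \<tau> ^ n \<le> c"
proof -
  \<comment> \<open>The exponent \<open>e\<close> is at most both \<open>q\<close> and \<open>n\<close>,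
    so one power dominates the two terms.\<close>
  define e where "e = min q 1"
  define \<tau> where "\<tau> = min 1 ((c / (a + b + 1)) powr (1 / e))"
  have e: "0 < e" "e \<le> q" "e \<le> real n" using assms by (auto simp: e_def)
  have \<tau>: "0 < \<tau>" "\<tau> \<le> 1" using assms by (auto simp: \<tau>_def)
  have "\<tau> powr e \<le> ((c / (a + b + 1)) powr (1 / e)) powr e"
    using e \<tau> by (intro powr_mono2) (auto simp: \<tau>_def)
  also have "\<dots> = c / (a + b + 1)" using e assms by (simp add: powr_powr)
  finally have te: "\<tau> powr e \<le> c / (a + b + 1)" .
  have "\<tau> powr q \<le> \<tau> powr e" "\<tau> powr real n \<le> \<tau> powr e"
    using e \<tau> by (auto intro: powr_mono')
  then have "a * \<tau> powr q + b * \<tau> ^ n \<le> a * \<tau> powr e + b * \<tau> powr e"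
    using assms \<tau> by (intro add_mono mult_left_mono) (auto simp: powr_realpow)
  also have "\<dots> \<le> (a + b + 1) * \<tau> powr e" using \<tau> by (simp add: algebra_simps)
  also have "\<dots> \<le> (a + b + 1) * (c / (a + b + 1))" using te assms by (intro mult_left_mono) auto
  finally show ?thesis using \<tau> assms by auto
qed

text \<open>The operator decreases the bump at most at a rate proportional to the bump. The point is that the
right-hand side is small where the bump is small. Split the jumps at length \<open>\<tau> * r\<close>.
Short jumps cost an amount that vanishes with \<open>\<tau>\<close>. Long jumps cost a multiple of the
bump and, from the gradient term, of its square root; but jumps to points where the bump is positive give
back the lower bound of the kernel times \<open>bump_mass\<close>. One half of this gain is kept in the
statement, for later use against the jumps of \<open>u\<close>; the other half pays for the short jumps,
if \<open>\<tau>\<close> is small, and by Young's inequality for the square root.\<close>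

lemma bump_is_barrier:
  fixes s lam Lam :: real
  assumes s: "0 < s" "s < 1" and lam: "0 < lam" "0 < Lam"
  shows "\<exists>C \<tau>. 0 < C \<and> 0 < \<tau> \<and> (\<forall>r z. \<forall>k :: 'a::euclidean_space \<Rightarrow> real.
     0 < r \<longrightarrow> norm z < 1 \<longrightarrow> kernel_upper s Lam k \<longrightarrow> kernel_lower s lam r k \<longrightarrow>
     (LINT y|lebesgue. bump_defect s (\<tau> * r) r z y * k y)
       + kernel_floor TYPE('a) s lam r / 2 * bump_mass TYPE('a) r \<le> C * r powr (- 2 * s) * bump z)"
proof -
  let ?n = "real DIM('a)" and ?p = "taylor_order s" and ?w = "unit_ball_vol (real DIM('a))"
  let ?L = "lam * 2 powr (- ?n - 2 * s) * ?w"
  \<comment> \<open>A lower bound, in units of \<open>r powr (- 2 * s)\<close>, for half of the gain; the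
    bump is at least \<open>9/16\<close> on half the ball.\<close>
  define c where "c = ?L * (1/2) ^ DIM('a) * (9/32)"
  have c: "0 < c" using lam by (simp add: c_def)
  have q: "0 < ?p - 2 * s" using s taylor_order_gt by blast
  define A where "A = 4 * Lam * dyadic_const TYPE('a) (?p - 2 * s)"
  have A: "0 \<le> A" using lam dyadic_const_pos[OF q, where 'a='a] by (simp add: A_def)
  obtain \<tau> where \<tau>: "0 < \<tau>" "A * \<tau> powr (?p - 2 * s) + ?L * \<tau> ^ DIM('a) \<le> c / 2"
    using small_scale_exists[OF A, of ?L "c / 2" "?p - 2 * s" "DIM('a)"] lam c q by auto
  define B1 where "B1 = Lam * dyadic_const TYPE('a) (2 * s) * \<tau> powr (- 2 * s)"
  define B2 where "B2 = (if 1/2 < s then 4 * Lam * dyadic_const TYPE('a) (2 * s - 1) * \<tau> powr (1 - 2 * s) else 0)"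
  define C where "C = B1 + B2\<^sup>2 / (2 * c) + 1"
  have B1: "0 \<le> B1" using lam dyadic_const_pos[of "2 * s", where 'a='a] s by (simp add: B1_def)
  have C: "0 < C" using B1 c by (simp add: C_def add_nonneg_pos)
  have main: "(LINT y|lebesgue. bump_defect s (\<tau> * r) r z y * k y)
       + kernel_floor TYPE('a) s lam r / 2 * bump_mass TYPE('a) r \<le> C * r powr (- 2 * s) * bump z"
    if r: "0 < r" and z: "norm z < 1" and ku: "kernel_upper s Lam k" and kl: "kernel_lower s lam r k"
    for r z and k :: "'a \<Rightarrow> real"
  proof -
    let ?\<rho> = "\<tau> * r" and ?\<kappa> = "kernel_floor TYPE('a) s lam r" and ?b = "bump z"
    have \<rho>: "0 < ?\<rho>" using \<tau> r by simp
    have \<kappa>: "0 < ?\<kappa>" using lam(1) r by (rule kernel_floor_pos)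
    define e where "e = (if 1/2 < s then 4 * sqrt ?b / r else 0)"
    have e: "0 \<le> e" using r by (simp add: e_def bump_nonneg)
    \<comment> \<open>\<open>G1\<close> bounds the short jumps; \<open>G2\<close> and \<open>G3\<close>
      the cost of long jumps from the value and from the gradient. The gain is written over all jumps,
      which is corrected by the indicator of the short ones.\<close>
    define G1 where "G1 y = norm y powr ((?p - 2 * s) - ?n) * indicator (ball 0 ?\<rho>) y" for y :: 'a
    define G2 where "G2 y = norm y powr (- ?n - 2 * s) * indicator (- ball 0 ?\<rho>) y" for y :: 'a
    define G3 where "G3 y = e * (norm y powr (- ?n - (2 * s - 1)) * indicator (- ball 0 ?\<rho>) y)" for y :: 'a
    define G where "G y = 4 * Lam * r powr (- ?p) * G1 y + ?\<kappa> * indicator (ball 0 ?\<rho>) y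
        + ?b * Lam * G2 y + Lam * G3 y - ?\<kappa> * bump (z + (1 / r) *\<^sub>R y)" for y
    have G1: "integrable lebesgue G1" "(LINT y|lebesgue. G1 y) \<le> dyadic_const TYPE('a) (?p - 2 * s) * ?\<rho> powr (?p - 2 * s)"
      unfolding G1_def using inner_power_integral[OF \<rho> q, where 'a='a] by auto
    have G2: "integrable lebesgue G2" "(LINT y|lebesgue. G2 y) \<le> dyadic_const TYPE('a) (2 * s) * ?\<rho> powr (- (2 * s))"
      unfolding G2_def using outer_power_integral[OF \<rho>, of "2 * s", where 'a='a] s by auto
    have G3: "integrable lebesgue G3 \<and> Lam * (LINT y|lebesgue. G3 y) \<le> sqrt ?b * B2 * r powr (- 2 * s)"
    proof (cases "1/2 < s")
      case True
      then have "0 < 2 * s - 1" by simp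
      note o = outer_power_integral[OF \<rho> this, where 'a='a]
      have "(LINT y|lebesgue. G3 y) \<le> e * (dyadic_const TYPE('a) (2 * s - 1) * ?\<rho> powr (- (2 * s - 1)))"
        unfolding G3_def using o e by (simp add: mult_left_mono)
      also have "\<dots> = 4 * sqrt ?b * dyadic_const TYPE('a) (2 * s - 1) * (r powr (- 1) * ?\<rho> powr (1 - 2 * s))"
        using True r by (simp add: e_def powr_minus_divide)
      also have "r powr (- 1) * ?\<rho> powr (1 - 2 * s) = \<tau> powr (1 - 2 * s) * r powr (- (2 * s))"
        using scaled_power[OF r \<tau>(1), of 1 "2 * s"] by simp
      finally have "Lam * (LINT y|lebesgue. G3 y)
          \<le> Lam * (4 * sqrt ?b * dyadic_const TYPE('a) (2 * s - 1) * (\<tau> powr (1 - 2 * s) * r powr (- (2 * s))))"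
        using lam by (intro mult_left_mono) auto
      then show ?thesis using o(1) True unfolding G3_def by (simp add: B2_def mult_ac)
    next
      case False then show ?thesis by (simp add: G3_def[abs_def] e_def B2_def)
    qed
    note bi = bump_integrable[OF r, of z]
    have Gi: "integrable lebesgue G"
      unfolding G_def using G1 G2 G3 bi(1) integrable_indicator_ball
      by (intro Bochner_Integration.integrable_add Bochner_Integration.integrable_diff integrable_mult_right) auto
    have pt: "bump_defect s ?\<rho> r z y * k y \<le> G y" if y: "y \<noteq> 0" for y
    proof -
      have ky: "0 \<le> k y" "k y \<le> Lam * norm y powr (- ?n - 2 * s)"
        using ku y by (auto simp: kernel_upper_def)
      show ?thesis
      proof (cases "norm y < ?\<rho>")
        case True
        have "bump_defect s ?\<rho> r z y * k y \<le> (4 * (norm y / r) powr ?p) * k y"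
          using bump_defect_near[OF r True y] ky by (intro mult_right_mono)
        also have "\<dots> \<le> (4 * (norm y / r) powr ?p) * (Lam * norm y powr (- ?n - 2 * s))"
          using ky by (intro mult_left_mono) auto
        also have "\<dots> = 4 * Lam * r powr (- ?p) * (norm y powr ?p * norm y powr (- ?n - 2 * s))"
          using r by (simp add: powr_divide powr_minus_divide)
        also have "norm y powr ?p * norm y powr (- ?n - 2 * s) = G1 y"
          using True unfolding powr_add[symmetric] G1_def by (simp add: algebra_simps)
        also have "4 * Lam * r powr (- ?p) * G1 y \<le> G y"
          using True \<kappa> bump_le_1[of "z + (1 / r) *\<^sub>R y"]
          by (simp add: G_def G2_def G3_def mult_left_le)
        finally show ?thesis .
      next
        case False
        have kb: "?\<kappa> * bump (z + (1 / r) *\<^sub>R y) \<le> bump (z + (1 / r) *\<^sub>R y) * k y"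
        proof (cases "norm y \<le> 2 * r")
          case True
          then have "?\<kappa> \<le> k y" using kl y by (auto simp: kernel_lower_def)
          then show ?thesis
            by (subst mult.commute) (intro mult_left_mono bump_nonneg)
        next
          case False
          then have "2 \<le> norm ((1 / r) *\<^sub>R y)" using r by (simp add: divide_simps)
          then have "1 \<le> norm (z + (1 / r) *\<^sub>R y)"
            using norm_triangle_ineq4[of "z + (1 / r) *\<^sub>R y" z] z by simp
          then show ?thesis by (simp add: bump_eq_0)
        qed
        have "bump_defect s ?\<rho> r z y * k y \<le> (?b + e * norm y - bump (z + (1 / r) *\<^sub>R y)) * k y"
          using bump_defect_far[OF r, of ?\<rho> y s z] False ky unfolding e_def
          by (intro mult_right_mono) auto
        also have "\<dots> = (?b + e * norm y) * k y - bump (z + (1 / r) *\<^sub>R y) * k y"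
          by (simp add: algebra_simps)
        also have "\<dots> \<le> (?b + e * norm y) * (Lam * norm y powr (- ?n - 2 * s)) - ?\<kappa> * bump (z + (1 / r) *\<^sub>R y)"
          using kb ky e by (intro diff_mono mult_left_mono) (auto simp: bump_nonneg)
        also have "(?b + e * norm y) * (Lam * norm y powr (- ?n - 2 * s))
            = ?b * Lam * G2 y + Lam * (e * (norm y powr 1 * norm y powr (- ?n - 2 * s)))"
          using False y by (simp add: G2_def algebra_simps)
        also have "e * (norm y powr 1 * norm y powr (- ?n - 2 * s)) = G3 y"
          using False unfolding powr_add[symmetric] G3_def by (simp add: algebra_simps)
        finally show ?thesis using False by (simp add: G_def G1_def)
      qed
    qed
    have "(LINT y|lebesgue. bump_defect s ?\<rho> r z y * k y) \<le> (LINT y|lebesgue. G y)"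
      using ku lam r \<rho> s pt
      by (intro integral_mono_AE Gi bump_defect_integrable eventually_mono[OF AE_lebesgue_nonzero]) auto
    also have "\<dots> = 4 * Lam * r powr (- ?p) * (LINT y|lebesgue. G1 y) + ?\<kappa> * (?w * ?\<rho> ^ DIM('a))
        + ?b * Lam * (LINT y|lebesgue. G2 y) + Lam * (LINT y|lebesgue. G3 y) - ?\<kappa> * bump_mass TYPE('a) r"
      unfolding G_def using G1 G2 G3 bi integrable_indicator_ball[of "0::'a" ?\<rho>] \<rho>
      by (simp add: content_ball)
    also have "4 * Lam * r powr (- ?p) * (LINT y|lebesgue. G1 y)
        \<le> 4 * Lam * r powr (- ?p) * (dyadic_const TYPE('a) (?p - 2 * s) * ?\<rho> powr (?p - 2 * s))"
      using G1 lam by (intro mult_left_mono) auto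
    also have "\<dots> = A * (r powr (- ?p) * ?\<rho> powr (?p - 2 * s))" by (simp add: A_def)
    also have "\<dots> = A * \<tau> powr (?p - 2 * s) * r powr (- 2 * s)"
      using scaled_power[OF r \<tau>(1), of ?p "2 * s"] by simp
    also have "?\<kappa> * (?w * ?\<rho> ^ DIM('a)) = ?L * \<tau> ^ DIM('a) * r powr (- 2 * s)"
      using kernel_floor_volume[OF r, of \<tau> s lam, where 'a='a] \<tau> by simp
    also have "?b * Lam * (LINT y|lebesgue. G2 y)
        \<le> ?b * Lam * (dyadic_const TYPE('a) (2 * s) * ?\<rho> powr (- (2 * s)))"
      using G2 lam by (intro mult_left_mono) (auto simp: bump_nonneg)
    also have "\<dots> = ?b * B1 * r powr (- 2 * s)"
      using r \<tau> by (simp add: B1_def powr_mult)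
    also have "Lam * (LINT y|lebesgue. G3 y) \<le> sqrt ?b * B2 * r powr (- 2 * s)" using G3 by simp
    finally have 1: "(LINT y|lebesgue. bump_defect s ?\<rho> r z y * k y) \<le>
        (A * \<tau> powr (?p - 2 * s) + ?L * \<tau> ^ DIM('a) + ?b * B1 + sqrt ?b * B2) * r powr (- 2 * s)
        - ?\<kappa> * bump_mass TYPE('a) r"
      by (simp add: algebra_simps)
    have "c * r powr (- 2 * s) = ?\<kappa> / 2 * (9/16 * (?w * (1/2 * r) ^ DIM('a)))"
    proof -
      have "?\<kappa> / 2 * (9/16 * X) = 9/32 * (?\<kappa> * X)" for X by simp
      then show ?thesis
        by (simp only: kernel_floor_volume[OF r, of "1/2" s lam, where 'a='a]) (simp add: c_def)
    qed
    also have "\<dots> \<le> ?\<kappa> / 2 * bump_mass TYPE('a) r"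
      using bump_mass_ge[OF r] \<kappa> by (intro mult_left_mono) auto
    finally have 2: "c * r powr (- 2 * s) \<le> ?\<kappa> / 2 * bump_mass TYPE('a) r" .
    \<comment> \<open>Young's inequality: half of the gain turns the square root of the bump into a
      multiple of the bump.\<close>
    have "2 * c * (sqrt ?b * B2) \<le> c\<^sup>2 + (sqrt ?b * B2)\<^sup>2"
      using sum_squares_bound[of c "sqrt ?b * B2"] by (simp add: mult_ac)
    also have "(sqrt ?b * B2)\<^sup>2 = ?b * B2\<^sup>2" by (simp add: power_mult_distrib bump_nonneg)
    finally have "sqrt ?b * B2 \<le> c / 2 + ?b * (B2\<^sup>2 / (2 * c))"
      using c by (simp add: field_simps power2_eq_square)
    then have "A * \<tau> powr (?p - 2 * s) + ?L * \<tau> ^ DIM('a) + ?b * B1 + sqrt ?b * B2 - c \<le> C * ?b"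
      using \<tau>(2) bump_nonneg[of z] by (simp add: C_def algebra_simps)
    then have "(A * \<tau> powr (?p - 2 * s) + ?L * \<tau> ^ DIM('a) + ?b * B1 + sqrt ?b * B2 - c) * r powr (- 2 * s)
        \<le> C * ?b * r powr (- 2 * s)"
      by (intro mult_right_mono) auto
    then show ?thesis using 1 2 by (simp add: algebra_simps)
  qed
  show ?thesis using C \<tau>(1) main by blast
qed

section \<open>The operator acting on a function below a barrier\<close>

lemma tail_bound:
  fixes x0 x1 y :: "'a::euclidean_space"
  assumes "norm (x1 - x0) < r" "2 * r \<le> norm (x1 + y - x0)" "0 < r" "0 < s"
  shows "r \<le> norm y" "(norm (x1 + y - x0) / r) powr s \<le> 2 powr s * r powr (- s) * norm y powr s"
proof -
  have tri: "norm (x1 + y - x0) \<le> norm (x1 - x0) + norm y"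
    using norm_triangle_ineq[of "x1 - x0" y] by (simp add: algebra_simps)
  then show ry: "r \<le> norm y" using assms by linarith
  have "(norm (x1 + y - x0) / r) powr s \<le> (2 * norm y / r) powr s"
    using tri ry assms by (intro powr_mono2 divide_right_mono) auto
  also have "\<dots> = 2 powr s * r powr (- s) * norm y powr s"
    using assms by (simp add: powr_divide powr_mult powr_minus inverse_powr divide_inverse mult_ac)
  finally show "(norm (x1 + y - x0) / r) powr s \<le> 2 powr s * r powr (- s) * norm y powr s" .
qed

text \<open>Here \<open>W\<close> is the glued function at the time of touching and \<open>w\<close> is the solution.
The function \<open>W\<close> is the barrier minus a nonnegative quantity inside the ball of radius
\<open>2 * r\<close>, so the operator applied to it is at most that of the barrier, minus the
contribution of jumps to the ball of radius \<open>r\<close>, plus that of the growth outside. The mass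
of the bump appearing when \<open>c - w\<close> replaces the distance of \<open>w\<close> to the barrier
is absorbed by the half of the gain kept in \<open>bump_is_barrier\<close>. The ball around
\<open>x1\<close> is excised because there \<open>W\<close> is the test function and not
\<open>w\<close>.\<close>

lemma glued_operator_upper_bound:
  fixes k W w :: "'a::euclidean_space \<Rightarrow> real" and s lam Lam :: real
  defines "\<kappa> r \<equiv> kernel_floor TYPE('a) s lam r"
  assumes s: "0 < s" "s < 1" and lam: "0 < lam" "0 < Lam" and r: "0 < r" and \<tau>: "0 < \<tau>"
    and ku: "kernel_upper s Lam k" and kl: "kernel_lower s lam r k"
    and barrier: "(LINT y|lebesgue. bump_defect s (\<tau> * r) r ((1 / r) *\<^sub>R (x1 - x0)) y * k y)
       + \<kappa> r / 2 * bump_mass TYPE('a) r \<le> C * r powr (- 2 * s) * bump ((1 / r) *\<^sub>R (x1 - x0))"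
    and x1: "norm (x1 - x0) < r" and m: "0 \<le> m" and E: "0 \<le> E"
    and below: "\<And>x. norm (x - x0) < 2 * r \<Longrightarrow> W x \<le> c - m * bump ((1 / r) *\<^sub>R (x - x0))"
    and data: "\<And>x. norm (x - x0) < r \<Longrightarrow> \<epsilon> \<le> norm (x - x1) \<Longrightarrow> W x \<le> w x"
    and growth: "\<And>x. 2 * r \<le> norm (x - x0) \<Longrightarrow> W x \<le> c + E * (norm (x - x0) / r) powr s"
    and F: "integrable lebesgue (\<lambda>y. (W (x1 + y) - (c - m * bump ((1 / r) *\<^sub>R (x1 - x0)))
       - cutoff s (\<tau> * r) y * (y \<bullet> ((- (m / r)) *\<^sub>R bump_grad ((1 / r) *\<^sub>R (x1 - x0))))) * k y)"
    and w: "integrable lebesgue (\<lambda>x. indicator (ball x0 r - ball x1 \<epsilon>) x * (c - w x))"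
  shows "(LINT y|lebesgue. (W (x1 + y) - (c - m * bump ((1 / r) *\<^sub>R (x1 - x0)))
       - cutoff s (\<tau> * r) y * (y \<bullet> ((- (m / r)) *\<^sub>R bump_grad ((1 / r) *\<^sub>R (x1 - x0))))) * k y)
    \<le> m * (C * r powr (- 2 * s) * bump ((1 / r) *\<^sub>R (x1 - x0)))
      - \<kappa> r / 2 * (LINT x|lebesgue. indicator (ball x0 r - ball x1 \<epsilon>) x * (c - w x))
      + E * (2 powr s * Lam * dyadic_const TYPE('a) s) * r powr (- 2 * s)"
proof -
  let ?n = "real DIM('a)" and ?z = "(1 / r) *\<^sub>R (x1 - x0)"
  let ?N = "\<lambda>y. bump_defect s (\<tau> * r) r ?z y * k y" and ?J = "bump_mass TYPE('a) r"
  let ?F = "\<lambda>y. (W (x1 + y) - (c - m * bump ?z) - cutoff s (\<tau> * r) y * (y \<bullet> ((- (m / r)) *\<^sub>R bump_grad ?z))) * k y"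
  define A where "A x = indicator (ball x0 r - ball x1 \<epsilon>) x * (c - w x)" for x
  define T where "T y = norm y powr (- ?n - s) * indicator (- ball 0 r) y" for y :: 'a
  define G where "G y = m * ?N y + E * (2 powr s * Lam * r powr (- s)) * T y
      + \<kappa> r / 2 * m * bump (?z + (1 / r) *\<^sub>R y) - \<kappa> r / 2 * A (x1 + 1 *\<^sub>R y)" for y
  have \<kappa>: "0 < \<kappa> r" using lam r by (simp add: \<kappa>_def kernel_floor_pos)
  have T: "integrable lebesgue T" "(LINT y|lebesgue. T y) \<le> dyadic_const TYPE('a) s * r powr (- s)"
    unfolding T_def using outer_power_integral[OF r s(1), where 'a='a] by auto
  note bi = bump_integrable[OF r, of ?z]
  have Am: "integrable lebesgue A" using w unfolding A_def .
  have A: "integrable lebesgue (\<lambda>y. A (x1 + 1 *\<^sub>R y))"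
      "(LINT y|lebesgue. A (x1 + 1 *\<^sub>R y)) = (LINT x|lebesgue. A x)"
    using lebesgue_integral_affine_isometry[of A 1 x1] Am by auto
  have N: "integrable lebesgue ?N"
    using s ku lam r \<tau> by (intro bump_defect_integrable) auto
  have scale: "?z + (1 / r) *\<^sub>R y = (1 / r) *\<^sub>R (x1 + y - x0)" for y
    by (simp add: algebra_simps)
  have pt: "?F y \<le> G y" if y: "y \<noteq> 0" for y
  proof -
    have ky: "0 \<le> k y" "k y \<le> Lam * norm y powr (- ?n - 2 * s)"
      using ku y by (auto simp: kernel_upper_def)
    define \<phi> where "\<phi> = c - m * bump (?z + (1 / r) *\<^sub>R y)"
    \<comment> \<open>The integrand is that of the barrier plus the contribution of the distance to the
      barrier.\<close>
    have split: "?F y = (W (x1 + y) - \<phi>) * k y + m * ?N y"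
      using r by (simp add: bump_defect_def \<phi>_def algebra_simps)
    have T0: "0 \<le> T y" by (simp add: T_def)
    have "(W (x1 + y) - \<phi>) * k y \<le> E * (2 powr s * Lam * r powr (- s)) * T y
        + \<kappa> r / 2 * m * bump (?z + (1 / r) *\<^sub>R y) - \<kappa> r / 2 * A (x1 + y)"
    proof (cases "norm (x1 + y - x0) < 2 * r")
      case True
      then have W: "W (x1 + y) \<le> \<phi>" using below[of "x1 + y"] by (simp add: \<phi>_def scale)
      have tail: "0 \<le> E * (2 powr s * Lam * r powr (- s)) * T y" using E lam T0 by simp
      have bnn: "0 \<le> \<kappa> r / 2 * m * bump (?z + (1 / r) *\<^sub>R y)" using \<kappa> m by (simp add: bump_nonneg)
      show ?thesis
      proof (cases "x1 + y \<in> ball x0 r - ball x1 \<epsilon>")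
        case inside: True
        then have near: "norm (x1 + y - x0) < r" "\<epsilon> \<le> norm y" by (auto simp: dist_norm norm_minus_commute)
        have "norm y \<le> norm (x1 + y - x0) + norm (x1 - x0)"
          using norm_triangle_ineq4[of "x1 + y - x0" "x1 - x0"] by simp
        then have "norm y \<le> 2 * r" using near x1 by linarith
        then have k: "\<kappa> r / 2 \<le> k y" using kl y \<kappa> unfolding kernel_lower_def \<kappa>_def by fastforce
        \<comment> \<open>The first factor is nonpositive, so the kernel may be replaced by a lower bound
          of it.\<close>
        have "(W (x1 + y) - \<phi>) * k y \<le> (W (x1 + y) - \<phi>) * (\<kappa> r / 2)"
          using W k by (intro mult_left_mono_neg) auto
        also have "\<dots> \<le> (w (x1 + y) - \<phi>) * (\<kappa> r / 2)"
          using data[of "x1 + y"] near \<kappa> by (intro mult_right_mono) auto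
        also have "\<dots> = \<kappa> r / 2 * m * bump (?z + (1 / r) *\<^sub>R y) - \<kappa> r / 2 * A (x1 + y)"
        proof -
          have "(w (x1 + y) - \<phi>) * h = h * m * bump (?z + (1 / r) *\<^sub>R y) - h * (c - w (x1 + y))" for h
            by (simp add: \<phi>_def algebra_simps)
          moreover have "A (x1 + y) = c - w (x1 + y)" using inside by (simp add: A_def)
          ultimately show ?thesis by simp
        qed
        finally show ?thesis using tail by linarith
      next
        case False
        then have "A (x1 + y) = 0" by (auto simp: A_def)
        moreover have "(W (x1 + y) - \<phi>) * k y \<le> 0"
          using W ky by (simp add: mult_nonpos_nonneg)
        ultimately show ?thesis using tail bnn by simp
      qed
    next
      case False
      then have out: "2 * r \<le> norm (x1 + y - x0)" by simp
      note tb = tail_bound[OF x1 out r s(1)]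
      have "1 \<le> norm (?z + (1 / r) *\<^sub>R y)" unfolding scale using out r by (simp add: divide_simps)
      then have b0: "bump (?z + (1 / r) *\<^sub>R y) = 0" by (rule bump_eq_0)
      have A0: "A (x1 + y) = 0" using out r by (simp add: A_def dist_norm norm_minus_commute indicator_def)
      have "(W (x1 + y) - \<phi>) * k y \<le> (E * (norm (x1 + y - x0) / r) powr s) * k y"
        using growth[OF out] ky by (intro mult_right_mono) (auto simp: \<phi>_def b0)
      also have "\<dots> \<le> (E * (2 powr s * r powr (- s) * norm y powr s)) * (Lam * norm y powr (- ?n - 2 * s))"
        using tb(2) E ky by (intro mult_mono) auto
      also have "\<dots> = E * (2 powr s * Lam * r powr (- s)) * (norm y powr s * norm y powr (- ?n - 2 * s))"
        by (simp add: mult_ac)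
      also have "norm y powr s * norm y powr (- ?n - 2 * s) = T y"
      proof -
        have eq: "s + (- ?n - 2 * s) = - ?n - s" by simp
        show ?thesis using tb(1) unfolding powr_add[symmetric] eq T_def by simp
      qed
      finally show ?thesis by (simp add: b0 A0)
    qed
    then show ?thesis unfolding split G_def by simp
  qed
  have "(LINT y|lebesgue. ?F y) \<le> (LINT y|lebesgue. G y)"
  proof (rule integral_mono_AE[OF F])
    show "integrable lebesgue G"
      unfolding G_def using N T(1) bi(1) A(1)
      by (intro Bochner_Integration.integrable_add Bochner_Integration.integrable_diff integrable_mult_right) auto
    show "AE y in lebesgue. ?F y \<le> G y" by (rule eventually_mono[OF AE_lebesgue_nonzero pt])
  qed
  also have "\<dots> = m * (LINT y|lebesgue. ?N y) + E * (2 powr s * Lam * r powr (- s)) * (LINT y|lebesgue. T y)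
      + \<kappa> r / 2 * m * ?J - \<kappa> r / 2 * (LINT x|lebesgue. A x)"
    unfolding G_def using N T(1) bi(1,2) A by simp
  also have "E * (2 powr s * Lam * r powr (- s)) * (LINT y|lebesgue. T y)
      \<le> E * (2 powr s * Lam * r powr (- s)) * (dyadic_const TYPE('a) s * r powr (- s))"
    using T(2) E lam by (intro mult_left_mono) auto
  also have "\<dots> = E * (2 powr s * Lam * dyadic_const TYPE('a) s) * (r powr (- s) * r powr (- s))"
    by (simp add: mult_ac)
  also have "r powr (- s) * r powr (- s) = r powr (- 2 * s)" by (simp flip: powr_add)
  finally have "(LINT y|lebesgue. ?F y) \<le> m * ((LINT y|lebesgue. ?N y) + \<kappa> r / 2 * ?J)
      + E * (2 powr s * Lam * dyadic_const TYPE('a) s) * r powr (- 2 * s) - \<kappa> r / 2 * (LINT x|lebesgue. A x)"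
    by (simp add: algebra_simps)
  also have "m * ((LINT y|lebesgue. ?N y) + \<kappa> r / 2 * ?J) \<le> m * (C * r powr (- 2 * s) * bump ?z)"
    using barrier m by (intro mult_left_mono)
  finally show ?thesis unfolding A_def by linarith
qed

section \<open>Barriers that vary in time\<close>

text \<open>Variation of constants. The lower bound involves \<open>g\<close> only through its mass on an initial
part of the interval, since this is all that is known about \<open>g\<close> in the application.\<close>

lemma damped_growth:
  fixes g :: "real \<Rightarrow> real"
  assumes g: "continuous_on {a..b} g" "\<And>t. t \<in> {a..b} \<Longrightarrow> 0 \<le> g t"
    and "a \<le> b" "0 \<le> \<kappa>" "0 \<le> L"
  shows "\<exists>m. m a = 0 \<and> (\<forall>t\<in>{a..b}. 0 \<le> m t \<and> (m has_real_derivative (\<kappa> * g t - L * m t)) (at t within {a..b})) \<and>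
    (\<forall>c\<in>{a..b}. \<forall>t\<in>{c..b}. \<kappa> * exp (- L * (b - a)) * integral {a..c} g \<le> m t)"
proof -
  define G where "G t = integral {a..t} (\<lambda>\<tau>. exp (L * \<tau>) * g \<tau>)" for t
  define m where "m t = \<kappa> * exp (- L * t) * G t" for t
  have cont: "continuous_on {a..b} (\<lambda>\<tau>. exp (L * \<tau>) * g \<tau>)"
    using g by (intro continuous_intros)
  have int: "(\<lambda>\<tau>. exp (L * \<tau>) * g \<tau>) integrable_on {a..t}" if "t \<le> b" for t
    using that by (intro integrable_continuous_real continuous_on_subset[OF cont]) auto
  have gint: "g integrable_on {a..t}" if "t \<le> b" for t
    using that by (intro integrable_continuous_real continuous_on_subset[OF g(1)]) auto
  have Gpos: "0 \<le> G t" if "t \<in> {a..b}" for t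
    unfolding G_def using that g(2) by (intro integral_nonneg int) auto
  have "(m has_real_derivative (\<kappa> * g t - L * m t)) (at t within {a..b})" if t: "t \<in> {a..b}" for t
  proof -
    have "(G has_real_derivative exp (L * t) * g t) (at t within {a..b})"
      unfolding G_def using integral_has_real_derivative[OF cont t] .
    then have "(m has_real_derivative (\<kappa> * (exp (- L * t) * (- L)) * G t + \<kappa> * exp (- L * t) * (exp (L * t) * g t)))
        (at t within {a..b})"
      unfolding m_def by (auto intro!: derivative_eq_intros)
    moreover have "\<kappa> * (exp (- L * t) * (- L)) * G t + \<kappa> * exp (- L * t) * (exp (L * t) * g t) = \<kappa> * g t - L * m t"
      by (simp add: m_def exp_minus)
    ultimately show ?thesis by simp
  qed
  moreover have "0 \<le> m t" if "t \<in> {a..b}" for t using Gpos[OF that] assms by (simp add: m_def)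
  moreover have "\<kappa> * exp (- L * (b - a)) * integral {a..c} g \<le> m t" if c: "c \<in> {a..b}" and t: "t \<in> {c..b}" for c t
  proof -
    have "exp (L * a) * integral {a..c} g = integral {a..c} (\<lambda>\<tau>. exp (L * a) * g \<tau>)" by simp
    also have "\<dots> \<le> integral {a..c} (\<lambda>\<tau>. exp (L * \<tau>) * g \<tau>)"
      using c assms gint[of c] int[of c]
      by (intro integral_le) (auto intro!: mult_right_mono mult_left_mono integrable_on_cmult_left)
    also have "\<dots> \<le> G t"
      unfolding G_def using c t g(2)
      by (intro integral_subset_le int) auto
    finally have 1: "exp (L * a) * integral {a..c} g \<le> G t" .
    have 2: "exp (- L * (b - a)) \<le> exp (- L * t) * exp (L * a)"
      using t assms by (auto simp: algebra_simps mult_left_mono simp flip: exp_add)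
    have "0 \<le> integral {a..c} g" using c g(2) gint by (intro integral_nonneg) auto
    then have "exp (- L * (b - a)) * integral {a..c} g \<le> exp (- L * t) * exp (L * a) * integral {a..c} g"
      using 2 by (intro mult_right_mono)
    also have "\<dots> = exp (- L * t) * (exp (L * a) * integral {a..c} g)" by simp
    also have "\<dots> \<le> exp (- L * t) * G t" using 1 by (intro mult_left_mono) auto
    finally show ?thesis using assms(4) mult_left_mono by (fastforce simp: m_def mult.assoc)
  qed
  moreover have "m a = 0" by (simp add: m_def G_def)
  ultimately show ?thesis by blast
qed

lemma continuous_on_if_semicontinuous:
  assumes "usc_on S u" "lsc_on S u" shows "continuous_on S u"
  unfolding continuous_on_def using assms
  by (auto simp: usc_on_def lsc_on_def intro!: order_tendstoI)

lemma slice_integrable: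
  fixes q :: "'a::euclidean_space \<Rightarrow> real"
  assumes "continuous_on (cball x0 r) q"
  shows "integrable lebesgue (\<lambda>x. indicator (ball x0 r) x * q x)"
proof -
  have "compact (q ` cball x0 r)" using assms by (intro compact_continuous_image) auto
  then obtain B where B: "\<And>x. x \<in> cball x0 r \<Longrightarrow> \<bar>q x\<bar> \<le> B"
    by (metis compact_imp_bounded bounded_iff imageI real_norm_def)
  have "(\<lambda>x. indicator (ball x0 r) x *\<^sub>R q x) \<in> borel_measurable borel"
    using assms by (intro borel_measurable_continuous_on_indicator) (auto intro: continuous_on_subset ball_subset_cball)
  then have m: "(\<lambda>x. indicator (ball x0 r) x * q x) \<in> borel_measurable lebesgue"
    by (intro measurable_completion) simp
  show ?thesis
    by (rule Bochner_Integration.integrable_bound[OF integrable_mult_right[OF integrable_indicator_ball[of x0 r], of B] m])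
      (use B in \<open>auto simp: indicator_def intro!: AE_I2 order_trans[OF B abs_ge_self]\<close>)
qed

text \<open>Dominated convergence. Continuity in time of this mass is what makes the solution of the differential
equation in \<open>damped_growth\<close> differentiable at every time.\<close>

lemma slice_integral_continuous:
  fixes u :: "'a::euclidean_space \<times> real \<Rightarrow> real"
  assumes u: "continuous_on (cball x0 r \<times> {a..b}) u"
  shows "continuous_on {a..b} (\<lambda>t. LINT x|lebesgue. indicator (ball x0 r) x * (c - u (x, t)))"
proof -
  have slice: "continuous_on (cball x0 r) (\<lambda>x. c - u (x, t))" if "t \<in> {a..b}" for t
    using that by (intro continuous_intros continuous_on_compose2[OF u]) auto
  have "compact ((\<lambda>q. c - u q) ` (cball x0 r \<times> {a..b}))"
    by (intro compact_continuous_image continuous_intros u compact_Times) auto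
  then obtain B where B: "\<And>q. q \<in> cball x0 r \<times> {a..b} \<Longrightarrow> \<bar>c - u q\<bar> \<le> B"
    by (metis compact_imp_bounded bounded_iff imageI real_norm_def)
  show ?thesis
    unfolding continuous_on_sequentially comp_def
  proof (intro allI ballI impI, elim conjE)
    fix \<tau> t assume t: "t \<in> {a..b}" and \<tau>: "\<forall>n. \<tau> n \<in> {a..b}" "\<tau> \<longlonglongrightarrow> t"
    show "(\<lambda>n. LINT x|lebesgue. indicator (ball x0 r) x * (c - u (x, \<tau> n))) \<longlonglongrightarrow>
      (LINT x|lebesgue. indicator (ball x0 r) x * (c - u (x, t)))"
    proof (rule integral_dominated_convergence[where w = "\<lambda>x. B * indicator (ball x0 r) x"])
      show "integrable lebesgue (\<lambda>x. B * indicator (ball x0 r) x)"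
        by (intro integrable_mult_right integrable_indicator_ball)
      show "(\<lambda>x. indicator (ball x0 r) x * (c - u (x, t))) \<in> borel_measurable lebesgue"
        using slice_integrable[OF slice[OF t]] by simp
      show "(\<lambda>x. indicator (ball x0 r) x * (c - u (x, \<tau> n))) \<in> borel_measurable lebesgue" for n
        using slice_integrable[OF slice[of "\<tau> n"]] \<tau> by simp
      show "AE x in lebesgue. norm (indicator (ball x0 r) x * (c - u (x, \<tau> n))) \<le> B * indicator (ball x0 r) x" for n
        using B \<tau> by (auto simp: indicator_def intro!: AE_I2)
      have "(\<lambda>n. u (x, \<tau> n)) \<longlonglongrightarrow> u (x, t)" if "x \<in> cball x0 r" for x
        using that t \<tau>
        by (intro continuous_on_tendsto_compose[OF u] tendsto_intros) auto
      then show "AE x in lebesgue. (\<lambda>n. indicator (ball x0 r) x * (c - u (x, \<tau> n))) \<longlonglongrightarrow> indicator (ball x0 r) x * (c - u (x, t))"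
        by (intro AE_I2) (auto simp: indicator_def intro!: tendsto_intros)
    qed
  qed
qed

definition barrier :: "'a::euclidean_space \<Rightarrow> real \<Rightarrow> (real \<Rightarrow> real) \<Rightarrow> (real \<Rightarrow> real) \<Rightarrow> 'a \<times> real \<Rightarrow> real" where
  "barrier x0 r c m = (\<lambda>(x, t). c t - m t * bump ((1 / r) *\<^sub>R (x - x0)))"

lemma GDERIV_barrier:
  "GDERIV (\<lambda>x. barrier x0 r c m (x, t)) x :> (- (m t / r)) *\<^sub>R bump_grad ((1 / r) *\<^sub>R (x - x0))"
proof -
  have "((\<lambda>x. bump ((1 / r) *\<^sub>R (x - x0))) has_derivative (\<lambda>h. ((1 / r) *\<^sub>R h) \<bullet> bump_grad ((1 / r) *\<^sub>R (x - x0)))) (at x)"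
    by (rule has_derivative_compose[OF _ GDERIV_bump[unfolded gderiv_def]])
      (auto intro!: derivative_eq_intros)
  then show ?thesis
    unfolding gderiv_def barrier_def by (auto intro!: derivative_eq_intros)
qed

lemma barrier_taylor:
  assumes "0 < r" "norm y < r" "0 \<le> m t"
  shows "\<bar>barrier x0 r c m (x + y, t) - barrier x0 r c m (x, t)
      - y \<bullet> ((- (m t / r)) *\<^sub>R bump_grad ((1 / r) *\<^sub>R (x - x0)))\<bar> \<le> 25 * m t / r\<^sup>2 * (norm y)\<^sup>2"
proof -
  let ?z = "(1 / r) *\<^sub>R (x - x0)" and ?w = "(1 / r) *\<^sub>R y"
  have w: "norm ?w \<le> 1" using assms by simp
  have "barrier x0 r c m (x + y, t) - barrier x0 r c m (x, t) - y \<bullet> ((- (m t / r)) *\<^sub>R bump_grad ?z)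
      = - m t * (bump (?z + ?w) - bump ?z - ?w \<bullet> bump_grad ?z)"
    by (simp add: barrier_def algebra_simps)
  also have "\<bar>\<dots>\<bar> \<le> m t * (25 * (norm ?w)\<^sup>2)"
    using mult_left_mono[OF bump_taylor[OF w, of ?z] assms(3)] assms(3) by (simp add: abs_mult)
  also have "\<dots> = 25 * m t / r\<^sup>2 * (norm y)\<^sup>2" by (simp add: power_divide)
  finally show ?thesis .
qed

lemma test_function_barrier:
  assumes r: "0 < r" and "0 < \<epsilon>"
    and der: "\<And>t. snd p - \<epsilon> < t \<Longrightarrow> t \<le> snd p \<Longrightarrow> \<exists>c'. (c has_real_derivative c') (at_left t)"
      "\<And>t. snd p - \<epsilon> < t \<Longrightarrow> t \<le> snd p \<Longrightarrow> \<exists>m'. (m has_real_derivative m') (at_left t)"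
  shows "test_function \<epsilon> p (barrier x0 r c m)"
  unfolding test_function_def
proof (intro conjI ballI)
  fix q assume "q \<in> cylinder \<epsilon> p"
  then have t: "snd p - \<epsilon> < snd q" "snd q \<le> snd p" by (auto simp: cylinder_def)
  obtain c' m' where "(c has_real_derivative c') (at_left (snd q))" "(m has_real_derivative m') (at_left (snd q))"
    using der t by meson
  then have "((\<lambda>t. c t - m t * bump ((1 / r) *\<^sub>R (fst q - x0))) has_real_derivative
      (c' - m' * bump ((1 / r) *\<^sub>R (fst q - x0)))) (at_left (snd q))"
    by (intro derivative_intros DERIV_cmult_right)
  then show "case q of (x, t) \<Rightarrow> \<exists>D. ((\<lambda>\<tau>. barrier x0 r c m (x, \<tau>)) has_real_derivative D) (at_left t)"
    by (auto simp: barrier_def split_beta)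
next
  fix t
  let ?B = "(norm (fst p - x0) + \<epsilon>) / r"
  have B: "0 \<le> ?B" using assms by simp
  let ?G = "\<lambda>x. (- (m t / r)) *\<^sub>R bump_grad ((1 / r) *\<^sub>R (x - x0))"
  have "(\<bar>- (m t / r)\<bar> * ((4 + 8 * ?B\<^sup>2) * \<bar>1 / r\<bar>))-lipschitz_on (ball (fst p) \<epsilon>) ?G"
  proof (rule lipschitz_onI)
    fix x y assume xy: "x \<in> ball (fst p) \<epsilon>" "y \<in> ball (fst p) \<epsilon>"
    have in_ball: "(1 / r) *\<^sub>R (x - x0) \<in> cball 0 ?B" if "x \<in> ball (fst p) \<epsilon>" for x
    proof -
      have "norm (x - x0) \<le> norm (fst p - x0) + norm (x - fst p)"
        using norm_triangle_ineq[of "fst p - x0" "x - fst p"] by simp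
      then show ?thesis using that r by (simp add: divide_right_mono dist_norm norm_minus_commute)
    qed
    have "dist (?G x) (?G y) = \<bar>- (m t / r)\<bar> * dist (bump_grad ((1 / r) *\<^sub>R (x - x0))) (bump_grad ((1 / r) *\<^sub>R (y - x0)))"
      by (simp only: dist_norm scaleR_diff_right[symmetric] norm_scaleR)
    also have "\<dots> \<le> \<bar>- (m t / r)\<bar> * ((4 + 8 * ?B\<^sup>2) * dist ((1 / r) *\<^sub>R (x - x0)) ((1 / r) *\<^sub>R (y - x0)))"
      using lipschitz_onD[OF bump_grad_Lipschitz[OF B] in_ball in_ball] xy by (intro mult_left_mono) auto
    also have "dist ((1 / r) *\<^sub>R (x - x0)) ((1 / r) *\<^sub>R (y - x0)) = \<bar>1 / r\<bar> * dist x y"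
      by (simp only: dist_norm scaleR_diff_right[symmetric] norm_scaleR) simp
    finally show "dist (?G x) (?G y) \<le> (\<bar>- (m t / r)\<bar> * ((4 + 8 * ?B\<^sup>2) * \<bar>1 / r\<bar>)) * dist x y"
      by (simp only: mult.assoc)
  qed simp
  then show "C11_on (ball (fst p) \<epsilon>) (\<lambda>x. barrier x0 r c m (x, t))"
    unfolding C11_on_def by (intro exI conjI ballI) (rule GDERIV_barrier, assumption)
qed

section \<open>The equation at a touching point\<close>

text \<open>Truncating the lower bound at \<open>\<rho>\<close> does not affect its value at distance
\<open>2 * r\<close>, because \<open>\<rho> \<le> r\<close>.\<close>

lemma admissible_kernel_bounds:
  fixes K :: "'a::euclidean_space \<Rightarrow> 'a \<Rightarrow> real \<Rightarrow> real"
  assumes K: "admissible_kernel s lam Lam \<rho> K" and "0 < s" "0 < lam" "0 < \<rho>" "\<rho> \<le> r"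
  shows "kernel_upper s Lam (\<lambda>y. K x y t)" "kernel_lower s lam r (\<lambda>y. K x y t)"
proof -
  show "kernel_upper s Lam (\<lambda>y. K x y t)"
    using K by (simp add: kernel_upper_def admissible_kernel_def)
  show "kernel_lower s lam r (\<lambda>y. K x y t)"
    unfolding kernel_lower_def kernel_floor_def
  proof (intro allI impI)
    fix y :: 'a assume y: "y \<noteq> 0" "norm y \<le> 2 * r"
    let ?e = "- real DIM('a) - 2 * s"
    have "(2 * r) powr ?e \<le> norm y powr ?e" "(2 * r) powr ?e \<le> \<rho> powr ?e"
      using y assms by (auto intro!: powr_mono2')
    then have "lam * (2 * r) powr ?e \<le> lam * min (norm y powr ?e) (\<rho> powr ?e)"
      using assms by (intro mult_left_mono) auto
    also have "\<dots> \<le> K x y t" using K y by (simp add: admissible_kernel_def)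
    finally show "lam * (2 * r) powr ?e \<le> K x y t" .
  qed
qed

text \<open>If the barrier touches \<open>u\<close> from above at \<open>(x1, t1)\<close>, it is an admissible test
function on every small cylinder ending there, and the resulting inequality is combined with the bound
for the operator of the glued function.\<close>

lemma touching_barrier_estimate:
  fixes K :: "'a::euclidean_space \<Rightarrow> 'a \<Rightarrow> real \<Rightarrow> real" and u f :: "'a \<times> real \<Rightarrow> real" and s lam Lam C \<tau> r a b :: real
  defines "\<kappa> \<equiv> kernel_floor TYPE('a) s lam r / 2"
  defines "T0 \<equiv> 2 powr s * Lam * dyadic_const TYPE('a) s"
  assumes s: "0 < s" "s < 1" and lam: "0 < lam" "0 < Lam" and \<tau>: "0 < \<tau>"
    and barrier: "\<And>z. \<And>k :: 'a \<Rightarrow> real. norm z < 1 \<Longrightarrow> kernel_upper s Lam k \<Longrightarrow> kernel_lower s lam r k \<Longrightarrow>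
       (LINT y|lebesgue. bump_defect s (\<tau> * r) r z y * k y) + \<kappa> * bump_mass TYPE('a) r
       \<le> C * r powr (- 2 * s) * bump z"
    and \<rho>: "0 < \<rho>" "\<rho> \<le> r" and K: "admissible_kernel s lam Lam \<rho> K"
    and visc: "viscosity_inequality s K \<Omega> I f u"
    and dom: "ball x0 r \<subseteq> \<Omega>" "{a..b} \<subseteq> I"
    and p: "norm (x1 - x0) < r" "t1 \<in> {a<..b}"
    and \<epsilon>: "0 < \<epsilon>" "\<epsilon> \<le> r - norm (x1 - x0)" "\<epsilon> \<le> t1 - a"
    and c: "\<And>t. t \<in> {a..b} \<Longrightarrow> (c has_real_derivative c') (at t within {a..b})"
    and m: "\<And>t. t \<in> {a..b} \<Longrightarrow> 0 \<le> m t"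
      "\<And>t. t \<in> {a..b} \<Longrightarrow> (m has_real_derivative m' t) (at t within {a..b})"
    and touch: "u (x1, t1) = barrier x0 r c m (x1, t1)"
    and above: "\<And>x t. norm (x - x0) < 2 * r \<Longrightarrow> t \<in> {a..b} \<Longrightarrow> u (x, t) \<le> barrier x0 r c m (x, t)"
    and E: "0 \<le> E"
    and growth: "\<And>x. 2 * r \<le> norm (x - x0) \<Longrightarrow> u (x, t1) \<le> c t1 + E * (norm (x - x0) / r) powr s"
    and int: "integrable lebesgue (\<lambda>x. indicator (ball x0 r - ball x1 \<epsilon>) x * (c t1 - u (x, t1)))"
  shows "c' - m' t1 * bump ((1 / r) *\<^sub>R (x1 - x0))
    \<le> f (x1, t1) + m t1 * (C * r powr (- 2 * s) * bump ((1 / r) *\<^sub>R (x1 - x0)))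
      - \<kappa> * (LINT x|lebesgue. indicator (ball x0 r - ball x1 \<epsilon>) x * (c t1 - u (x, t1)))
      + E * T0 * r powr (- 2 * s)"
proof -
  let ?z = "(1 / r) *\<^sub>R (x1 - x0)" and ?\<phi> = "barrier x0 r c m" and ?Q = "cylinder \<epsilon> (x1, t1)"
  let ?g = "(- (m t1 / r)) *\<^sub>R bump_grad ?z"
  let ?W = "\<lambda>x. glue ?Q ?\<phi> u (x, t1)"
  have r: "0 < r" using \<rho> by simp
  have t1: "t1 \<in> {a..b}" "a < t1" using p by auto
  have Q: "?Q \<subseteq> ball x0 r \<times> {a<..b}"
  proof
    fix q assume "q \<in> ?Q"
    then have q: "dist x1 (fst q) < \<epsilon>" "t1 - \<epsilon> < snd q" "snd q \<le> t1" by (auto simp: cylinder_def)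
    have "dist x0 (fst q) \<le> norm (x1 - x0) + dist x1 (fst q)"
      by (metis dist_commute dist_norm dist_triangle)
    then show "q \<in> ball x0 r \<times> {a<..b}" using q \<epsilon> p by (auto simp: mem_Times_iff)
  qed
  have left: "(h has_real_derivative d) (at_left t)"
    if "(h has_real_derivative d) (at t within {a..b})" "t \<in> {a<..b}" for h d t
  proof -
    have "(h has_real_derivative d) (at t within {a..t})"
      using that by (intro has_field_derivative_subset[OF that(1)]) auto
    then show ?thesis using that at_within_Icc_at_left[of a t] by simp
  qed
  have test: "test_function \<epsilon> (x1, t1) ?\<phi>"
    using \<epsilon> p left[OF c] left[OF m(2)] by (intro test_function_barrier[OF r \<epsilon>(1)]) force+
  have D: "((\<lambda>\<tau>. ?\<phi> (x1, \<tau>)) has_real_derivative (c' - m' t1 * bump ?z)) (at_left t1)"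
    unfolding barrier_def prod.case
    using left[OF c[OF t1(1)]] left[OF m(2)[OF t1(1)]] p by (intro derivative_intros DERIV_cmult_right) auto
  have quad: "\<forall>y. norm y < \<epsilon> \<longrightarrow> \<bar>?\<phi> (x1 + y, t1) - ?\<phi> (x1, t1) - y \<bullet> ?g\<bar> \<le> 25 * m t1 / r\<^sup>2 * (norm y)\<^sup>2"
  proof (intro allI impI)
    fix y :: 'a assume "norm y < \<epsilon>"
    then have "norm y < r" using \<epsilon>(2) norm_ge_zero[of "x1 - x0"] by linarith
    then show "\<bar>?\<phi> (x1 + y, t1) - ?\<phi> (x1, t1) - y \<bullet> ?g\<bar> \<le> 25 * m t1 / r\<^sup>2 * (norm y)\<^sup>2"
      by (intro barrier_taylor r m(1) t1(1))
  qed
  have aboveQ: "\<forall>q\<in>?Q. u q \<le> ?\<phi> q"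
  proof
    fix q assume "q \<in> ?Q"
    then have "fst q \<in> ball x0 r" "snd q \<in> {a..b}" using Q by fastforce+
    then show "u q \<le> ?\<phi> q" using above[of "fst q" "snd q"] r by (simp add: dist_norm norm_minus_commute)
  qed
  have "{a<..b} \<subseteq> I" using dom(2) by force
  then have "ball x0 r \<times> {a<..b} \<subseteq> \<Omega> \<times> I" using dom(1) by blast
  moreover have "(x1, t1) \<in> ball x0 r \<times> {a<..b}" using p by (auto simp: dist_norm norm_minus_commute)
  ultimately have mem: "(x1, t1) \<in> \<Omega> \<times> I" "?Q \<subseteq> \<Omega> \<times> I" "0 < \<tau> * r"
    using Q \<tau> r by (blast, blast, simp)
  have \<phi>p: "?\<phi> (x1, t1) = c t1 - m t1 * bump ?z" by (simp add: barrier_def)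
  from visc[unfolded viscosity_inequality_def, rule_format, OF mem(1) \<epsilon>(1) mem(3,2) test D GDERIV_barrier quad[rule_format] touch aboveQ[rule_format]]
  have F: "integrable lebesgue (\<lambda>y. (?W (x1 + y) - (c t1 - m t1 * bump ?z) - cutoff s (\<tau> * r) y * (y \<bullet> ?g)) * K x1 y t1)"
    and ineq: "c' - m' t1 * bump ?z
       - (LINT y|lebesgue. (?W (x1 + y) - (c t1 - m t1 * bump ?z) - cutoff s (\<tau> * r) y * (y \<bullet> ?g)) * K x1 y t1) \<le> f (x1, t1)"
    unfolding \<phi>p by auto
  note k = admissible_kernel_bounds[OF K s(1) lam(1) \<rho>, of x1 t1]
  have z: "norm ?z < 1" using p r by simp
  have inQ: "(x, t1) \<in> ?Q \<longleftrightarrow> norm (x - x1) < \<epsilon>" for x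
    using \<epsilon> by (auto simp: cylinder_def dist_norm norm_minus_commute)
  have far: "\<epsilon> \<le> norm (x - x1)" if "r \<le> norm (x - x0)" for x
    using that \<epsilon> norm_triangle_ineq[of "x - x1" "x1 - x0"] by simp
  have "(LINT y|lebesgue. (?W (x1 + y) - (c t1 - m t1 * bump ?z) - cutoff s (\<tau> * r) y * (y \<bullet> ?g)) * K x1 y t1)
    \<le> m t1 * (C * r powr (- 2 * s) * bump ?z)
      - kernel_floor TYPE('a) s lam r / 2 * (LINT x|lebesgue. indicator (ball x0 r - ball x1 \<epsilon>) x * (c t1 - u (x, t1)))
      + E * (2 powr s * Lam * dyadic_const TYPE('a) s) * r powr (- 2 * s)"
  proof (rule glued_operator_upper_bound[OF s lam r \<tau> k _ p(1) m(1)[OF t1(1)] E _ _ _ F int])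
    show "(LINT y|lebesgue. bump_defect s (\<tau> * r) r ?z y * K x1 y t1)
        + kernel_floor TYPE('a) s lam r / 2 * bump_mass TYPE('a) r \<le> C * r powr (- 2 * s) * bump ?z"
      using barrier[OF z k] by (simp add: \<kappa>_def)
    show "?W x \<le> c t1 - m t1 * bump ((1 / r) *\<^sub>R (x - x0))" if "norm (x - x0) < 2 * r" for x
      using above[OF that t1(1)] by (simp add: glue_def barrier_def)
    show "?W x \<le> u (x, t1)" if "norm (x - x0) < r" "\<epsilon> \<le> norm (x - x1)" for x
      using that by (simp add: glue_def inQ)
    show "?W x \<le> c t1 + E * (norm (x - x0) / r) powr s" if "2 * r \<le> norm (x - x0)" for x
      using growth[OF that] far[of x] that r by (simp add: glue_def inQ)
  qed
  with ineq show ?thesis unfolding \<kappa>_def T0_def by linarith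
qed

text \<open>Excising a ball of radius \<open>\<epsilon>\<close> loses an amount of order
\<open>\<epsilon> ^ DIM('a)\<close>, which is negligible as the cylinder of the test function may be
taken arbitrarily small.\<close>

lemma excised_integral_ge:
  fixes q q' :: "'a::euclidean_space \<Rightarrow> real"
  assumes q: "continuous_on (cball x0 r) q" "continuous_on (cball x0 r) q'"
    and qq: "\<And>x. x \<in> cball x0 r \<Longrightarrow> q x \<le> q' x" "\<And>x. x \<in> cball x0 r \<Longrightarrow> q x \<le> B"
    and \<epsilon>: "0 < \<epsilon>" "ball x1 \<epsilon> \<subseteq> ball x0 r" and B: "0 \<le> B"
  shows "integrable lebesgue (\<lambda>x. indicator (ball x0 r - ball x1 \<epsilon>) x * q' x)"
    and "(LINT x|lebesgue. indicator (ball x0 r) x * q x) - B * (unit_ball_vol (real DIM('a)) * \<epsilon> ^ DIM('a))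
      \<le> (LINT x|lebesgue. indicator (ball x0 r - ball x1 \<epsilon>) x * q' x)"
proof -
  have "indicator (ball x0 r - ball x1 \<epsilon>) x * q' x = indicator (ball x0 r) x * q' x - indicator (ball x1 \<epsilon>) x * q' x" for x
    using \<epsilon>(2) by (auto simp: indicator_def)
  moreover have "integrable lebesgue (\<lambda>x. indicator (ball x1 \<epsilon>) x * q' x)"
  proof (rule slice_integrable)
    have "cball x1 \<epsilon> = closure (ball x1 \<epsilon>)" using \<epsilon> by simp
    also have "\<dots> \<subseteq> closure (ball x0 r)" using \<epsilon> by (intro closure_mono)
    also have "\<dots> \<subseteq> cball x0 r" by (intro closure_minimal) auto
    finally show "continuous_on (cball x1 \<epsilon>) q'" using continuous_on_subset[OF q(2)] by blast
  qed
  ultimately show int: "integrable lebesgue (\<lambda>x. indicator (ball x0 r - ball x1 \<epsilon>) x * q' x)"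
    using slice_integrable[OF q(2)] by simp
  note i = slice_integrable[OF q(1)] integrable_indicator_ball[of x1 \<epsilon>]
  have "(LINT x|lebesgue. indicator (ball x0 r) x * q x - B * indicator (ball x1 \<epsilon>) x)
      \<le> (LINT x|lebesgue. indicator (ball x0 r - ball x1 \<epsilon>) x * q' x)"
  proof (rule integral_mono[OF _ int])
    show "integrable lebesgue (\<lambda>x. indicator (ball x0 r) x * q x - B * indicator (ball x1 \<epsilon>) x)"
      by (intro Bochner_Integration.integrable_diff integrable_mult_right i)
    fix x
    show "indicator (ball x0 r) x * q x - B * indicator (ball x1 \<epsilon>) x
        \<le> indicator (ball x0 r - ball x1 \<epsilon>) x * q' x"
    proof (cases "x \<in> ball x1 \<epsilon>")
      case True
      then have "x \<in> ball x0 r" using \<epsilon>(2) by blast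
      then show ?thesis using True qq(2)[of x] by simp
    next
      case False
      then show ?thesis using qq(1)[of x] by (cases "x \<in> ball x0 r") auto
    qed
  qed
  then show "(LINT x|lebesgue. indicator (ball x0 r) x * q x) - B * (unit_ball_vol (real DIM('a)) * \<epsilon> ^ DIM('a))
      \<le> (LINT x|lebesgue. indicator (ball x0 r - ball x1 \<epsilon>) x * q' x)"
    using i \<epsilon> by (simp add: content_ball)
qed

section \<open>Improvement of a bound at one scale\<close>

lemma continuous_on_barrier:
  assumes "continuous_on T c" "continuous_on T m"
  shows "continuous_on (S \<times> T) (barrier x0 r c m)"
proof -
  have "continuous_on (S \<times> T) (\<lambda>q. c (snd q) - m (snd q) * bump ((1 / r) *\<^sub>R (fst q - x0)))"
    unfolding bump_def
    by (intro continuous_intros continuous_on_compose2[OF assms(1)] continuous_on_compose2[OF assms(2)]) auto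
  then show ?thesis by (simp add: barrier_def case_prod_beta)
qed

text \<open>The one-scale estimate, as a property of \<open>\<theta>\<close> and \<open>\<eta>\<close> since these
must not depend on the other data. The last hypothesis asks \<open>M - u\<close> to have at least half of
the mass that the constant \<open>D\<close> has on the first half of the time interval.\<close>

definition pointwise_decrease ::
    "'a::euclidean_space itself \<Rightarrow> real \<Rightarrow> real \<Rightarrow> real \<Rightarrow> real \<Rightarrow> real \<Rightarrow> bool" where
  "pointwise_decrease _ s lam Lam \<theta> \<eta> \<longleftrightarrow>
    (\<forall>\<rho> r (K :: 'a::euclidean_space \<Rightarrow> 'a \<Rightarrow> real \<Rightarrow> real) \<Omega> I f u x0 t0 M D.
      0 < \<rho> \<longrightarrow> \<rho> \<le> r \<longrightarrow> admissible_kernel s lam Lam \<rho> K \<longrightarrow>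
      viscosity_inequality s K \<Omega> I f u \<longrightarrow>
      ball x0 r \<subseteq> \<Omega> \<longrightarrow> {t0 - r powr (2 * s)..t0} \<subseteq> I \<longrightarrow>
      continuous_on (cball x0 r \<times> {t0 - r powr (2 * s)..t0}) u \<longrightarrow> 0 < D \<longrightarrow>
      (\<forall>x. \<forall>t\<in>{t0 - r powr (2 * s)..t0}. norm (x - x0) < 2 * r \<longrightarrow> u (x, t) \<le> M) \<longrightarrow>
      (\<forall>x. \<forall>t\<in>{t0 - r powr (2 * s)..t0}. 2 * r \<le> norm (x - x0) \<longrightarrow>
          u (x, t) \<le> M + \<eta> * D * (norm (x - x0) / r) powr s) \<longrightarrow>
      (\<forall>x\<in>ball x0 r. \<forall>t\<in>{t0 - r powr (2 * s)..t0}. f (x, t) \<le> \<eta> * D * r powr (- 2 * s)) \<longrightarrow>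
      D / 4 * (unit_ball_vol (real DIM('a)) * r ^ DIM('a)) * r powr (2 * s)
        \<le> integral {t0 - r powr (2 * s)..t0 - r powr (2 * s) / 2}
            (\<lambda>t. LINT x|lebesgue. indicator (ball x0 r) x * (M - u (x, t))) \<longrightarrow>
      (\<forall>x. \<forall>t\<in>{t0 - r powr (2 * s) / 2..t0}. norm (x - x0) \<le> r / 2 \<longrightarrow> u (x, t) \<le> M - \<theta> * D))"

text \<open>The barrier is \<open>M + \<theta> * D * r powr (- 2 * s) * (t - a) - m t * bump\<close>, where
\<open>a\<close> is the initial time. The positive slope in time leaves room for the right-hand side, for
the growth outside and for the excised ball. By the mass assumption \<open>m\<close> is at least a fixed
multiple of \<open>D\<close> in the second half of the time interval, with a constant that determines
\<open>\<theta>\<close>.\<close>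

lemma point_estimate:
  fixes s lam Lam :: real
  assumes s: "0 < s" "s < 1" and lam: "0 < lam" "0 < Lam"
  shows "\<exists>\<theta> \<eta>. 0 < \<theta> \<and> \<theta> < 1 \<and> 0 < \<eta> \<and>
    pointwise_decrease TYPE('a::euclidean_space) s lam Lam \<theta> \<eta>"
proof -
  let ?w = "unit_ball_vol (real DIM('a))"
  obtain C \<tau> where C: "0 < C" "0 < \<tau>" and barrier: "\<And>r z. \<And>k :: 'a \<Rightarrow> real.
     0 < r \<Longrightarrow> norm z < 1 \<Longrightarrow> kernel_upper s Lam k \<Longrightarrow> kernel_lower s lam r k \<Longrightarrow>
     (LINT y|lebesgue. bump_defect s (\<tau> * r) r z y * k y)
       + kernel_floor TYPE('a) s lam r / 2 * bump_mass TYPE('a) r \<le> C * r powr (- 2 * s) * bump z"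
    using bump_is_barrier[OF s lam, where 'a='a] by blast
  define k1 where "k1 = lam * 2 powr (- real DIM('a) - 2 * s) * ?w / 2"
  have k1: "0 < k1" using lam by (simp add: k1_def)
  define T0 where "T0 = 2 powr s * Lam * dyadic_const TYPE('a) s"
  have T0: "0 < T0" using lam s dyadic_const_pos[OF s(1), where 'a='a] by (simp add: T0_def)
  \<comment> \<open>Half of the least drop \<open>m * bump / D\<close> at late times:
    \<open>exp (- C) * (D / 4) * k1\<close> bounds \<open>m\<close> and \<open>9/16\<close> the
    bump.\<close>
  define \<theta> where "\<theta> = min (1/2) (9/128 * exp (- C) * k1)"
  have \<theta>: "0 < \<theta>" "\<theta> < 1" "2 * \<theta> \<le> 9/64 * exp (- C) * k1" using k1 by (auto simp: \<theta>_def)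
  define \<eta> where "\<eta> = \<theta> / (2 * (1 + T0))"
  have \<eta>: "0 < \<eta>" "\<eta> * (1 + T0) = \<theta> / 2" using \<theta> T0 by (auto simp: \<eta>_def field_simps)
  have main: "u (x, t) \<le> M - \<theta> * D"
    if \<rho>: "0 < \<rho>" "\<rho> \<le> r" and K: "admissible_kernel s lam Lam \<rho> K"
      and visc: "viscosity_inequality s K \<Omega> I f u"
      and dom: "ball x0 r \<subseteq> \<Omega>" "{t0 - r powr (2 * s)..t0} \<subseteq> I"
      and cont: "continuous_on (cball x0 r \<times> {t0 - r powr (2 * s)..t0}) u" and D: "0 < D"
      and upper: "\<forall>x. \<forall>t\<in>{t0 - r powr (2 * s)..t0}. norm (x - x0) < 2 * r \<longrightarrow> u (x, t) \<le> M"
      and growth: "\<forall>x. \<forall>t\<in>{t0 - r powr (2 * s)..t0}. 2 * r \<le> norm (x - x0) \<longrightarrow>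
          u (x, t) \<le> M + \<eta> * D * (norm (x - x0) / r) powr s"
      and f: "\<forall>x\<in>ball x0 r. \<forall>t\<in>{t0 - r powr (2 * s)..t0}. f (x, t) \<le> \<eta> * D * r powr (- 2 * s)"
      and mass: "D / 4 * (?w * r ^ DIM('a)) * r powr (2 * s)
        \<le> integral {t0 - r powr (2 * s)..t0 - r powr (2 * s) / 2}
            (\<lambda>t. LINT x|lebesgue. indicator (ball x0 r) x * (M - u (x, t)))"
      and xt: "t \<in> {t0 - r powr (2 * s) / 2..t0}" "norm (x - x0) \<le> r / 2"
    for \<rho> r and K :: "'a \<Rightarrow> 'a \<Rightarrow> real \<Rightarrow> real" and \<Omega> I f u x0 t0 M D x t
  proof -
    define h where "h = r powr (2 * s)"
    define R where "R = r powr (- 2 * s)"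
    define a where "a = t0 - h"
    have r: "0 < r" using \<rho> by simp
    have h: "0 < h" "0 < R" "R * h = 1" using r by (auto simp: h_def R_def simp flip: powr_add)
    have a: "a < t0" using h by (simp add: a_def)
    note cont = cont[folded h_def, folded a_def] and dom = dom[folded h_def, folded a_def]
      and growth = growth[folded h_def, folded a_def] and f = f[folded h_def R_def, folded a_def]
      and upper = upper[folded h_def, folded a_def] and mass = mass[folded h_def, folded a_def]
    define \<kappa> where "\<kappa> = kernel_floor TYPE('a) s lam r / 2"
    have \<kappa>: "0 < \<kappa>" using kernel_floor_pos[OF lam(1) r, where 'a='a] by (simp add: \<kappa>_def)
    have \<kappa>V: "\<kappa> * (?w * r ^ DIM('a)) * h = k1"
    proof -
      have "\<kappa> * (?w * r ^ DIM('a)) = k1 * R"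
        using kernel_floor_volume[OF r, of 1 s lam, where 'a='a] by (simp add: \<kappa>_def k1_def R_def)
      then show ?thesis using h(3) by (simp only: mult.assoc mult_1_right)
    qed
    define g where "g t = (LINT x|lebesgue. indicator (ball x0 r) x * (M - u (x, t)))" for t
    have gc: "continuous_on {a..t0} g" unfolding g_def by (rule slice_integral_continuous[OF cont])
    have le_M: "u (x, t) \<le> M" if "x \<in> cball x0 r" "t \<in> {a..t0}" for x t
      using upper that r by (auto simp: dist_norm norm_minus_commute)
    have g0: "0 \<le> g t" if "t \<in> {a..t0}" for t
      unfolding g_def using le_M that by (intro integral_nonneg_AE AE_I2) (auto simp: indicator_def)
    obtain m where m0: "m a = 0"
      and m: "\<And>t. t \<in> {a..t0} \<Longrightarrow> 0 \<le> m t"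
        "\<And>t. t \<in> {a..t0} \<Longrightarrow> (m has_real_derivative (\<kappa> * g t - C * R * m t)) (at t within {a..t0})"
      and m_ge: "\<And>c t. c \<in> {a..t0} \<Longrightarrow> t \<in> {c..t0} \<Longrightarrow> \<kappa> * exp (- (C * R) * (t0 - a)) * integral {a..c} g \<le> m t"
      using damped_growth[OF gc g0, of \<kappa> "C * R"] a \<kappa> C h by auto
    define c0 where "c0 t = M + \<theta> * D * R * (t - a)" for t
    have c0: "(c0 has_real_derivative (\<theta> * D * R)) (at t within {a..t0})" for t
      unfolding c0_def by (auto intro!: derivative_eq_intros)
    have c0_ge: "M \<le> c0 t" if "t \<in> {a..t0}" for t
      using that \<theta> D h by (simp add: c0_def)
    have cont_c: "continuous_on {a..t0} c0" "continuous_on {a..t0} m"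
      using DERIV_continuous[OF c0] DERIV_continuous[OF m(2)] by (auto simp: continuous_on_eq_continuous_within)
    let ?S = "cball x0 r \<times> {a..t0}"
    have below: "u q \<le> barrier x0 r c0 m q" if q: "q \<in> ?S" for q
    proof (rule ccontr)
      assume neg: "\<not> u q \<le> barrier x0 r c0 m q"
      have "continuous_on ?S (\<lambda>q. u q - barrier x0 r c0 m q)"
        by (intro continuous_on_diff cont continuous_on_barrier cont_c)
      moreover have "compact ?S" "?S \<noteq> {}" using q by (auto intro: compact_Times)
      ultimately obtain p where p: "p \<in> ?S" and max: "\<And>q. q \<in> ?S \<Longrightarrow> u q - barrier x0 r c0 m q \<le> u p - barrier x0 r c0 m p"
        using continuous_attains_sup[of ?S] by blast
      obtain x1 t1 where x1t1: "p = (x1, t1)" by (cases p)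
      \<comment> \<open>Raised by \<open>N\<close>, the barrier lies above \<open>u\<close> and touches
        it at \<open>p\<close>.\<close>
      define N where "N = u p - barrier x0 r c0 m p"
      have N: "0 < N" using max[OF q] neg by (simp add: N_def)
      let ?z = "(1 / r) *\<^sub>R (x1 - x0)"
      have x1: "norm (x1 - x0) \<le> r" and t1: "t1 \<in> {a..t0}"
        using p x1t1 by (auto simp: dist_norm norm_minus_commute)
      have x1u: "u (x1, t1) \<le> M" using le_M[of x1 t1] p x1t1 by simp
      \<comment> \<open>The touching point is in the interior of the ball and after the initial time,
        because elsewhere the barrier is at least \<open>M\<close>.\<close>
      have pos: "0 < m t1 * bump ?z"
        using N x1u c0_ge[OF t1] by (simp add: N_def x1t1 barrier_def)
      have x1': "norm (x1 - x0) < r"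
      proof (rule ccontr)
        assume "\<not> norm (x1 - x0) < r"
        then have "bump ?z = 0" using r by (intro bump_eq_0) simp
        then show False using pos by simp
      qed
      have t1': "a < t1" using pos m0 t1 by (cases "t1 = a") auto
      have "compact ((\<lambda>q. M - u q) ` ?S)"
        by (intro compact_continuous_image continuous_intros cont compact_Times) auto
      then obtain B where B: "\<And>q. q \<in> ?S \<Longrightarrow> \<bar>M - u q\<bar> \<le> B"
        by (metis compact_imp_bounded bounded_iff imageI real_norm_def)
      have B0: "0 \<le> B" using B[OF p] by linarith
      \<comment> \<open>The radius for which the excised ball costs at most a quarter of the
        slope.\<close>
      define e where "e = \<theta> / 4 * D * R / (\<kappa> * B * ?w + 1)"
      have den: "0 < \<kappa> * B * ?w + 1" using \<kappa> B0 by (simp add: add_nonneg_pos)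
      have e: "0 < e" using \<theta> D h den by (simp add: e_def)
      define \<epsilon> where "\<epsilon> = Min {1, e, r - norm (x1 - x0), t1 - a}"
      have \<epsilon>: "0 < \<epsilon>" "\<epsilon> \<le> 1" "\<epsilon> \<le> e" "\<epsilon> \<le> r - norm (x1 - x0)" "\<epsilon> \<le> t1 - a"
        using e x1' t1' by (auto simp: \<epsilon>_def)
      have small: "\<kappa> * (B * (?w * \<epsilon> ^ DIM('a))) \<le> \<theta> / 4 * D * R"
      proof -
        have "\<epsilon> ^ DIM('a) \<le> \<epsilon> ^ 1" using \<epsilon> by (intro power_decreasing) (auto simp: Suc_le_eq)
        then have "\<epsilon> ^ DIM('a) \<le> e" using \<epsilon> by simp
        then have "\<kappa> * B * ?w * \<epsilon> ^ DIM('a) \<le> (\<kappa> * B * ?w + 1) * e"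
          using \<kappa> B0 \<epsilon> e by (intro mult_mono) auto
        also have "\<dots> = \<theta> / 4 * D * R"
          unfolding e_def using den by (subst times_divide_eq_right, subst nonzero_mult_div_cancel_left) auto
        finally show ?thesis by (simp add: mult_ac)
      qed
      have sub: "ball x1 \<epsilon> \<subseteq> ball x0 r"
        using \<epsilon> by (intro ball_subset_ball_iff[THEN iffD2] disjI1) (auto simp: dist_norm norm_minus_commute)
      have slice: "continuous_on (cball x0 r) (\<lambda>x. l - u (x, t1))" for l
        using t1 by (intro continuous_intros continuous_on_compose2[OF cont]) auto
      define X where "X = (LINT x|lebesgue. indicator (ball x0 r - ball x1 \<epsilon>) x * (c0 t1 + N - u (x, t1)))"
      have X: "integrable lebesgue (\<lambda>x. indicator (ball x0 r - ball x1 \<epsilon>) x * (c0 t1 + N - u (x, t1)))"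
        "g t1 - B * (?w * \<epsilon> ^ DIM('a)) \<le> X"
      proof -
        have hyp: "M - u (x, t1) \<le> c0 t1 + N - u (x, t1)" "M - u (x, t1) \<le> B" if "x \<in> cball x0 r" for x
          using c0_ge[OF t1] N B[of "(x, t1)"] t1 that by auto
        note ex = excised_integral_ge[OF slice slice hyp \<epsilon>(1) sub B0]
        show "integrable lebesgue (\<lambda>x. indicator (ball x0 r - ball x1 \<epsilon>) x * (c0 t1 + N - u (x, t1)))"
          by (rule ex(1))
        show "g t1 - B * (?w * \<epsilon> ^ DIM('a)) \<le> X" unfolding g_def X_def by (rule ex(2))
      qed
      have "\<theta> * D * R - (\<kappa> * g t1 - C * R * m t1) * bump ?z
        \<le> f (x1, t1) + m t1 * (C * r powr (- 2 * s) * bump ?z)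
          - kernel_floor TYPE('a) s lam r / 2 * (LINT x|lebesgue. indicator (ball x0 r - ball x1 \<epsilon>) x * ((c0 t1 + N) - u (x, t1)))
          + \<eta> * D * (2 powr s * Lam * dyadic_const TYPE('a) s) * r powr (- 2 * s)"
      proof (rule touching_barrier_estimate[OF s lam C(2) barrier[OF r] \<rho> K visc dom x1' _ \<epsilon>(1,4,5),
            where c = "\<lambda>t. c0 t + N" and m = m and m' = "\<lambda>t. \<kappa> * g t - C * R * m t"])
        show "t1 \<in> {a<..t0}" using t1 t1' by simp
        show "((\<lambda>t. c0 t + N) has_real_derivative \<theta> * D * R) (at t within {a..t0})" for t
          using c0[of t] by (auto intro!: derivative_eq_intros)
        show "u (x1, t1) = barrier x0 r (\<lambda>t. c0 t + N) m (x1, t1)"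
          by (simp add: N_def x1t1 barrier_def)
        show "u (x, t) \<le> barrier x0 r (\<lambda>t. c0 t + N) m (x, t)"
          if "norm (x - x0) < 2 * r" "t \<in> {a..t0}" for x t
        proof (cases "x \<in> cball x0 r")
          case True
          then have "u (x, t) - barrier x0 r c0 m (x, t) \<le> N"
            unfolding N_def using that by (intro max) auto
          then show ?thesis by (simp add: barrier_def)
        next
          case False
          then have "bump ((1 / r) *\<^sub>R (x - x0)) = 0"
            using r by (intro bump_eq_0) (simp add: dist_norm norm_minus_commute divide_simps)
          moreover have "u (x, t) \<le> M" using upper that by blast
          ultimately show ?thesis using c0_ge[OF that(2)] N by (simp add: barrier_def)
        qed
        show "u (x, t1) \<le> c0 t1 + N + \<eta> * D * (norm (x - x0) / r) powr s" if "2 * r \<le> norm (x - x0)" for x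
        proof -
          have "u (x, t1) \<le> M + \<eta> * D * (norm (x - x0) / r) powr s" using growth that t1 by blast
          then show ?thesis using c0_ge[OF t1] N by linarith
        qed
      qed (use m X \<eta> D in auto)
      then have main: "\<theta> * D * R - \<kappa> * g t1 * bump ?z \<le> f (x1, t1) - \<kappa> * X + \<eta> * D * T0 * R"
        unfolding R_def[symmetric] \<kappa>_def[symmetric] X_def[symmetric] T0_def[symmetric] by (simp add: algebra_simps)
      have "\<kappa> * g t1 * bump ?z \<le> \<kappa> * g t1 * 1"
        using bump_le_1 g0[OF t1] \<kappa> by (intro mult_left_mono) auto
      moreover have "\<kappa> * (g t1 - B * (?w * \<epsilon> ^ DIM('a))) \<le> \<kappa> * X" using X(2) \<kappa> by (intro mult_left_mono) auto
      moreover have "f (x1, t1) \<le> \<eta> * D * R" using f x1' t1 by (simp add: dist_norm norm_minus_commute)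
      \<comment> \<open>The right-hand side and the growth outside together cost at most half of the
        slope.\<close>
      moreover have "\<eta> * D * R + \<eta> * D * T0 * R = \<theta> / 2 * D * R"
        unfolding \<eta>(2)[symmetric] by (simp add: algebra_simps)
      ultimately have "\<theta> * D * R \<le> \<theta> / 2 * D * R + \<theta> / 4 * D * R"
        using main small by (simp only: right_diff_distrib mult_1_right)
      then show False using \<theta> D h by (simp add: mult_le_0_iff)
    qed
    have xt': "t \<in> {a..t0}" "(x, t) \<in> ?S"
      using xt[folded h_def] h r by (auto simp: a_def dist_norm norm_minus_commute)
    have c: "t0 - h / 2 \<in> {a..t0}" "t \<in> {t0 - h / 2..t0}" using xt h by (auto simp: a_def h_def)
    have CRh: "C * R * (t0 - a) = C" using h(3) by (simp add: a_def)
    have "exp (- C) * (D / 4) * k1 = \<kappa> * exp (- C) * (D / 4 * (?w * r ^ DIM('a)) * h)"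
      unfolding \<kappa>V[symmetric] by simp
    also have "\<dots> \<le> \<kappa> * exp (- C) * integral {a..t0 - h / 2} g"
      using mass \<kappa> by (intro mult_left_mono) (auto simp: g_def[abs_def])
    also have "\<dots> \<le> m t" using m_ge[OF c] CRh by simp
    finally have mt: "exp (- C) * (D / 4) * k1 \<le> m t" .
    have "9/16 \<le> bump ((1 / r) *\<^sub>R (x - x0))" using xt r by (intro bump_ge) (simp add: divide_simps)
    then have "exp (- C) * (D / 4) * k1 * (9/16) \<le> m t * bump ((1 / r) *\<^sub>R (x - x0))"
      using mt m(1)[OF xt'(1)] by (intro mult_mono) auto
    moreover have "2 * \<theta> * D \<le> exp (- C) * (D / 4) * k1 * (9/16)"
      using mult_right_mono[OF \<theta>(3), of D] D by simp
    moreover have "c0 t \<le> M + \<theta> * D"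
    proof -
      have "R * (t - a) \<le> R * h" using xt h by (intro mult_left_mono) (auto simp: a_def)
      then have "\<theta> * D * (R * (t - a)) \<le> \<theta> * D * 1" using h \<theta> D by (intro mult_left_mono) auto
      then show ?thesis by (simp add: c0_def mult.assoc)
    qed
    moreover have "u (x, t) \<le> c0 t - m t * bump ((1 / r) *\<^sub>R (x - x0))"
      using below[OF xt'(2)] by (simp add: barrier_def)
    ultimately show ?thesis by linarith
  qed
  have "pointwise_decrease TYPE('a) s lam Lam \<theta> \<eta>"
    unfolding pointwise_decrease_def by (intro allI impI ballI) (rule main; assumption)
  then show ?thesis using \<theta> \<eta> by blast
qed

definition oscillation_decrease ::
    "'a::euclidean_space itself \<Rightarrow> real \<Rightarrow> real \<Rightarrow> real \<Rightarrow> real \<Rightarrow> real \<Rightarrow> bool" where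
  "oscillation_decrease _ s lam Lam \<theta> \<eta> \<longleftrightarrow>
    (\<forall>\<rho> r (K :: 'a::euclidean_space \<Rightarrow> 'a \<Rightarrow> real \<Rightarrow> real) \<Omega> I f u x0 t0 A B.
      0 < \<rho> \<longrightarrow> \<rho> \<le> r \<longrightarrow> admissible_kernel s lam Lam \<rho> K \<longrightarrow>
      viscosity_inequality s K \<Omega> I f u \<longrightarrow> viscosity_inequality s K \<Omega> I (\<lambda>q. - f q) (\<lambda>q. - u q) \<longrightarrow>
      ball x0 r \<subseteq> \<Omega> \<longrightarrow> {t0 - r powr (2 * s)..t0} \<subseteq> I \<longrightarrow>
      continuous_on (cball x0 r \<times> {t0 - r powr (2 * s)..t0}) u \<longrightarrow> A < B \<longrightarrow>
      (\<forall>x. \<forall>t\<in>{t0 - r powr (2 * s)..t0}. norm (x - x0) < 2 * r \<longrightarrow> A \<le> u (x, t) \<and> u (x, t) \<le> B) \<longrightarrow>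
      (\<forall>x. \<forall>t\<in>{t0 - r powr (2 * s)..t0}. 2 * r \<le> norm (x - x0) \<longrightarrow>
          A - \<eta> * (B - A) * (norm (x - x0) / r) powr s \<le> u (x, t) \<and>
          u (x, t) \<le> B + \<eta> * (B - A) * (norm (x - x0) / r) powr s) \<longrightarrow>
      (\<forall>x\<in>ball x0 r. \<forall>t\<in>{t0 - r powr (2 * s)..t0}. \<bar>f (x, t)\<bar> \<le> \<eta> * (B - A) * r powr (- 2 * s)) \<longrightarrow>
      (\<forall>x. \<forall>t\<in>{t0 - r powr (2 * s) / 2..t0}. norm (x - x0) \<le> r / 2 \<longrightarrow> u (x, t) \<le> B - \<theta> * (B - A)) \<or>
      (\<forall>x. \<forall>t\<in>{t0 - r powr (2 * s) / 2..t0}. norm (x - x0) \<le> r / 2 \<longrightarrow> A + \<theta> * (B - A) \<le> u (x, t)))"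

text \<open>The masses of \<open>B - u\<close> and \<open>u - A\<close> add up to that of the constant
\<open>B - A\<close>, so one of them is large enough for \<open>point_estimate\<close>, applied to
\<open>u\<close> or to \<open>- u\<close>.\<close>

lemma oscillation_step:
  fixes s lam Lam :: real
  assumes s: "0 < s" "s < 1" and lam: "0 < lam" "0 < Lam"
  shows "\<exists>\<theta> \<eta>. 0 < \<theta> \<and> \<theta> < 1 \<and> 0 < \<eta> \<and>
    oscillation_decrease TYPE('a::euclidean_space) s lam Lam \<theta> \<eta>"
proof -
  let ?w = "unit_ball_vol (real DIM('a))"
  obtain \<theta> \<eta> where \<theta>: "0 < \<theta>" "\<theta> < 1" "0 < \<eta>" and point: "pointwise_decrease TYPE('a) s lam Lam \<theta> \<eta>"
    using point_estimate[OF s lam, where 'a='a] by blast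
  note point = point[unfolded pointwise_decrease_def, rule_format]
  have main: "(\<forall>x. \<forall>t\<in>{t0 - r powr (2 * s) / 2..t0}. norm (x - x0) \<le> r / 2 \<longrightarrow> u (x, t) \<le> B - \<theta> * (B - A)) \<or>
      (\<forall>x. \<forall>t\<in>{t0 - r powr (2 * s) / 2..t0}. norm (x - x0) \<le> r / 2 \<longrightarrow> A + \<theta> * (B - A) \<le> u (x, t))"
    if \<rho>: "0 < \<rho>" "\<rho> \<le> r" and K: "admissible_kernel s lam Lam \<rho> K"
      and visc: "viscosity_inequality s K \<Omega> I f u" "viscosity_inequality s K \<Omega> I (\<lambda>q. - f q) (\<lambda>q. - u q)"
      and dom: "ball x0 r \<subseteq> \<Omega>" "{t0 - r powr (2 * s)..t0} \<subseteq> I"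
      and cont: "continuous_on (cball x0 r \<times> {t0 - r powr (2 * s)..t0}) u" and AB: "A < B"
      and bounds: "\<forall>x. \<forall>t\<in>{t0 - r powr (2 * s)..t0}. norm (x - x0) < 2 * r \<longrightarrow> A \<le> u (x, t) \<and> u (x, t) \<le> B"
      and growth: "\<forall>x. \<forall>t\<in>{t0 - r powr (2 * s)..t0}. 2 * r \<le> norm (x - x0) \<longrightarrow>
          A - \<eta> * (B - A) * (norm (x - x0) / r) powr s \<le> u (x, t) \<and>
          u (x, t) \<le> B + \<eta> * (B - A) * (norm (x - x0) / r) powr s"
      and f: "\<forall>x\<in>ball x0 r. \<forall>t\<in>{t0 - r powr (2 * s)..t0}. \<bar>f (x, t)\<bar> \<le> \<eta> * (B - A) * r powr (- 2 * s)"
    for \<rho> r and K :: "'a \<Rightarrow> 'a \<Rightarrow> real \<Rightarrow> real" and \<Omega> I f u x0 t0 A B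
  proof -
    define D where "D = B - A"
    have D: "0 < D" using AB by (simp add: D_def)
    have r: "0 < r" using \<rho> by simp
    define h where "h = r powr (2 * s)"
    have h: "0 < h" using r by (simp add: h_def)
    let ?J = "{t0 - h..t0 - h / 2}"
    define g where "g t = (LINT x|lebesgue. indicator (ball x0 r) x * (B - u (x, t)))" for t
    define g' where "g' t = (LINT x|lebesgue. indicator (ball x0 r) x * (- A - - u (x, t)))" for t
    have cont': "continuous_on (cball x0 r \<times> {t0 - h..t0}) (\<lambda>q. - u q)"
      using cont by (intro continuous_intros) (simp add: h_def)
    have "g integrable_on ?J" "g' integrable_on ?J"
      unfolding g_def g'_def using h
      by (intro integrable_continuous_real continuous_on_subset[OF slice_integral_continuous[OF cont[folded h_def]]]
          continuous_on_subset[OF slice_integral_continuous[OF cont']]; force)+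
    then have "integral ?J g + integral ?J g' = integral ?J (\<lambda>t. g t + g' t)"
      by (simp add: integral_add)
    also have "\<dots> = integral ?J (\<lambda>t. D * (?w * r ^ DIM('a)))"
    proof (rule integral_cong)
      fix t assume "t \<in> ?J"
      then have t: "t \<in> {t0 - h..t0}" using h by auto
      have sl: "continuous_on (cball x0 r) (\<lambda>x. l + c * u (x, t))" for l c
        using t by (intro continuous_intros continuous_on_compose2[OF cont[folded h_def]]) auto
      have "g t + g' t = (LINT x|lebesgue. indicator (ball x0 r) x * (B - u (x, t)) + indicator (ball x0 r) x * (- A - - u (x, t)))"
        unfolding g_def g'_def
        using slice_integrable[OF sl[of B "-1"]] slice_integrable[OF sl[of "- A" 1]] by simp
      also have "\<dots> = (LINT x|lebesgue. D * indicator (ball x0 r) x)"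
        by (intro Bochner_Integration.integral_cong) (auto simp: D_def indicator_def)
      also have "\<dots> = D * (?w * r ^ DIM('a))" using r by (simp add: content_ball)
      finally show "g t + g' t = D * (?w * r ^ DIM('a))" .
    qed
    also have "\<dots> = 2 * (D / 4 * (?w * r ^ DIM('a)) * h)" using h by (simp add: field_simps)
    finally consider "D / 4 * (?w * r ^ DIM('a)) * h \<le> integral ?J g" | "D / 4 * (?w * r ^ DIM('a)) * h \<le> integral ?J g'"
      by linarith
    then show ?thesis
    proof cases
      case 1
      have "u (x, t) \<le> B - \<theta> * D" if "t \<in> {t0 - r powr (2 * s) / 2..t0}" "norm (x - x0) \<le> r / 2" for x t
        by (rule point[OF \<rho> K visc(1) dom cont D _ _ _ _ that])
          (use bounds growth f 1 in \<open>auto simp: D_def g_def[abs_def] h_def abs_le_iff\<close>)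
      then show ?thesis by (simp add: D_def)
    next
      case 2
      have "- u (x, t) \<le> - A - \<theta> * D" if "t \<in> {t0 - r powr (2 * s) / 2..t0}" "norm (x - x0) \<le> r / 2" for x t
      proof (rule point[OF \<rho> K visc(2) dom cont'[unfolded h_def] D _ _ _ _ that])
        fix x t assume "t \<in> {t0 - r powr (2 * s)..t0}" "2 * r \<le> norm (x - x0)"
        then have "A - \<eta> * (B - A) * (norm (x - x0) / r) powr s \<le> u (x, t)" using growth by blast
        then show "- u (x, t) \<le> - A + \<eta> * D * (norm (x - x0) / r) powr s"
          unfolding D_def by linarith
      qed (use bounds f 2 in \<open>auto simp: D_def g'_def[abs_def] h_def abs_le_iff\<close>)
      then have "A + \<theta> * D \<le> u (x, t)" if "t \<in> {t0 - r powr (2 * s) / 2..t0}" "norm (x - x0) \<le> r / 2" for x t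
        using that by fastforce
      then show ?thesis unfolding D_def by blast
    qed
  qed
  have "oscillation_decrease TYPE('a) s lam Lam \<theta> \<eta>"
    unfolding oscillation_decrease_def by (intro allI impI) (rule main; assumption)
  then show ?thesis using \<theta> by blast
qed

section \<open>Iteration over the scales\<close>

text \<open>Functions of small power growth are close to constants, with an error that the kernel can integrate.\<close>

lemma powr_minus_one_le:
  fixes X \<alpha> s :: real
  assumes "1 \<le> X" "0 < \<alpha>" "\<alpha> \<le> s / 2"
  shows "X powr \<alpha> - 1 \<le> 2 * \<alpha> / s * X powr s"
proof -
  define l where "l = ln X"
  have l: "0 \<le> l" using assms by (simp add: l_def)
  have s: "0 < s" using assms by simp
  have X: "X powr c = exp (c * l)" for c using assms by (simp add: powr_def l_def)
  have "1 - \<alpha> * l \<le> exp (- (\<alpha> * l))" using exp_ge_add_one_self[of "- (\<alpha> * l)"] by simp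
  then have "(1 - \<alpha> * l) * exp (\<alpha> * l) \<le> exp (- (\<alpha> * l)) * exp (\<alpha> * l)"
    by (intro mult_right_mono) auto
  also have "\<dots> = 1" by (simp flip: exp_add)
  finally have "exp (\<alpha> * l) - 1 \<le> \<alpha> * l * exp (\<alpha> * l)" by (simp add: algebra_simps)
  also have "\<dots> \<le> \<alpha> * (2 / s * exp (s / 2 * l)) * exp (s / 2 * l)"
  proof (intro mult_mono)
    have "s / 2 * l \<le> exp (s / 2 * l)" using exp_ge_add_one_self[of "s / 2 * l"] by linarith
    then show "l \<le> 2 / s * exp (s / 2 * l)" using s by (simp add: field_simps)
    show "exp (\<alpha> * l) \<le> exp (s / 2 * l)" using mult_right_mono[OF assms(3) l] by simp
  qed (use assms s l in auto)
  also have "\<dots> = 2 * \<alpha> / s * exp (s * l)" by (simp add: mult.assoc flip: exp_add)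
  finally show ?thesis by (simp add: X)
qed

text \<open>The bound for \<open>u\<close> above its lower bound, at distance \<open>d\<close> from the center, that
is available after \<open>k\<close> steps. The second branch does not depend on \<open>k\<close>: at a
point between two consecutive scales nothing is gained after the step at which it leaves the cylinder.\<close>

definition envelope :: "real \<Rightarrow> real \<Rightarrow> real \<Rightarrow> real \<Rightarrow> nat \<Rightarrow> real \<Rightarrow> real" where
  "envelope \<alpha> q r0 A0 k d =
     (if d < 2 * (q ^ k * r0) then A0 * (q powr \<alpha>) ^ k else A0 * (d / (2 * q * r0)) powr \<alpha>)"

lemma power_powr_swap: "0 < (q::real) \<Longrightarrow> (q ^ k) powr \<alpha> = (q powr \<alpha>) ^ k"
  by (simp add: powr_powr mult.commute flip: powr_realpow)

text \<open>At scale \<open>q ^ k * r0\<close> the envelope exceeds the oscillation by a small multiple of it, times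
a power of the distance that the kernel can integrate.\<close>

lemma envelope_growth:
  assumes q: "0 < q" "q \<le> 1/4" and r0: "0 < r0" and A0: "0 < A0"
    and \<alpha>: "0 < \<alpha>" "\<alpha> \<le> s / 2" "2 * \<alpha> / s * (1 / (2 * q)) powr s \<le> \<eta>"
    and d: "2 * (q ^ k * r0) \<le> d"
  shows "envelope \<alpha> q r0 A0 k d
    \<le> A0 * (q powr \<alpha>) ^ k + \<eta> * (A0 * (q powr \<alpha>) ^ k) * (d / (q ^ k * r0)) powr s"
proof -
  let ?r = "q ^ k * r0" and ?D = "A0 * (q powr \<alpha>) ^ k"
  let ?Y = "d / ?r"
  have r: "0 < ?r" using q r0 by simp
  have D: "0 < ?D" using q A0 by simp
  have Y: "2 \<le> ?Y" using d r by (simp add: divide_simps)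
  have X: "1 \<le> ?Y / (2 * q)"
  proof -
    have "1 * (2 * q) \<le> ?Y" using Y q by linarith
    then show ?thesis using q by (subst le_divide_eq) simp
  qed
  have "d / (2 * q * r0) = q ^ k * (?Y / (2 * q))" using q r0 by simp
  then have "envelope \<alpha> q r0 A0 k d = A0 * (q ^ k * (?Y / (2 * q))) powr \<alpha>"
    using d by (simp add: envelope_def)
  also have "\<dots> = ?D * (?Y / (2 * q)) powr \<alpha>"
    unfolding powr_mult power_powr_swap[OF q(1)] by simp
  also have "\<dots> \<le> ?D * (1 + 2 * \<alpha> / s * (?Y / (2 * q)) powr s)"
    using powr_minus_one_le[OF X \<alpha>(1,2)] D by (intro mult_left_mono) auto
  also have "(?Y / (2 * q)) powr s = (1 / (2 * q)) powr s * ?Y powr s"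
    unfolding powr_mult[symmetric] by (simp add: mult_ac)
  also have "?D * (1 + 2 * \<alpha> / s * ((1 / (2 * q)) powr s * ?Y powr s))
      = ?D + ?D * (2 * \<alpha> / s * (1 / (2 * q)) powr s * ?Y powr s)"
    by (simp only: distrib_left mult_1_right mult.assoc)
  also have "\<dots> \<le> ?D + ?D * (\<eta> * ?Y powr s)"
    using \<alpha>(3) D by (intro add_left_mono mult_left_mono mult_right_mono) auto
  finally show ?thesis by (simp add: mult_ac)
qed

lemma envelope_Suc_far:
  assumes "0 < q" "q \<le> 1" "0 < r0" "2 * (q ^ k * r0) \<le> d"
  shows "envelope \<alpha> q r0 A0 (Suc k) d = envelope \<alpha> q r0 A0 k d"
proof -
  have "q ^ Suc k * r0 \<le> q ^ k * r0"
    using assms by (intro mult_right_mono power_decreasing) auto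
  then have "\<not> d < 2 * (q ^ Suc k * r0)" "\<not> d < 2 * (q ^ k * r0)" using assms by linarith+
  then show ?thesis unfolding envelope_def by simp
qed

lemma envelope_Suc_mid:
  assumes "0 < q" "0 < r0" "0 < A0" "0 < \<alpha>" "2 * (q ^ Suc k * r0) \<le> d"
  shows "A0 * (q powr \<alpha>) ^ k \<le> envelope \<alpha> q r0 A0 (Suc k) d"
proof -
  have "q ^ k \<le> d / (2 * q * r0)" using assms by (simp add: le_divide_eq mult_ac)
  then have "(q ^ k) powr \<alpha> \<le> (d / (2 * q * r0)) powr \<alpha>"
    using assms by (intro powr_mono2) auto
  then show ?thesis using assms by (simp add: envelope_def power_powr_swap)
qed

text \<open>The invariant bounds \<open>u\<close> at all points of space, so that it yields the growth outside the
cylinder which the next step needs. A step that improves the upper bound keeps \<open>A\<close>, and one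
that improves the lower bound keeps the upper bound \<open>A + D\<close>; the envelope is unchanged
outside the old cylinder and contains the old bounds between the two cylinders.\<close>

lemma oscillation_decay:
  fixes u f :: "'a::euclidean_space \<times> real \<Rightarrow> real"
  assumes osc: "oscillation_decrease TYPE('a) s lam Lam \<theta> \<eta>" and \<theta>: "0 < \<theta>" "0 < \<eta>"
    and s: "0 < s" and q: "0 < q" "q \<le> 1/4" "q powr (2 * s) \<le> 1/2"
    and \<alpha>: "0 < \<alpha>" "\<alpha> \<le> s / 2" "2 * \<alpha> / s * (1 / (2 * q)) powr s \<le> \<eta>" "1 - \<theta> \<le> q powr \<alpha>"
    and \<rho>: "0 < \<rho>" and K: "admissible_kernel s lam Lam \<rho> K"
    and visc: "viscosity_inequality s K \<Omega> I f u" "viscosity_inequality s K \<Omega> I (\<lambda>q. - f q) (\<lambda>q. - u q)"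
    and r0: "0 < r0" and dom: "ball x0 r0 \<subseteq> \<Omega>" "{t0 - r0 powr (2 * s)..t0} \<subseteq> I"
    and cont: "continuous_on (cball x0 r0 \<times> {t0 - r0 powr (2 * s)..t0}) u"
    and A0: "0 < A0" and u: "\<And>x t. t \<in> {t0 - r0 powr (2 * s)..t0} \<Longrightarrow> \<bar>u (x, t)\<bar> \<le> A0 / 2"
    and f: "\<And>x t. x \<in> ball x0 r0 \<Longrightarrow> t \<in> {t0 - r0 powr (2 * s)..t0} \<Longrightarrow> \<bar>f (x, t)\<bar> \<le> \<eta> * A0 * r0 powr (- 2 * s)"
    and "\<forall>j<k. \<rho> \<le> q ^ j * r0"
  shows "\<exists>A. \<forall>x. \<forall>t\<in>{t0 - (q ^ k * r0) powr (2 * s)..t0}.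
    A + A0 * (q powr \<alpha>) ^ k - envelope \<alpha> q r0 A0 k (norm (x - x0)) \<le> u (x, t) \<and>
    u (x, t) \<le> A + envelope \<alpha> q r0 A0 k (norm (x - x0))"
  using \<open>\<forall>j<k. \<rho> \<le> q ^ j * r0\<close>
proof (induction k)
  case 0
  show ?case
  proof (intro exI[of _ "- A0 / 2"] allI ballI)
    fix x t assume t: "t \<in> {t0 - (q ^ 0 * r0) powr (2 * s)..t0}"
    have "A0 \<le> envelope \<alpha> q r0 A0 0 (norm (x - x0))"
    proof (cases "norm (x - x0) < 2 * r0")
      case False
      have "2 * q * r0 \<le> 2 * r0" using q r0 by (intro mult_right_mono) auto
      then have "2 * q * r0 \<le> norm (x - x0)" using False by linarith
      then have "1 \<le> norm (x - x0) / (2 * q * r0)" using q r0 by (simp add: le_divide_eq)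
      then show ?thesis using False A0 \<alpha> by (simp add: envelope_def ge_one_powr_ge_zero)
    qed (simp add: envelope_def)
    moreover have "\<bar>u (x, t)\<bar> \<le> A0 / 2" using u t by simp
    ultimately show "- A0 / 2 + A0 * (q powr \<alpha>) ^ 0 - envelope \<alpha> q r0 A0 0 (norm (x - x0)) \<le> u (x, t) \<and>
        u (x, t) \<le> - A0 / 2 + envelope \<alpha> q r0 A0 0 (norm (x - x0))"
      unfolding power_0 mult_1_right by linarith
  qed
next
  case (Suc k)
  define r where "r = q ^ k * r0"
  define D where "D = A0 * (q powr \<alpha>) ^ k"
  define h where "h = r powr (2 * s)"
  let ?E = "\<lambda>x. envelope \<alpha> q r0 A0 k (norm (x - x0))" and ?E' = "\<lambda>x. envelope \<alpha> q r0 A0 (Suc k) (norm (x - x0))"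
  have "q ^ k \<le> 1" using q by (intro power_le_one) auto
  then have r: "0 < r" "r \<le> r0" using q r0 by (auto simp: r_def)
  have D: "0 < D" using q A0 by (simp add: D_def)
  have h: "h \<le> r0 powr (2 * s)" using r s by (auto simp: h_def intro!: powr_mono2)
  have "\<forall>j<k. \<rho> \<le> q ^ j * r0" and \<rho>r: "\<rho> \<le> r" using Suc.prems by (auto simp: r_def)
  then obtain A where "\<forall>x. \<forall>t\<in>{t0 - h..t0}. A + D - ?E x \<le> u (x, t) \<and> u (x, t) \<le> A + ?E x"
    using Suc.IH unfolding r_def[symmetric] D_def[symmetric] h_def[symmetric] by blast
  then have A: "A + D - ?E x \<le> u (x, t)" "u (x, t) \<le> A + ?E x" if "t \<in> {t0 - h..t0}" for x t
    using that by blast+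
  have E_near: "?E x = D" if "norm (x - x0) < 2 * r" for x
    using that by (simp add: envelope_def D_def r_def)
  have growth: "?E x \<le> D + \<eta> * D * (norm (x - x0) / r) powr s" if "2 * r \<le> norm (x - x0)" for x
    using envelope_growth[OF q(1,2) r0 A0 \<alpha>(1-3)] that by (simp add: D_def r_def)
  have fr: "\<bar>f (x, t)\<bar> \<le> \<eta> * D * r powr (- 2 * s)" if "x \<in> ball x0 r" "t \<in> {t0 - h..t0}" for x t
  proof -
    have "1 \<le> (q ^ k) powr (\<alpha> - 2 * s)"
      using q \<alpha> s \<open>q ^ k \<le> 1\<close> powr_mono'[of "\<alpha> - 2 * s" 0 "q ^ k"] by simp
    then have "\<eta> * A0 * r0 powr (- 2 * s) * 1 \<le> \<eta> * A0 * r0 powr (- 2 * s) * (q ^ k) powr (\<alpha> - 2 * s)"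
      using \<theta> A0 by (intro mult_left_mono) auto
    also have "(q ^ k) powr (\<alpha> - 2 * s) = (q ^ k) powr \<alpha> * (q ^ k) powr (- 2 * s)"
      by (simp flip: powr_add)
    also have "\<eta> * A0 * r0 powr (- 2 * s) * ((q ^ k) powr \<alpha> * (q ^ k) powr (- 2 * s))
        = \<eta> * D * r powr (- 2 * s)"
      unfolding r_def powr_mult D_def power_powr_swap[OF q(1), symmetric] by simp
    finally show ?thesis using f[of x t] that r h by auto
  qed
  have AD: "A < A + D" using D by simp
  have "(\<forall>x. \<forall>t\<in>{t0 - h / 2..t0}. norm (x - x0) \<le> r / 2 \<longrightarrow> u (x, t) \<le> A + D - \<theta> * (A + D - A)) \<or>
      (\<forall>x. \<forall>t\<in>{t0 - h / 2..t0}. norm (x - x0) \<le> r / 2 \<longrightarrow> A + \<theta> * (A + D - A) \<le> u (x, t))"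
    unfolding h_def
  proof (rule osc[unfolded oscillation_decrease_def, rule_format, OF \<rho> \<rho>r K visc _ _ _ AD])
    show "ball x0 r \<subseteq> \<Omega>" using dom(1) r by (meson subset_ball order_trans)
    show "{t0 - r powr (2 * s)..t0} \<subseteq> I" using dom(2) h by (auto simp: h_def)
    show "continuous_on (cball x0 r \<times> {t0 - r powr (2 * s)..t0}) u"
      using r h by (intro continuous_on_subset[OF cont] Sigma_mono) (auto simp: h_def)
    fix x t assume t: "t \<in> {t0 - r powr (2 * s)..t0}"
    note t' = t[folded h_def]
    show "A \<le> u (x, t) \<and> u (x, t) \<le> A + D" if "norm (x - x0) < 2 * r"
      using A[OF t', of x] E_near[OF that] by simp
    show "A - \<eta> * (A + D - A) * (norm (x - x0) / r) powr s \<le> u (x, t) \<and>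
          u (x, t) \<le> A + D + \<eta> * (A + D - A) * (norm (x - x0) / r) powr s" if "2 * r \<le> norm (x - x0)"
      using A[OF t', of x] growth[OF that] by simp
    show "\<bar>f (x, t)\<bar> \<le> \<eta> * (A + D - A) * r powr (- 2 * s)" if "x \<in> ball x0 r"
      using fr[OF that t'] by simp
  qed
  then consider
      (up) "\<And>x t. t \<in> {t0 - h / 2..t0} \<Longrightarrow> norm (x - x0) \<le> r / 2 \<Longrightarrow> u (x, t) \<le> A + D - \<theta> * D"
    | (down) "\<And>x t. t \<in> {t0 - h / 2..t0} \<Longrightarrow> norm (x - x0) \<le> r / 2 \<Longrightarrow> A + \<theta> * D \<le> u (x, t)"
    by (simp only: add_diff_cancel_left') blast
  moreover define D' where "D' = A0 * (q powr \<alpha>) ^ Suc k"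
  have D': "(1 - \<theta>) * D \<le> D'" "D' \<le> D"
  proof -
    have "D' = q powr \<alpha> * D" by (simp add: D'_def D_def)
    moreover have "q powr \<alpha> \<le> 1" using q \<alpha> powr_mono'[of 0 \<alpha> q] by simp
    ultimately show "(1 - \<theta>) * D \<le> D'" "D' \<le> D"
      using \<alpha>(4) D mult_right_mono[of "1 - \<theta>" "q powr \<alpha>" D] by (auto simp: mult_le_cancel_right1)
  qed
  have rS: "q ^ Suc k * r0 = q * r" by (simp add: r_def)
  have hS: "(q ^ Suc k * r0) powr (2 * s) \<le> h / 2"
    unfolding rS powr_mult h_def using mult_right_mono[OF q(3), of "r powr (2 * s)"] by simp
  have time: "t \<in> {t0 - h / 2..t0}" "t \<in> {t0 - h..t0}" if "t \<in> {t0 - (q ^ Suc k * r0) powr (2 * s)..t0}" for t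
    using that hS powr_ge_zero[of r "2 * s"] by (auto simp: h_def)
  have qr: "2 * (q * r) \<le> r / 2" using mult_right_mono[OF q(2), of "2 * r"] r by simp
  \<comment> \<open>Either the point is in the new cylinder, or the new envelope contains both the old
    one and the old oscillation.\<close>
  have E': "?E' x = D' \<and> norm (x - x0) \<le> r / 2 \<and> ?E x = D \<or> D \<le> ?E' x \<and> ?E x \<le> ?E' x" for x
  proof (cases "norm (x - x0) < 2 * (q * r)")
    case True
    then have "norm (x - x0) < 2 * r" using qr r by linarith
    then have "?E x = D" by (rule E_near)
    moreover have "?E' x = D'" using True by (simp add: envelope_def D'_def r_def mult_ac)
    ultimately show ?thesis using True qr by simp
  next
    case False
    then have *: "D \<le> ?E' x"
      unfolding D_def using q r0 A0 \<alpha> rS by (intro envelope_Suc_mid) auto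
    moreover have "?E x \<le> ?E' x"
    proof (cases "norm (x - x0) < 2 * r")
      case True
      then show ?thesis using E_near[OF True] * by simp
    next
      case False
      then show ?thesis using q r0 by (simp add: envelope_Suc_far r_def)
    qed
    ultimately show ?thesis by blast
  qed
  show ?case
    using calculation
  proof cases
    case up
    show ?thesis
      unfolding D'_def[symmetric]
    proof (intro exI[of _ A] allI ballI)
      fix x t assume "t \<in> {t0 - (q ^ Suc k * r0) powr (2 * s)..t0}"
      note t = time[OF this]
      show "A + D' - ?E' x \<le> u (x, t) \<and> u (x, t) \<le> A + ?E' x"
        using E'[of x] A[OF t(2), of x] up[OF t(1), of x] D' by (auto simp: algebra_simps)
    qed
  next
    case down
    show ?thesis
      unfolding D'_def[symmetric]
    proof (intro exI[of _ "A + D - D'"] allI ballI)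
      fix x t assume "t \<in> {t0 - (q ^ Suc k * r0) powr (2 * s)..t0}"
      note t = time[OF this]
      show "A + D - D' + D' - ?E' x \<le> u (x, t) \<and> u (x, t) \<le> A + D - D' + ?E' x"
        using E'[of x] A[OF t(2), of x] down[OF t(1), of x] D' by (auto simp: algebra_simps)
    qed
  qed
qed

section \<open>From decay of the oscillation to the Hoelder estimate\<close>

lemma scale_between:
  fixes q r0 d :: real
  assumes "0 < q" "q < 1" "0 < d" "d \<le> r0"
  shows "\<exists>k. d \<le> q ^ k * r0 \<and> q ^ Suc k * r0 < d"
proof -
  define k where "k = (LEAST k. q ^ Suc k * r0 < d)"
  have r0: "0 < r0" using assms by simp
  obtain n where "q ^ n < d / r0" using real_arch_pow_inv[of "d / r0" q] assms by auto
  then have "q ^ n * r0 < d" using r0 by (simp add: less_divide_eq)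
  moreover have "q ^ Suc n * r0 \<le> q ^ n * r0"
    using assms r0 by (intro mult_right_mono power_decreasing) auto
  ultimately have "q ^ Suc n * r0 < d" by linarith
  then have 1: "q ^ Suc k * r0 < d" unfolding k_def by (rule LeastI)
  have "d \<le> q ^ k * r0"
  proof (cases k)
    case 0 then show ?thesis using assms by simp
  next
    case (Suc j)
    then have "\<not> q ^ Suc j * r0 < d" using not_less_Least[of j "\<lambda>k. q ^ Suc k * r0 < d"] k_def by simp
    then show ?thesis using Suc by simp
  qed
  then show ?thesis using 1 by blast
qed

text \<open>The center is the later of the two points, since the cylinders extend backwards in time. The scales down
to the one comparable with the distance \<open>d\<close> are all at least \<open>d\<close>, hence larger
than \<open>\<rho>\<close>.\<close>

lemma holder_from_decay:
  fixes u :: "'a::euclidean_space \<times> real \<Rightarrow> real"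
  assumes s: "0 < s" and q: "0 < q" "q < 1" and \<alpha>: "0 < \<alpha>" and r0: "0 < r0" and A0: "0 < A0"
    and \<rho>: "0 < \<rho>" and d: "\<rho> < par_dist s (x0, t0) (x, t)" and t: "t \<le> t0"
    and bound: "\<bar>u (x0, t0)\<bar> \<le> A0 / 2" "\<bar>u (x, t)\<bar> \<le> A0 / 2"
    and decay: "\<And>k. \<forall>j<k. \<rho> \<le> q ^ j * r0 \<Longrightarrow> \<exists>A. \<forall>x. \<forall>t\<in>{t0 - (q ^ k * r0) powr (2 * s)..t0}.
      A + A0 * (q powr \<alpha>) ^ k - envelope \<alpha> q r0 A0 k (norm (x - x0)) \<le> u (x, t) \<and>
      u (x, t) \<le> A + envelope \<alpha> q r0 A0 k (norm (x - x0))"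
  shows "\<bar>u (x0, t0) - u (x, t)\<bar> \<le> A0 * (par_dist s (x0, t0) (x, t) / (q * r0)) powr \<alpha>"
proof -
  define d where "d = par_dist s (x0, t0) (x, t)"
  have d0: "0 < d" "\<rho> < d" using d \<rho> by (auto simp: d_def)
  have dx: "norm (x - x0) \<le> d" and dt: "(t0 - t) powr (1 / (2 * s)) \<le> d"
    using t by (auto simp: d_def par_dist_def norm_minus_commute)
  have "\<bar>u (x0, t0) - u (x, t)\<bar> \<le> A0 * (d / (q * r0)) powr \<alpha>"
  proof (cases "d \<le> r0")
    case True
    then obtain k where k: "d \<le> q ^ k * r0" "q ^ Suc k * r0 < d"
      using scale_between[OF q d0(1)] by blast
    have "\<forall>j<k. \<rho> \<le> q ^ j * r0"
    proof (intro allI impI)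
      fix j assume "j < k"
      then have "q ^ k * r0 \<le> q ^ j * r0" using q r0 by (intro mult_right_mono power_decreasing) auto
      then show "\<rho> \<le> q ^ j * r0" using k d0 by linarith
    qed
    from decay[OF this] obtain A where A: "\<And>x t. t \<in> {t0 - (q ^ k * r0) powr (2 * s)..t0} \<Longrightarrow>
        A + A0 * (q powr \<alpha>) ^ k - envelope \<alpha> q r0 A0 k (norm (x - x0)) \<le> u (x, t) \<and>
        u (x, t) \<le> A + envelope \<alpha> q r0 A0 k (norm (x - x0))"
      by blast
    have pos: "0 < q ^ k * r0" using q r0 by simp
    have "t0 - t = ((t0 - t) powr (1 / (2 * s))) powr (2 * s)"
      using t s by (simp add: powr_powr)
    also have "\<dots> \<le> (q ^ k * r0) powr (2 * s)"
      using dt k s by (intro powr_mono2) auto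
    finally have "t \<in> {t0 - (q ^ k * r0) powr (2 * s)..t0}" "t0 \<in> {t0 - (q ^ k * r0) powr (2 * s)..t0}"
      using t by auto
    then have "\<bar>u (x0, t0) - u (x, t)\<bar> \<le> A0 * (q powr \<alpha>) ^ k"
      using A[of t x] A[of t0 x0] dx k pos by (auto simp: envelope_def abs_le_iff)
    also have "\<dots> = A0 * (q ^ k) powr \<alpha>" using q by (simp add: power_powr_swap)
    also have "\<dots> \<le> A0 * (d / (q * r0)) powr \<alpha>"
      using k(2) q r0 A0 \<alpha> by (intro mult_left_mono powr_mono2) (auto simp: le_divide_eq mult_ac)
    finally show ?thesis .
  next
    case False
    moreover have "q * r0 \<le> 1 * r0" using q r0 by (intro mult_right_mono) auto
    ultimately have "q * r0 \<le> d" by linarith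
    then have "1 \<le> d / (q * r0)" using q r0 by simp
    then have "A0 * 1 \<le> A0 * (d / (q * r0)) powr \<alpha>"
      using A0 \<alpha> by (intro mult_left_mono ge_one_powr_ge_zero) auto
    then show ?thesis using bound by linarith
  qed
  then show ?thesis by (simp add: d_def)
qed

lemma Linfty_norm_ge:
  assumes "g \<in> Linfty S" "p \<in> S" shows "\<bar>g p\<bar> \<le> Linfty_norm S g"
proof -
  obtain B where "\<forall>q\<in>S. \<bar>g q\<bar> \<le> B" using assms(1) by (auto simp: Linfty_def bounded_iff)
  then show ?thesis
    unfolding Linfty_norm_def using assms(2) by (intro cSUP_upper bdd_aboveI2[where M = B]) auto
qed

lemma par_dist_commute: "par_dist s p q = par_dist s q p"
  by (simp add: par_dist_def norm_minus_commute abs_minus_commute)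

text \<open>The ratio \<open>q\<close> of consecutive scales must make the next cylinder fit into the one on which
the bound improves, and \<open>\<alpha>\<close> must be small for the growth outside and for the decay of
the oscillation.\<close>

lemma exponents_exist:
  fixes s \<theta> \<eta> :: real
  assumes "0 < s" "0 < \<theta>" "\<theta> < 1" "0 < \<eta>"
  shows "\<exists>q \<alpha>. 0 < q \<and> q \<le> 1/4 \<and> q powr (2 * s) \<le> 1/2 \<and> 0 < \<alpha> \<and> \<alpha> \<le> s / 2 \<and>
    2 * \<alpha> / s * (1 / (2 * q)) powr s \<le> \<eta> \<and> 1 - \<theta> \<le> q powr \<alpha>"
proof -
  define q where "q = min (1/4) ((1/2::real) powr (1 / (2 * s)))"
  have q: "0 < q" "q \<le> 1/4" by (auto simp: q_def)
  have "q powr (2 * s) \<le> ((1/2) powr (1 / (2 * s))) powr (2 * s)"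
    using q assms by (intro powr_mono2) (auto simp: q_def)
  also have "\<dots> = 1/2" using assms by (simp add: powr_powr)
  finally have q2: "q powr (2 * s) \<le> 1/2" .
  define T where "T = (1 / (2 * q)) powr s"
  have T: "0 < T" using q by (simp add: T_def)
  have lnq: "ln q < 0" using q by simp
  have lnt: "ln (1 - \<theta>) < 0" using assms by simp
  have pos: "0 < \<eta> * s / (2 * T)" "0 < ln (1 - \<theta>) / ln q"
    using assms T lnq lnt by (auto simp: divide_neg_neg)
  define \<alpha> where "\<alpha> = min (s / 2) (min (\<eta> * s / (2 * T)) (ln (1 - \<theta>) / ln q))"
  have \<alpha>: "0 < \<alpha>" "\<alpha> \<le> s / 2" "\<alpha> \<le> \<eta> * s / (2 * T)" "\<alpha> \<le> ln (1 - \<theta>) / ln q"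
    unfolding \<alpha>_def using assms(1) pos by linarith+
  have "2 * \<alpha> / s * T \<le> \<eta>" using \<alpha>(3) T assms by (simp add: field_simps)
  moreover have "ln (1 - \<theta>) \<le> \<alpha> * ln q" using \<alpha>(4) lnq by (simp add: le_divide_eq)
  then have "exp (ln (1 - \<theta>)) \<le> exp (\<alpha> * ln q)" unfolding exp_le_cancel_iff .
  then have "1 - \<theta> \<le> q powr \<alpha>" using assms q by (simp add: powr_def)
  ultimately show ?thesis using q q2 \<alpha>(1,2) unfolding T_def by blast
qed

theorem theorem1p1:
  fixes s lam Lam :: real
  assumes "0 < s" "s < 1" and "0 < lam" "lam < Lam"
  shows "\<exists>\<alpha> C. 0 < \<alpha> \<and> \<alpha> < 2 * s \<and> C > 0 \<and>
    (\<forall>(\<rho>::real) (R::real) (K :: 'a::euclidean_space \<Rightarrow> 'a \<Rightarrow> real \<Rightarrow> real)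
        (f :: 'a \<times> real \<Rightarrow> real) (u :: 'a \<times> real \<Rightarrow> real).
       0 < \<rho> \<and> \<rho> < R \<and> admissible_kernel s lam Lam \<rho> K \<and>
       f \<in> Linfty (ball 0 R \<times> time_interval s R) \<and>
       u \<in> Linfty (UNIV \<times> time_interval s R) \<and>
       viscosity_solution s K (ball 0 R) (time_interval s R) f u
       \<longrightarrow>
       holder_above s \<alpha> \<rho> (ball 0 (R / 2) \<times> time_interval s (R / 2)) u
         \<le> ereal (C / R powr \<alpha> *
              (Linfty_norm (UNIV \<times> time_interval s R) u
               + R powr (2 * s) * Linfty_norm (ball 0 R \<times> time_interval s R) f)))"
proof -
  have s: "0 < s" "s < 1" and Lam: "0 < Lam" using assms by auto
  obtain \<theta> \<eta> where \<theta>: "0 < \<theta>" "\<theta> < 1" "0 < \<eta>" and osc: "oscillation_decrease TYPE('a) s lam Lam \<theta> \<eta>"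
    using oscillation_step[OF s assms(3) Lam, where 'a='a] by blast
  obtain q \<alpha> where q: "0 < q" "q \<le> 1/4" "q powr (2 * s) \<le> 1/2"
    and \<alpha>: "0 < \<alpha>" "\<alpha> \<le> s / 2" "2 * \<alpha> / s * (1 / (2 * q)) powr s \<le> \<eta>" "1 - \<theta> \<le> q powr \<alpha>"
    using exponents_exist[OF s(1) \<theta>] by blast
  \<comment> \<open>Around every point of the half cylinder, the cylinder of radius \<open>c * R\<close>
    (and duration \<open>(c * R) powr (2 * s)\<close>) fits into the domain of the equation.\<close>
  define c where "c = min (1/4) ((1 - (1/2) powr (2 * s)) powr (1 / (2 * s)))"
  have half: "(1/2::real) powr (2 * s) < 1" using s by (simp add: powr_divide)
  have c: "0 < c" "c \<le> 1/4" using half by (auto simp: c_def)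
  have c2: "c powr (2 * s) \<le> 1 - (1/2) powr (2 * s)"
  proof -
    have "c powr (2 * s) \<le> ((1 - (1/2) powr (2 * s)) powr (1 / (2 * s))) powr (2 * s)"
      using c s by (intro powr_mono2) (auto simp: c_def)
    also have "\<dots> = 1 - (1/2) powr (2 * s)" using s half by (simp add: powr_powr)
    finally show ?thesis .
  qed
  define C where "C = (2 + 1 / \<eta>) / (q * c) powr \<alpha>"
  have C: "0 < C" using \<theta> q c by (simp add: C_def add_pos_pos)
  have "\<alpha> < 2 * s" using \<alpha> s by simp
  moreover have "holder_above s \<alpha> \<rho> (ball 0 (R / 2) \<times> time_interval s (R / 2)) u
         \<le> ereal (C / R powr \<alpha> *
              (Linfty_norm (UNIV \<times> time_interval s R) u
               + R powr (2 * s) * Linfty_norm (ball 0 R \<times> time_interval s R) f))"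
    if \<rho>: "0 < \<rho>" "\<rho> < R" and K: "admissible_kernel s lam Lam \<rho> K"
      and f: "f \<in> Linfty (ball 0 R \<times> time_interval s R)" and u: "u \<in> Linfty (UNIV \<times> time_interval s R)"
      and sol: "viscosity_solution s K (ball 0 R) (time_interval s R) f u"
    for \<rho> R and K :: "'a \<Rightarrow> 'a \<Rightarrow> real \<Rightarrow> real" and f u
  proof -
    let ?I = "time_interval s R"
    define U where "U = Linfty_norm (UNIV \<times> ?I) u"
    define F where "F = Linfty_norm (ball 0 R \<times> ?I) f"
    define Z where "Z = U + R powr (2 * s) * F"
    have R: "0 < R" using \<rho> by simp
    have U: "\<bar>u (x, t)\<bar> \<le> U" if "t \<in> ?I" for x t
      unfolding U_def using that by (intro Linfty_norm_ge[OF u]) auto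
    have F: "\<bar>f (x, t)\<bar> \<le> F" if "x \<in> ball 0 R" "t \<in> ?I" for x t
      unfolding F_def using that by (intro Linfty_norm_ge[OF f]) auto
    have 0: "0 \<in> ?I" using R by (simp add: time_interval_def)
    have U0: "0 \<le> U" and F0: "0 \<le> F"
      using U[OF 0, of 0] F[OF _ 0, of 0] R by (auto intro: order_trans[OF abs_ge_zero])
    have visc: "viscosity_inequality s K (ball 0 R) ?I f u"
        "viscosity_inequality s K (ball 0 R) ?I (\<lambda>q. - f q) (\<lambda>q. - u q)"
      using sol viscosity_inequality_subsolution[OF assms K] viscosity_inequality_supersolution[OF assms K]
      by (auto simp: viscosity_solution_def)
    have cont: "continuous_on (ball 0 R \<times> ?I) u"
      using sol by (intro continuous_on_if_semicontinuous)
        (auto simp: viscosity_solution_def viscosity_subsolution_def viscosity_supersolution_def)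
    define r0 where "r0 = c * R"
    have r0: "0 < r0" "r0 \<le> R / 4" using c R mult_right_mono[OF c(2), of R] by (auto simp: r0_def)
    have half_R: "(R / 2) powr (2 * s) = (1/2) powr (2 * s) * R powr (2 * s)"
      using R by (simp add: powr_divide)
    have r0R: "r0 powr (2 * s) \<le> R powr (2 * s) - (R / 2) powr (2 * s)"
      unfolding r0_def powr_mult half_R using mult_right_mono[OF c2, of "R powr (2 * s)"] by (simp add: algebra_simps)
    have pair: "\<bar>u (x0, t0) - u (x, t)\<bar> \<le> C / R powr \<alpha> * Z * par_dist s (x0, t0) (x, t) powr \<alpha>"
      if x0: "x0 \<in> ball 0 (R / 2)" and t0: "t0 \<in> time_interval s (R / 2)" and t: "t \<in> ?I" "t \<le> t0"
        and d: "\<rho> < par_dist s (x0, t0) (x, t)" for x0 t0 x t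
    \<comment> \<open>The iteration needs a positive initial oscillation; if the data vanish, so does
      \<open>u\<close>.\<close>
    proof (cases "Z = 0")
      case True
      have "0 \<le> R powr (2 * s) * F" using F0 by simp
      then have "U = 0" using True U0 unfolding Z_def by linarith
      moreover have "t0 \<in> ?I" using t t0 by (auto simp: time_interval_def)
      ultimately show ?thesis using U[of t x] U[of t0 x0] t True by simp
    next
      case False
      define A0 where "A0 = (2 + 1 / \<eta>) * Z"
      have RF: "0 \<le> R powr (2 * s) * F" using F0 by simp
      then have Z: "0 < Z" using False U0 unfolding Z_def by linarith
      have A0: "0 < A0" using Z \<theta> by (simp add: A0_def add_pos_pos)
      have A0_ge: "2 * U \<le> A0" "R powr (2 * s) * F \<le> \<eta> * A0"
      proof -
        have "2 * U \<le> 2 * Z" using RF by (simp add: Z_def)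
        also have "\<dots> \<le> A0" unfolding A0_def using Z \<theta> by (intro mult_right_mono) auto
        finally show "2 * U \<le> A0" .
        have "R powr (2 * s) * F \<le> Z" using U0 by (simp add: Z_def)
        also have "\<dots> \<le> 2 * \<eta> * Z + Z" using Z \<theta> by simp
        also have "\<dots> = \<eta> * A0" using \<theta> by (simp add: A0_def field_simps)
        finally show "R powr (2 * s) * F \<le> \<eta> * A0" .
      qed
      let ?J = "{t0 - r0 powr (2 * s)..t0}"
      have J: "?J \<subseteq> ?I" using t0 r0R by (auto simp: time_interval_def)
      have cb: "cball x0 r0 \<subseteq> ball 0 R"
      proof
        fix y assume "y \<in> cball x0 r0"
        then show "y \<in> ball 0 R" using x0 r0 R norm_triangle_ineq[of x0 "y - x0"]
          by (simp add: dist_norm norm_minus_commute)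
      qed
      have "\<bar>u (x0, t0) - u (x, t)\<bar> \<le> A0 * (par_dist s (x0, t0) (x, t) / (q * r0)) powr \<alpha>"
      proof (rule holder_from_decay[OF s(1) q(1) _ \<alpha>(1) r0(1) A0 \<rho>(1) d t(2)])
        fix k assume k: "\<forall>j<k. \<rho> \<le> q ^ j * r0"
        show "\<exists>A. \<forall>x. \<forall>t\<in>{t0 - (q ^ k * r0) powr (2 * s)..t0}.
            A + A0 * (q powr \<alpha>) ^ k - envelope \<alpha> q r0 A0 k (norm (x - x0)) \<le> u (x, t) \<and>
            u (x, t) \<le> A + envelope \<alpha> q r0 A0 k (norm (x - x0))"
        proof (rule oscillation_decay[OF osc \<theta>(1,3) s(1) q \<alpha> \<rho>(1) K visc r0(1) _ J _ A0 _ _ k])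
          show "ball x0 r0 \<subseteq> ball 0 R" using cb ball_subset_cball by blast
          show "continuous_on (cball x0 r0 \<times> ?J) u"
            using cb J by (intro continuous_on_subset[OF cont] Sigma_mono) auto
          show "\<bar>u (y, \<tau>)\<bar> \<le> A0 / 2" if "\<tau> \<in> ?J" for y \<tau>
            using U[of \<tau> y] J that A0_ge by auto
          show "\<bar>f (y, \<tau>)\<bar> \<le> \<eta> * A0 * r0 powr (- 2 * s)" if "y \<in> ball x0 r0" "\<tau> \<in> ?J" for y \<tau>
          proof -
            have "y \<in> ball 0 R" "\<tau> \<in> ?I" using that cb ball_subset_cball J by blast+
            then have "\<bar>f (y, \<tau>)\<bar> \<le> F" by (rule F)
            also have "F = R powr (2 * s) * F * R powr (- 2 * s)"
              using R by (simp add: powr_minus)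
            also have "\<dots> \<le> \<eta> * A0 * r0 powr (- 2 * s)"
            proof (rule mult_mono[OF A0_ge(2)])
              show "R powr (- 2 * s) \<le> r0 powr (- 2 * s)" using r0 s by (intro powr_mono2') auto
            qed (use \<theta> A0 in auto)
            finally show ?thesis .
          qed
        qed
      next
        have "t0 \<in> ?I" using J by auto
        then show "\<bar>u (x0, t0)\<bar> \<le> A0 / 2" "\<bar>u (x, t)\<bar> \<le> A0 / 2"
          using U[of t0 x0] U[of t x] A0_ge t(1) by auto
      qed (use q in auto)
      also have "par_dist s (x0, t0) (x, t) / (q * r0) = par_dist s (x0, t0) (x, t) * (1 / ((q * c) * R))"
        by (simp add: r0_def)
      also have "A0 * \<dots> powr \<alpha> = C / R powr \<alpha> * Z * par_dist s (x0, t0) (x, t) powr \<alpha>"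
        unfolding powr_mult using q c R by (simp add: powr_divide powr_mult A0_def C_def)
      finally show ?thesis .
    qed
    have sub: "time_interval s (R / 2) \<subseteq> ?I"
    proof -
      have "(R / 2) powr (2 * s) \<le> R powr (2 * s)" using R s by (intro powr_mono2) auto
      then show ?thesis by (auto simp: time_interval_def)
    qed
    show ?thesis
      unfolding holder_above_def U_def[symmetric] F_def[symmetric] Z_def[symmetric]
    proof (rule SUP_least, clarify)
      fix x0 x :: 'a and t0 t
      assume x: "x0 \<in> ball 0 (R / 2)" "x \<in> ball 0 (R / 2)"
        and t: "t0 \<in> time_interval s (R / 2)" "t \<in> time_interval s (R / 2)"
        and d: "\<rho> < par_dist s (x0, t0) (x, t)"
      have "\<bar>u (x0, t0) - u (x, t)\<bar> \<le> C / R powr \<alpha> * Z * par_dist s (x0, t0) (x, t) powr \<alpha>"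
      proof (cases "t \<le> t0")
        case True
        then show ?thesis using pair x t d sub by blast
      next
        case False
        then have "\<bar>u (x, t) - u (x0, t0)\<bar> \<le> C / R powr \<alpha> * Z * par_dist s (x, t) (x0, t0) powr \<alpha>"
          using x t d sub by (intro pair) (auto simp: par_dist_commute[of s "(x, t)"])
        then show ?thesis by (simp add: par_dist_commute[of s "(x, t)"] abs_minus_commute)
      qed
      then show "ereal (\<bar>u (x0, t0) - u (x, t)\<bar> / par_dist s (x0, t0) (x, t) powr \<alpha>) \<le> ereal (C / R powr \<alpha> * Z)"
        using d \<rho> by (simp add: divide_le_eq)
    qed
  qed
  ultimately show ?thesis using \<alpha>(1) C by blast
qed

end
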